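(* Assume (R1) and let $f\in\mathscr C^1(\mathbb R^d,\mathbb R)$ be Lipschitz continuous with constant $[\dot f]_\infty$. For all positive integers $m$, $L$ and $N_0,\dots,N_L$, the multilevel Monte Carlo estimator $\hat Q$ satisfies $$\mathbb E\left[\left(\hat Q-\mathbb E[f(X_T)]\right)^2\right]\le[\dot f]_\infty^2\left(\frac{K_{1,\infty}T^2}{m^{2L}}+\frac T{N_0}+\sum_{\ell=1}^L\frac{K_{1,m}(m-1)T^2}{N_\ell m^{2\ell-1}}\right).$$
   Context: $d\ge1$, $T\in(0,\infty)$, $x_0\in\mathbb R^d$, $W$ is a $d$-dimensional Brownian motion, $b:\mathbb R^d\to\mathbb R^d$, and $X$ solves $dX_t=b(X_t)dt+dW_t$, $X_0=x_0$. For an integer $n\ge1$, $X^n$ is the Euler scheme driven by the same $W$: $dX^n_t=b(X^n_{\eta_n(t)})dt+dW_t$, $X^n_0=x_0$, $\eta_n(t)=\lfloor nt/T\rfloor T/n$. $|\cdot|$ is the Euclidean norm, $\|\cdot\|$ the induced matrix norm, $\nabla b$ the Jacobian matrix, $\Delta b$ the coordinatewise Laplacian. Multilevel estimator: $\hat Q=\frac1{N_0}\sum_{k=1}^{N_0}f(X^1_{T,k})+\sum_{\ell=1}^L\frac1{N_\ell}\sum_{k=1}^{N_\ell}\big(f(X^{m^\ell}_{T,k})-f(X^{m^{\ell-1}}_{T,k})\big)$, where all samples, for different $k$ and for different levels $\ell$, are independent, and for fixed $(\ell,k)$, $\ell\ge1$, the pair $(X^{m^\ell}_{T,k},X^{m^{\ell-1}}_{T,k})$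 is a copy of $(X^{m^\ell}_T,X^{m^{\ell-1}}_T)$ (same Brownian path). Assumption (R1): $b\in\mathscr C^2(\mathbb R^d,\mathbb R^d)$ and there are constants $[\dot b]_\infty\in(0,\infty)$, $a_{\Delta b}\in[0,\infty)$ such that for all $x$, $\|\nabla b(x)\|\le[\dot b]_\infty$ and $|\Delta b(x)|\le2a_{\Delta b}(1+|x-x_0|)$. Constants: for $m\in\{1,2,\dots\}\cup\{\infty\}$ (ratios in $m$ being replaced by their limits when $m=\infty$), with $C_A=\sqrt T+[\dot b]_\infty\int_0^Te^{[\dot b]_\infty(T-t)}\sqrt t\,dt$, $$\sqrt{K_{1,m}}=C_A[\dot b]_\infty\sqrt{\tfrac{d(2m-1)}{6m}}+e^{[\dot b]_\infty T}\sqrt{\tfrac{m-1}m}\Big(\tfrac{|b(x_0)|}2\big(a_{\Delta b}\tfrac{[\dot b]_\infty T-1+e^{-[\dot b]_\infty T}}{[\dot b]_\infty^2}+[\dot b]_\infty T\big)+a_{\Delta b}\tfrac{1-e^{-[\dot b]_\infty T}}{[\dot b]_\infty}+\tfrac23\sqrt d([\dot b]_\infty^2+a_{\Delta b})T^{3/2}\Big).$$ *)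

theory Defs
  imports "HOL-Probability.Probability" "HOL-Library.Extended_Nat"
    "HOL-Real_Asymp.Real_Asymp"
begin

definition C1_map :: "('a::real_normed_vector \<Rightarrow> 'b::real_normed_vector) \<Rightarrow> bool" where
  "C1_map g \<longleftrightarrow> (\<exists>g' :: 'a \<Rightarrow> 'a \<Rightarrow>\<^sub>L 'b.
     (\<forall>x. (g has_derivative blinfun_apply (g' x)) (at x)) \<and> continuous_on UNIV g')"

definition C2_map :: "('a::real_normed_vector \<Rightarrow> 'b::real_normed_vector) \<Rightarrow> bool" where
  "C2_map g \<longleftrightarrow> (\<exists>g' :: 'a \<Rightarrow> 'a \<Rightarrow>\<^sub>L 'b.
     (\<forall>x. (g has_derivative blinfun_apply (g' x)) (at x)) \<and> C1_map g')"

definition partial_deriv :: "'d \<Rightarrow> (real ^ 'd::finite \<Rightarrow> real) \<Rightarrow> real ^ 'd \<Rightarrow> real" where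
  "partial_deriv j g x = deriv (\<lambda>t. g (x + t *\<^sub>R axis j 1)) 0"

definition laplacian :: "(real ^ 'd::finite \<Rightarrow> real ^ 'e::finite) \<Rightarrow> real ^ 'd \<Rightarrow> real ^ 'e" where
  "laplacian g x =
     (\<chi> i. \<Sum>j\<in>UNIV. partial_deriv j (partial_deriv j (\<lambda>y. g y $ i)) x)"

text \<open>\<open>Lb\<close> and \<open>a\<close> are the constants written $[\dot b]_\infty$ and $a_{\Delta b}$ in the
  literature; \<open>onorm\<close> of the matrix action is the matrix norm induced by the Euclidean norm.\<close>

definition R1 :: "(real ^ 'd::finite \<Rightarrow> real ^ 'd) \<Rightarrow> real ^ 'd \<Rightarrow> real \<Rightarrow> real \<Rightarrow> bool" where
  "R1 b x0 Lb a \<longleftrightarrow> C2_map b \<and> 0 < Lb \<and> 0 \<le> a \<and>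
     (\<forall>x. onorm (\<lambda>v. jacobian b (at x) *v v) \<le> Lb) \<and>
     (\<forall>x. norm (laplacian b x) \<le> 2 * a * (1 + norm (x - x0)))"

definition brownian_motion :: "'w measure \<Rightarrow> (real \<Rightarrow> 'w \<Rightarrow> real ^ 'd::finite) \<Rightarrow> bool" where
  "brownian_motion M W \<longleftrightarrow> prob_space M \<and>
     (\<forall>t\<ge>0. W t \<in> borel_measurable M) \<and>
     (AE \<omega> in M. W 0 \<omega> = 0) \<and>
     (AE \<omega> in M. continuous_on {0..} (\<lambda>t. W t \<omega>)) \<and>
     (\<forall>(n::nat) t. 0 \<le> t 0 \<and> (\<forall>i<n. t i \<le> t (Suc i)) \<longrightarrow>
        prob_space.indep_vars M (\<lambda>_. borel) (\<lambda>i \<omega>. W (t (Suc i)) \<omega> - W (t i) \<omega>) {..<n}) \<and>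
     (\<forall>s t. 0 \<le> s \<and> s < t \<longrightarrow>
        prob_space.indep_vars M (\<lambda>_. borel) (\<lambda>j \<omega>. (W t \<omega> - W s \<omega>) $ j) UNIV \<and>
        (\<forall>j. distributed M lborel (\<lambda>\<omega>. (W t \<omega> - W s \<omega>) $ j)
               (\<lambda>x. ennreal (normal_density 0 (sqrt (t - s)) x))))"

text \<open>The relation \<open>dY_t = \<beta>_t dt + dW_t\<close>, \<open>Y_0 = x0\<close> on \<open>[0,T]\<close>. The noise is additive, so the
  equation is a pathwise integral equation and no stochastic integral is involved.\<close>

definition additive_noise_process ::
  "'w measure \<Rightarrow> (real \<Rightarrow> 'w \<Rightarrow> real ^ 'd::finite) \<Rightarrow> real \<Rightarrow> real ^ 'd \<Rightarrow>
   (real \<Rightarrow> 'w \<Rightarrow> real ^ 'd) \<Rightarrow> (real \<Rightarrow> 'w \<Rightarrow> real ^ 'd) \<Rightarrow> bool" where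
  "additive_noise_process M W T x0 \<beta> Y \<longleftrightarrow>
     (\<forall>t\<in>{0..T}. Y t \<in> borel_measurable M) \<and>
     (AE \<omega> in M. continuous_on {0..T} (\<lambda>t. Y t \<omega>)) \<and>
     (AE \<omega> in M. \<forall>t\<in>{0..T}. (\<lambda>s. \<beta> s \<omega>) integrable_on {0..t} \<and>
        Y t \<omega> = x0 + integral {0..t} (\<lambda>s. \<beta> s \<omega>) + W t \<omega>)"

definition sde_solution ::
  "'w measure \<Rightarrow> (real \<Rightarrow> 'w \<Rightarrow> real ^ 'd::finite) \<Rightarrow> (real ^ 'd \<Rightarrow> real ^ 'd) \<Rightarrow> real ^ 'd \<Rightarrow> real \<Rightarrow>
   (real \<Rightarrow> 'w \<Rightarrow> real ^ 'd) \<Rightarrow> bool" where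
  "sde_solution M W b x0 T X \<longleftrightarrow>
     additive_noise_process M W T x0 (\<lambda>s \<omega>. b (X s \<omega>)) X"

definition euler_grid :: "real \<Rightarrow> nat \<Rightarrow> real \<Rightarrow> real" where
  "euler_grid T n t = of_int \<lfloor>real n * t / T\<rfloor> * T / real n"

definition euler_scheme ::
  "'w measure \<Rightarrow> (real \<Rightarrow> 'w \<Rightarrow> real ^ 'd::finite) \<Rightarrow> (real ^ 'd \<Rightarrow> real ^ 'd) \<Rightarrow> real ^ 'd \<Rightarrow> real \<Rightarrow>
   nat \<Rightarrow> (real \<Rightarrow> 'w \<Rightarrow> real ^ 'd) \<Rightarrow> bool" where
  "euler_scheme M W b x0 T n Y \<longleftrightarrow>
     additive_noise_process M W T x0 (\<lambda>s \<omega>. b (Y (euler_grid T n s) \<omega>)) Y"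

text \<open>\<open>F l k\<close> and \<open>C l k\<close> are the \<open>k\<close>-th samples of the fine scheme (\<open>m ^ l\<close> steps) and of the coarse
  scheme (\<open>m ^ (l - 1)\<close> steps) at level \<open>l\<close>; \<open>C 0 k\<close> is never used. The samples live on a
  probability space \<open>P\<close> which need not be the space \<open>M\<close> carrying the schemes \<open>Xe n\<close>. In the
  independence clause, the missing coarse sample at level \<open>0\<close> is replaced by a constant, so that
  the independent blocks are \<open>F 0 k\<close> and the pairs \<open>(F l k, C l k)\<close> for \<open>l \<ge> 1\<close>;
  \<open>indep_vars\<close> includes the measurability of all of them.\<close>

definition mlmc_samples ::
  "'v measure \<Rightarrow> 'w measure \<Rightarrow> (nat \<Rightarrow> real \<Rightarrow> 'w \<Rightarrow> real ^ 'd::finite) \<Rightarrow> real \<Rightarrow>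
   nat \<Rightarrow> nat \<Rightarrow> (nat \<Rightarrow> nat) \<Rightarrow>
   (nat \<Rightarrow> nat \<Rightarrow> 'v \<Rightarrow> real ^ 'd) \<Rightarrow> (nat \<Rightarrow> nat \<Rightarrow> 'v \<Rightarrow> real ^ 'd) \<Rightarrow> bool" where
  "mlmc_samples P M Xe T m L N F C \<longleftrightarrow> prob_space P \<and>
     (\<forall>k\<in>{1..N 0}. distr P borel (F 0 k) = distr M borel (Xe 1 T)) \<and>
     (\<forall>l\<in>{1..L}. \<forall>k\<in>{1..N l}.
        distr P borel (\<lambda>\<omega>. (F l k \<omega>, C l k \<omega>)) =
        distr M borel (\<lambda>\<omega>. (Xe (m ^ l) T \<omega>, Xe (m ^ (l - 1)) T \<omega>))) \<and>
     prob_space.indep_vars P (\<lambda>_. borel)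
       (\<lambda>(l, k) \<omega>. (F l k \<omega>, if l = 0 then 0 else C l k \<omega>))
       (SIGMA l:{0..L}. {1..N l})"

definition mlmc_estimator ::
  "(real ^ 'd::finite \<Rightarrow> real) \<Rightarrow> nat \<Rightarrow> (nat \<Rightarrow> nat) \<Rightarrow>
   (nat \<Rightarrow> nat \<Rightarrow> 'v \<Rightarrow> real ^ 'd) \<Rightarrow> (nat \<Rightarrow> nat \<Rightarrow> 'v \<Rightarrow> real ^ 'd) \<Rightarrow> 'v \<Rightarrow> real" where
  "mlmc_estimator f L N F C \<omega> =
     1 / real (N 0) * (\<Sum>k=1..N 0. f (F 0 k \<omega>)) +
     (\<Sum>l=1..L. 1 / real (N l) * (\<Sum>k=1..N l. f (F l k \<omega>) - f (C l k \<omega>)))"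

definition CA_const :: "real \<Rightarrow> real \<Rightarrow> real" where
  "CA_const Lb T = sqrt T + Lb * integral {0..T} (\<lambda>t. exp (Lb * (T - t)) * sqrt t)"

definition ratio_A :: "enat \<Rightarrow> real" where
  "ratio_A m = (case m of enat k \<Rightarrow> (2 * real k - 1) / (6 * real k) | \<infinity> \<Rightarrow> 1 / 3)"

definition ratio_B :: "enat \<Rightarrow> real" where
  "ratio_B m = (case m of enat k \<Rightarrow> (real k - 1) / real k | \<infinity> \<Rightarrow> 1)"

definition sqrt_K1 ::
  "(real ^ 'd::finite \<Rightarrow> real ^ 'd) \<Rightarrow> real ^ 'd \<Rightarrow> real \<Rightarrow> real \<Rightarrow> real \<Rightarrow> enat \<Rightarrow> real" where
  "sqrt_K1 b x0 Lb a T m =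
     CA_const Lb T * Lb * sqrt (real CARD('d) * ratio_A m) +
     exp (Lb * T) * sqrt (ratio_B m) *
       (norm (b x0) / 2 * (a * ((Lb * T - 1 + exp (- (Lb * T))) / Lb\<^sup>2) + Lb * T) +
        a * ((1 - exp (- (Lb * T))) / Lb) +
        2 / 3 * sqrt (real CARD('d)) * (Lb\<^sup>2 + a) * T powr (3 / 2))"

definition K1 ::
  "(real ^ 'd::finite \<Rightarrow> real ^ 'd) \<Rightarrow> real ^ 'd \<Rightarrow> real \<Rightarrow> real \<Rightarrow> real \<Rightarrow> enat \<Rightarrow> real" where
  "K1 b x0 Lb a T m = (sqrt_K1 b x0 Lb a T m)\<^sup>2"

text \<open>The values at \<open>\<infinity>\<close> are the limits of the finite ones.\<close>

lemma ratio_A_tendsto: "(\<lambda>k. ratio_A (enat k)) \<longlonglongrightarrow> ratio_A \<infinity>"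
  unfolding ratio_A_def by simp real_asymp

lemma ratio_B_tendsto: "(\<lambda>k. ratio_B (enat k)) \<longlonglongrightarrow> ratio_B \<infinity>"
  unfolding ratio_B_def by simp real_asymp

lemma K1_tendsto: "(\<lambda>k. K1 b x0 Lb a T (enat k)) \<longlonglongrightarrow> K1 b x0 Lb a T \<infinity>"
  unfolding K1_def sqrt_K1_def
  by (intro tendsto_intros ratio_A_tendsto ratio_B_tendsto)

end

theory Submission
  imports Defs
begin
text \<open>The terminal values of the Euler schemes depend only on finitely many Brownian increments, so
  the strong error can be estimated in discrete time, without stochastic integrals. For the scheme
  \<open>Y\<close> with \<open>n m\<close> steps of length \<open>h\<close>, each increment \<open>b(Y_{j+1}) - b(Y_j)\<close> is split into a martingale
  difference and its conditional mean. The Gaussian Poincare inequality bounds the conditional variance of the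
  former by \<open>d h Lb^2\<close>; the latter is \<open>O(h)\<close> because \<open>E g(y + V) - g(y)\<close> is a time integral of
  expectations of \<open>\<Delta> g\<close>, by Gaussian integration by parts. Summation by parts and the discrete Gronwall
  inequality then give the constant \<open>K1\<close> for the distance to the scheme with \<open>n\<close> steps. The schemes
  converge pathwise to the solution, so letting \<open>m\<close> tend to infinity and applying Fatou's lemma yields
  the error against the solution itself. Finally, the mean square error is the squared bias plus the sum
  of the variances of the independent samples; at level \<open>0\<close> the variance is bounded by the Poincare
  inequality once more.\<close>

section \<open>Square-integrable random vectors and independence\<close>

text \<open>A plain Lipschitz bound on \<open>b (Y (Suc j)) - b (Y j)\<close> is only of order sqrt
  h, and adding such norms would give strong order 1/2. The centred parts have to be added in mean
  square, where orthogonality replaces a sum by the root of a sum of squares; the conditional means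
  have to be of order h, which is what the Laplacian bound provides. Since the noise is additive,
  the Brownian terms of the two coupled chains cancel and only drift errors inside blocks of m fine
  steps remain. Summation by parts gives the i-th increment of a block the weight h (m - 1 - i).
  With H = m h, the squared weights of a block add up to H^2 m \<open>ratio_A\<close>
  \<open>ratio_B\<close> and their mean is H \<open>ratio_B\<close> / 2. This is the origin of both
  ratios, and it lets one factor sqrt \<open>ratio_B\<close> be split off the whole bound: squared,
  with n = m^(l-1) coarse steps, it yields (m - 1) / m^(2l-1). The exponentials and
  \<open>CA_const\<close> come from the Gronwall kernel (1 + Lb H)^k, whose weighted sums are
  dominated by the integrals in the constant.\<close>

definition sq_int :: "'w measure \<Rightarrow> ('w \<Rightarrow> 'b::euclidean_space) \<Rightarrow> bool" where
  "sq_int M U \<longleftrightarrow> U \<in> borel_measurable M \<and> integrable M (\<lambda>\<omega>. (norm (U \<omega>))\<^sup>2)"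

text \<open>Outside \<open>sq_int\<close> the Bochner integral defaults to 0, so the value behaves
  as a norm only together with \<open>sq_int\<close>; monotonicity and the triangle inequality
  therefore carry it as a hypothesis.\<close>

definition L2 :: "'w measure \<Rightarrow> ('w \<Rightarrow> 'b::euclidean_space) \<Rightarrow> real" where
  "L2 M U = sqrt (\<integral>\<omega>. (norm (U \<omega>))\<^sup>2 \<partial>M)"

text \<open>Unlike \<open>indep_var\<close>, the two random variables may have different types.\<close>

definition indep_pair ::
  "'w measure \<Rightarrow> 'b measure \<Rightarrow> ('w \<Rightarrow> 'b) \<Rightarrow> 'c measure \<Rightarrow> ('w \<Rightarrow> 'c) \<Rightarrow> bool" where
  "indep_pair M S X T Y \<longleftrightarrow> X \<in> measurable M S \<and> Y \<in> measurable M T \<and>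
     distr M S X \<Otimes>\<^sub>M distr M T Y = distr M (S \<Otimes>\<^sub>M T) (\<lambda>\<omega>. (X \<omega>, Y \<omega>))"

lemma sq_int_measurable: "sq_int M U \<Longrightarrow> U \<in> borel_measurable M"
  by (simp add: sq_int_def)

lemma sq_int_integrable: "sq_int M U \<Longrightarrow> integrable M (\<lambda>\<omega>. (norm (U \<omega>))\<^sup>2)"
  by (simp add: sq_int_def)

lemma L2_nonneg[simp]: "0 \<le> L2 M U"
  by (simp add: L2_def)

lemma L2_sq: "(L2 M U)\<^sup>2 = (\<integral>\<omega>. (norm (U \<omega>))\<^sup>2 \<partial>M)"
  by (simp add: L2_def)

lemma sq_int_AE_bound:
  assumes "sq_int M V" "U \<in> borel_measurable M" "AE \<omega> in M. norm (U \<omega>) \<le> norm (V \<omega>)"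
  shows "sq_int M U" "L2 M U \<le> L2 M V"
proof -
  have ae: "AE \<omega> in M. (norm (U \<omega>))\<^sup>2 \<le> (norm (V \<omega>))\<^sup>2"
    using assms(3) by eventually_elim (simp add: power_mono)
  show *: "sq_int M U"
    unfolding sq_int_def
  proof (intro conjI Bochner_Integration.integrable_bound[OF sq_int_integrable[OF assms(1)]])
    show "AE \<omega> in M. norm ((norm (U \<omega>))\<^sup>2) \<le> norm ((norm (V \<omega>))\<^sup>2)" using ae by simp
  qed (use assms(2) in auto)
  show "L2 M U \<le> L2 M V"
    unfolding L2_def
    by (intro real_sqrt_le_mono integral_mono_AE sq_int_integrable assms * ae)
qed

lemma L2_norm: "L2 M (\<lambda>\<omega>. norm (U \<omega>)) = L2 M U"
  by (simp add: L2_def)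

lemma sq_int_norm: "sq_int M U \<Longrightarrow> sq_int M (\<lambda>\<omega>. norm (U \<omega>))"
  by (auto simp: sq_int_def)

lemma sq_int_scaleR: "sq_int M U \<Longrightarrow> sq_int M (\<lambda>\<omega>. c *\<^sub>R U \<omega>)"
  by (auto simp: sq_int_def power_mult_distrib)

lemma L2_scaleR: "L2 M (\<lambda>\<omega>. c *\<^sub>R U \<omega>) = \<bar>c\<bar> * L2 M U"
  by (simp add: L2_def power_mult_distrib real_sqrt_mult)

lemma L2_cmult: "L2 M (\<lambda>\<omega>. c * U \<omega>) = \<bar>c\<bar> * L2 M (U :: _ \<Rightarrow> real)"
  using L2_scaleR[of M c U] by simp

lemma sq_int_cmult: "sq_int M U \<Longrightarrow> sq_int M (\<lambda>\<omega>. c * U \<omega> :: real)"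
  using sq_int_scaleR[of M U c] by simp

lemma norm_add_sq_le: "(norm (x + y))\<^sup>2 \<le> 2 * (norm x)\<^sup>2 + 2 * (norm (y::'a::real_normed_vector))\<^sup>2"
proof -
  have "(norm (x + y))\<^sup>2 \<le> (norm x + norm y)\<^sup>2"
    by (intro power_mono norm_triangle_ineq) auto
  also have "\<dots> \<le> 2 * (norm x)\<^sup>2 + 2 * (norm y)\<^sup>2"
    using zero_le_power2[of "norm x - norm y"] by (simp add: power2_eq_square algebra_simps)
  finally show ?thesis .
qed

lemma sq_int_add:
  assumes U: "sq_int M U" and V: "sq_int M V"
  shows "sq_int M (\<lambda>\<omega>. U \<omega> + V \<omega>)"
  unfolding sq_int_def
proof (rule conjI[OF _ Bochner_Integration.integrable_bound])
  show "integrable M (\<lambda>\<omega>. 2 * (norm (U \<omega>))\<^sup>2 + 2 * (norm (V \<omega>))\<^sup>2)"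
    using sq_int_integrable[OF U] sq_int_integrable[OF V] by auto
  show "AE \<omega> in M. norm ((norm (U \<omega> + V \<omega>))\<^sup>2) \<le> norm (2 * (norm (U \<omega>))\<^sup>2 + 2 * (norm (V \<omega>))\<^sup>2)"
    by (rule AE_I2) (simp add: norm_add_sq_le)
qed (use U V in \<open>auto simp: sq_int_def\<close>)

lemma sq_int_minus: "sq_int M U \<Longrightarrow> sq_int M (\<lambda>\<omega>. - U \<omega>)"
  using sq_int_scaleR[of M U "-1"] by simp

lemma sq_int_diff:
  assumes U: "sq_int M U" and V: "sq_int M V"
  shows "sq_int M (\<lambda>\<omega>. U \<omega> - V \<omega>)"
  using sq_int_add[OF U sq_int_minus[OF V]] by simp

lemma sq_int_zero[simp]: "sq_int M (\<lambda>\<omega>. 0)"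
  by (simp add: sq_int_def)

lemma sq_int_sum: "(\<And>i. i \<in> I \<Longrightarrow> sq_int M (U i)) \<Longrightarrow> sq_int M (\<lambda>\<omega>. \<Sum>i\<in>I. U i \<omega>)"
  by (induction I rule: infinite_finite_induct) (auto intro: sq_int_add)

lemma sq_int_mult_integrable:
  assumes U: "sq_int M U" and V: "sq_int M V"
  shows "integrable M (\<lambda>\<omega>. norm (U \<omega>) * norm (V \<omega>))"
proof (rule Bochner_Integration.integrable_bound)
  show "integrable M (\<lambda>\<omega>. (norm (U \<omega>))\<^sup>2 + (norm (V \<omega>))\<^sup>2)"
    using sq_int_integrable[OF U] sq_int_integrable[OF V] by auto
  have "2 * (u * v) \<le> u\<^sup>2 + v\<^sup>2" for u v :: real
    using zero_le_power2[of "u - v"] by (simp add: power2_eq_square algebra_simps)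
  then have "u * v \<le> u\<^sup>2 + v\<^sup>2" if "0 \<le> u" "0 \<le> v" for u v :: real
    using mult_nonneg_nonneg[OF that] by (smt (verit))
  then show "AE \<omega> in M. norm (norm (U \<omega>) * norm (V \<omega>)) \<le> norm ((norm (U \<omega>))\<^sup>2 + (norm (V \<omega>))\<^sup>2)"
    by (auto intro!: AE_I2)
qed (use U V in \<open>auto simp: sq_int_def\<close>)

lemma sq_int_inner_integrable:
  assumes U: "sq_int M U" and V: "sq_int M V"
  shows "integrable M (\<lambda>\<omega>. U \<omega> \<bullet> V \<omega>)"
proof (rule Bochner_Integration.integrable_bound[OF sq_int_mult_integrable[OF U V]])
  show "AE \<omega> in M. norm (U \<omega> \<bullet> V \<omega>) \<le> norm (norm (U \<omega>) * norm (V \<omega>))"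
    using Cauchy_Schwarz_ineq2 by (auto intro!: AE_I2)
qed (use U V in \<open>auto simp: sq_int_def\<close>)

lemma L2_Cauchy_Schwarz:
  assumes U: "sq_int M U" and V: "sq_int M V"
  shows "(\<integral>\<omega>. norm (U \<omega>) * norm (V \<omega>) \<partial>M) \<le> L2 M U * L2 M V"
proof -
  define A B C where "A = (\<integral>\<omega>. (norm (U \<omega>))\<^sup>2 \<partial>M)" and "B = (\<integral>\<omega>. (norm (V \<omega>))\<^sup>2 \<partial>M)"
    and "C = (\<integral>\<omega>. norm (U \<omega>) * norm (V \<omega>) \<partial>M)"
  note int = sq_int_integrable[OF U] sq_int_integrable[OF V] sq_int_mult_integrable[OF U V]
  have "0 \<le> A" "0 \<le> B" by (simp_all add: A_def B_def)
  have q: "0 \<le> s\<^sup>2 * A - 2 * s * C + B" for s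
  proof -
    have "0 \<le> (\<integral>\<omega>. (s * norm (U \<omega>) - norm (V \<omega>))\<^sup>2 \<partial>M)" by simp
    also have "\<dots> = (\<integral>\<omega>. s\<^sup>2 * (norm (U \<omega>))\<^sup>2 - 2 * s * (norm (U \<omega>) * norm (V \<omega>)) + (norm (V \<omega>))\<^sup>2 \<partial>M)"
      by (intro Bochner_Integration.integral_cong) (auto simp: power2_eq_square algebra_simps)
    also have "\<dots> = s\<^sup>2 * A - 2 * s * C + B"
      using int by (simp add: A_def B_def C_def)
    finally show ?thesis .
  qed
  have "C\<^sup>2 \<le> A * B"
  proof (cases "A = 0")
    case True
    have "C = 0"
    proof (rule ccontr)
      assume "C \<noteq> 0"
      \<comment> \<open>With A = 0 the quadratic is affine in s, and this s gives it the value
        -1.\<close>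
      then show False using q[of "(B + 1) / (2 * C)"] True by simp
    qed
    then show ?thesis using True by simp
  next
    case False
    with \<open>0 \<le> A\<close> have "0 < A" by simp
    \<comment> \<open>C / A minimises the quadratic; the minimum is B - C^2 / A.\<close>
    then show ?thesis using q[of "C / A"]
      by (simp add: power2_eq_square field_simps)
  qed
  then have "C \<le> sqrt (A * B)" by (rule real_le_rsqrt)
  then show ?thesis by (simp add: A_def B_def C_def L2_def real_sqrt_mult)
qed

lemma L2_add_le:
  assumes U: "sq_int M U" and V: "sq_int M V"
  shows "L2 M (\<lambda>\<omega>. U \<omega> + V \<omega>) \<le> L2 M U + L2 M V"
proof -
  note int = sq_int_integrable[OF U] sq_int_integrable[OF V] sq_int_mult_integrable[OF U V]
  have "(L2 M (\<lambda>\<omega>. U \<omega> + V \<omega>))\<^sup>2 \<le> (\<integral>\<omega>. (norm (U \<omega>))\<^sup>2 + 2 * (norm (U \<omega>) * norm (V \<omega>)) + (norm (V \<omega>))\<^sup>2 \<partial>M)"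
    unfolding L2_sq
  proof (intro integral_mono)
    show "integrable M (\<lambda>\<omega>. (norm (U \<omega> + V \<omega>))\<^sup>2)"
      using sq_int_integrable[OF sq_int_add[OF U V]] .
    show "(norm (U \<omega> + V \<omega>))\<^sup>2 \<le> (norm (U \<omega>))\<^sup>2 + 2 * (norm (U \<omega>) * norm (V \<omega>)) + (norm (V \<omega>))\<^sup>2" for \<omega>
      using power_mono[OF norm_triangle_ineq[of "U \<omega>" "V \<omega>"], of 2]
      by (simp add: power2_eq_square algebra_simps)
  qed (use int in auto)
  also have "\<dots> = (L2 M U)\<^sup>2 + 2 * (\<integral>\<omega>. norm (U \<omega>) * norm (V \<omega>) \<partial>M) + (L2 M V)\<^sup>2"
    using int by (simp add: L2_sq)
  also have "\<dots> \<le> (L2 M U + L2 M V)\<^sup>2"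
    using L2_Cauchy_Schwarz[OF U V] by (simp add: power2_eq_square algebra_simps)
  finally show ?thesis
    by (rule power2_le_imp_le) simp
qed

lemma L2_zero[simp]: "L2 M (\<lambda>\<omega>. 0) = 0"
  by (simp add: L2_def)

lemma L2_sum_le:
  "(\<And>i. i \<in> I \<Longrightarrow> sq_int M (U i)) \<Longrightarrow> L2 M (\<lambda>\<omega>. \<Sum>i\<in>I. U i \<omega>) \<le> (\<Sum>i\<in>I. L2 M (U i))"
proof (induction I rule: infinite_finite_induct)
  case (insert x F)
  have "L2 M (\<lambda>\<omega>. U x \<omega> + (\<Sum>i\<in>F. U i \<omega>)) \<le> L2 M (U x) + L2 M (\<lambda>\<omega>. \<Sum>i\<in>F. U i \<omega>)"
    using insert by (intro L2_add_le sq_int_sum) auto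
  also have "\<dots> \<le> L2 M (U x) + (\<Sum>i\<in>F. L2 M (U i))" using insert by simp
  finally show ?case using insert by simp
qed simp_all

context prob_space
begin

lemma sq_int_const[simp]: "sq_int M (\<lambda>\<omega>. c)"
  by (simp add: sq_int_def)

lemma L2_const[simp]: "L2 M (\<lambda>\<omega>. c) = norm c"
  by (simp add: L2_def prob_space)

lemma sq_int_imp_integrable_norm:
  assumes U: "sq_int M U"
  shows "integrable M (\<lambda>\<omega>. norm (U \<omega>))"
  using sq_int_mult_integrable[OF U sq_int_const[of "1::real"]] by simp

lemma sq_int_imp_integrable:
  assumes U: "sq_int M U"
  shows "integrable M U"
  using sq_int_imp_integrable_norm[OF U] U integrable_norm_iff sq_int_measurable by blast

lemma expectation_norm_le_L2:
  assumes U: "sq_int M U"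
  shows "expectation (\<lambda>\<omega>. norm (U \<omega>)) \<le> L2 M U"
  using L2_Cauchy_Schwarz[OF U sq_int_const[of "1::real"]] by simp

lemma sq_int_Lipschitz:
  fixes g :: "'b::euclidean_space \<Rightarrow> 'c::euclidean_space"
  assumes U: "sq_int M U" and g: "K-lipschitz_on UNIV g"
  shows "sq_int M (\<lambda>\<omega>. g (U \<omega>))"
proof (rule sq_int_AE_bound(1))
  show "sq_int M (\<lambda>\<omega>. norm (g 0) + K * norm (U \<omega>))"
    by (intro sq_int_add sq_int_const sq_int_cmult sq_int_norm U)
  have "norm (g x) \<le> norm (g 0) + K * norm x" for x
    using lipschitz_on_normD[OF g, of x 0] norm_triangle_sub[of "g x" "g 0"] by simp
  then have "norm (g x) \<le> norm (norm (g 0) + K * norm x)" for x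
    by (smt (verit) real_norm_def)
  then show "AE \<omega> in M. norm (g (U \<omega>)) \<le> norm (norm (g 0) + K * norm (U \<omega>))"
    by simp
  have "g \<in> borel_measurable borel"
    using g lipschitz_on_continuous_on borel_measurable_continuous_onI by blast
  then show "(\<lambda>\<omega>. g (U \<omega>)) \<in> borel_measurable M" using sq_int_measurable[OF U] by simp
qed

lemma expectation_sq_le:
  assumes U: "sq_int M (U :: _ \<Rightarrow> real)"
  shows "(expectation U)\<^sup>2 \<le> expectation (\<lambda>\<omega>. (U \<omega>)\<^sup>2)"
proof -
  have "variance U = expectation (\<lambda>\<omega>. (U \<omega>)\<^sup>2) - (expectation U)\<^sup>2"
    using sq_int_imp_integrable[OF U] sq_int_integrable[OF U] by (intro variance_eq) simp_all
  then show ?thesis using variance_positive[of U] by linarith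
qed

section \<open>Independent pairs, and iterated integrals in the role of conditional
  expectations\<close>

lemma indep_var_imp_indep_pair: "indep_var S X T Y \<Longrightarrow> indep_pair M S X T Y"
  by (simp add: indep_pair_def indep_var_distribution_eq)

lemma indep_pair_compose:
  assumes ind: "indep_pair M S X T Y"
    and f[measurable]: "f \<in> measurable S S'" and g[measurable]: "g \<in> measurable T T'"
  shows "indep_pair M S' (\<lambda>\<omega>. f (X \<omega>)) T' (\<lambda>\<omega>. g (Y \<omega>))"
proof -
  have X[measurable]: "X \<in> measurable M S" and Y[measurable]: "Y \<in> measurable M T"
    and eq: "distr M S X \<Otimes>\<^sub>M distr M T Y = distr M (S \<Otimes>\<^sub>M T) (\<lambda>x. (X x, Y x))"
    using ind by (auto simp: indep_pair_def)
  have "distr M S' (\<lambda>\<omega>. f (X \<omega>)) \<Otimes>\<^sub>M distr M T' (\<lambda>\<omega>. g (Y \<omega>)) =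
      distr (distr M S X) S' f \<Otimes>\<^sub>M distr (distr M T Y) T' g"
    by (simp add: distr_distr comp_def)
  also have "\<dots> = distr (distr M S X \<Otimes>\<^sub>M distr M T Y) (S' \<Otimes>\<^sub>M T') (\<lambda>(x, y). (f x, g y))"
  proof (intro pair_measure_distr)
    have "prob_space (distr (distr M T Y) T' g)"
      by (intro prob_space.prob_space_distr prob_space_distr) auto
    then show "sigma_finite_measure (distr (distr M T Y) T' g)"
      by (simp add: prob_space_imp_sigma_finite)
  qed auto
  also have "\<dots> = distr M (S' \<Otimes>\<^sub>M T') (\<lambda>\<omega>. (f (X \<omega>), g (Y \<omega>)))"
    unfolding eq by (subst distr_distr) (auto simp: comp_def)
  finally show ?thesis by (simp add: indep_pair_def)
qed

text \<open>Fubini on the product of the two laws. Integrating over a second sample point of the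
  same space with the other variable frozen stands for conditioning; every later conditional mean or
  variance is of this form.\<close>

lemma indep_pair_iterated_integral:
  fixes f :: "'b \<Rightarrow> 'c \<Rightarrow> real"
  assumes ind: "indep_pair M S X T Y"
    and f[measurable]: "case_prod f \<in> borel_measurable (S \<Otimes>\<^sub>M T)"
    and int: "integrable M (\<lambda>\<omega>. f (X \<omega>) (Y \<omega>))"
  shows "integrable M (\<lambda>\<omega>. \<integral>\<omega>'. f (X \<omega>) (Y \<omega>') \<partial>M)"
    and "expectation (\<lambda>\<omega>. f (X \<omega>) (Y \<omega>)) = (\<integral>\<omega>. (\<integral>\<omega>'. f (X \<omega>) (Y \<omega>') \<partial>M) \<partial>M)"
    and "integrable M (\<lambda>\<omega>'. \<integral>\<omega>. f (X \<omega>) (Y \<omega>') \<partial>M)"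
    and "expectation (\<lambda>\<omega>. f (X \<omega>) (Y \<omega>)) = (\<integral>\<omega>'. (\<integral>\<omega>. f (X \<omega>) (Y \<omega>') \<partial>M) \<partial>M)"
proof -
  have X[measurable]: "X \<in> measurable M S" and Y[measurable]: "Y \<in> measurable M T"
    and eq: "distr M S X \<Otimes>\<^sub>M distr M T Y = distr M (S \<Otimes>\<^sub>M T) (\<lambda>x. (X x, Y x))"
    using ind by (auto simp: indep_pair_def)
  interpret X: prob_space "distr M S X" by (rule prob_space_distr) simp
  interpret Y: prob_space "distr M T Y" by (rule prob_space_distr) simp
  interpret XY: pair_sigma_finite "distr M S X" "distr M T Y" ..
  have ints: "integrable (distr M S X \<Otimes>\<^sub>M distr M T Y) (case_prod f)"
    unfolding eq by (subst integrable_distr_eq) (auto simp: int)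
  have E: "expectation (\<lambda>\<omega>. f (X \<omega>) (Y \<omega>)) = integral\<^sup>L (distr M S X \<Otimes>\<^sub>M distr M T Y) (case_prod f)"
    unfolding eq by (subst integral_distr) auto
  have in2: "(\<integral>y. f x y \<partial>distr M T Y) = (\<integral>\<omega>'. f x (Y \<omega>') \<partial>M)" if "x \<in> space S" for x
    using that by (subst integral_distr) auto
  have in1: "(\<integral>x. f x y \<partial>distr M S X) = (\<integral>\<omega>. f (X \<omega>) y \<partial>M)" if "y \<in> space T" for y
    using that by (subst integral_distr) auto
  have m2[measurable]: "(\<lambda>x. \<integral>y. f x y \<partial>distr M T Y) \<in> borel_measurable S" by measurable
  have m1[measurable]: "(\<lambda>y. \<integral>x. f x y \<partial>distr M S X) \<in> borel_measurable T" by measurable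
  have Xs: "X \<omega> \<in> space S" if "\<omega> \<in> space M" for \<omega> using that X by (rule measurable_space[rotated])
  have Ys: "Y \<omega> \<in> space T" if "\<omega> \<in> space M" for \<omega> using that Y by (rule measurable_space[rotated])
  have i2: "integrable M (\<lambda>\<omega>. \<integral>y. f (X \<omega>) y \<partial>distr M T Y)"
    using XY.integrable_fst'[OF ints] by (subst (asm) integrable_distr_eq) auto
  then show "integrable M (\<lambda>\<omega>. \<integral>\<omega>'. f (X \<omega>) (Y \<omega>') \<partial>M)"
    by (rule Bochner_Integration.integrable_cong[THEN iffD1, rotated -1]) (auto simp: in2 Xs)
  have i1: "integrable M (\<lambda>\<omega>. \<integral>x. f x (Y \<omega>) \<partial>distr M S X)"
    using XY.integrable_snd[OF ints] by (subst (asm) integrable_distr_eq) auto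
  then show "integrable M (\<lambda>\<omega>'. \<integral>\<omega>. f (X \<omega>) (Y \<omega>') \<partial>M)"
    by (rule Bochner_Integration.integrable_cong[THEN iffD1, rotated -1]) (auto simp: in1 Ys)
  have "expectation (\<lambda>\<omega>. f (X \<omega>) (Y \<omega>)) = (\<integral>x. (\<integral>y. f x y \<partial>distr M T Y) \<partial>distr M S X)"
    unfolding E using XY.integral_fst'[OF ints] by simp
  also have "\<dots> = (\<integral>\<omega>. (\<integral>y. f (X \<omega>) y \<partial>distr M T Y) \<partial>M)"
    by (subst integral_distr) auto
  also have "\<dots> = (\<integral>\<omega>. (\<integral>\<omega>'. f (X \<omega>) (Y \<omega>') \<partial>M) \<partial>M)"
    by (intro Bochner_Integration.integral_cong refl in2 Xs)
  finally show "expectation (\<lambda>\<omega>. f (X \<omega>) (Y \<omega>)) = (\<integral>\<omega>. (\<integral>\<omega>'. f (X \<omega>) (Y \<omega>') \<partial>M) \<partial>M)" .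
  have "expectation (\<lambda>\<omega>. f (X \<omega>) (Y \<omega>)) = (\<integral>y. (\<integral>x. f x y \<partial>distr M S X) \<partial>distr M T Y)"
    unfolding E using XY.integral_snd[OF ints] by simp
  also have "\<dots> = (\<integral>\<omega>. (\<integral>x. f x (Y \<omega>) \<partial>distr M S X) \<partial>M)"
    by (subst integral_distr) auto
  also have "\<dots> = (\<integral>\<omega>'. (\<integral>\<omega>. f (X \<omega>) (Y \<omega>') \<partial>M) \<partial>M)"
    by (intro Bochner_Integration.integral_cong refl in1 Ys)
  finally show "expectation (\<lambda>\<omega>. f (X \<omega>) (Y \<omega>)) = (\<integral>\<omega>'. (\<integral>\<omega>. f (X \<omega>) (Y \<omega>') \<partial>M) \<partial>M)" .
qed

end

section \<open>The normal distribution on the line\<close>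

lemma DERIV_bounded_linear_growth:
  fixes F :: "real \<Rightarrow> real"
  assumes "\<And>x. (F has_real_derivative F' x) (at x)" "\<And>x. \<bar>F' x\<bar> \<le> K"
  shows "\<bar>F x\<bar> \<le> \<bar>F 0\<bar> + K * \<bar>x\<bar>"
proof -
  have "norm (F x - F 0) \<le> K * norm (x - 0)"
    by (rule field_differentiable_bound[where S=UNIV and f'=F']) (use assms in auto)
  then show ?thesis by simp
qed

lemma normal_density_has_real_derivative:
  assumes "0 < \<sigma>"
  shows "(normal_density 0 \<sigma> has_real_derivative - (x / \<sigma>\<^sup>2) * normal_density 0 \<sigma> x) (at x)"
  unfolding normal_density_def[abs_def]
  using assms by (auto intro!: derivative_eq_intros simp: field_simps power2_eq_square)

lemma normal_density_mult_affine_tendsto_0: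
  assumes "0 < \<sigma>"
  shows "((\<lambda>x. normal_density 0 \<sigma> x * (A + K * \<bar>x\<bar>)) \<longlongrightarrow> 0) at_top"
    and "((\<lambda>x. normal_density 0 \<sigma> x * (A + K * \<bar>x\<bar>)) \<longlongrightarrow> 0) at_bot"
proof -
  have 1: "((\<lambda>x. exp (- x\<^sup>2 / (2 * \<sigma>\<^sup>2))) \<longlongrightarrow> 0) at_top"
    and 2: "((\<lambda>x. exp (- x\<^sup>2 / (2 * \<sigma>\<^sup>2)) * x) \<longlongrightarrow> 0) at_top"
    and 3: "((\<lambda>x. exp (- x\<^sup>2 / (2 * \<sigma>\<^sup>2))) \<longlongrightarrow> 0) at_bot"
    and 4: "((\<lambda>x. exp (- x\<^sup>2 / (2 * \<sigma>\<^sup>2)) * x) \<longlongrightarrow> 0) at_bot"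
    using assms by real_asymp+
  have abs: "((\<lambda>x. exp (- x\<^sup>2 / (2 * \<sigma>\<^sup>2)) * \<bar>x\<bar>) \<longlongrightarrow> 0) at_top"
    "((\<lambda>x. exp (- x\<^sup>2 / (2 * \<sigma>\<^sup>2)) * \<bar>x\<bar>) \<longlongrightarrow> 0) at_bot"
    using tendsto_rabs_zero[OF 2] tendsto_rabs_zero[OF 4] by (simp_all add: abs_mult)
  have eq: "(\<lambda>x. normal_density 0 \<sigma> x * (A + K * \<bar>x\<bar>)) =
     (\<lambda>x. (1 / sqrt (2 * pi * \<sigma>\<^sup>2)) * (A * exp (- x\<^sup>2 / (2 * \<sigma>\<^sup>2)) + K * (exp (- x\<^sup>2 / (2 * \<sigma>\<^sup>2)) * \<bar>x\<bar>)))"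
    by (auto simp: normal_density_def algebra_simps add_divide_distrib)
  show "((\<lambda>x. normal_density 0 \<sigma> x * (A + K * \<bar>x\<bar>)) \<longlongrightarrow> 0) at_top"
    unfolding eq by (intro tendsto_mult_right_zero tendsto_add_zero 1 abs)
  show "((\<lambda>x. normal_density 0 \<sigma> x * (A + K * \<bar>x\<bar>)) \<longlongrightarrow> 0) at_bot"
    unfolding eq by (intro tendsto_mult_right_zero tendsto_add_zero 3 abs)
qed

text \<open>The density times F has derivative F' times the density minus x F / \<sigma>^2 times the
  density. Its integral over the line vanishes, because F grows at most linearly against the
  Gaussian tails.\<close>

lemma normal_density_stein:
  fixes F F' :: "real \<Rightarrow> real"
  assumes \<sigma>: "0 < \<sigma>" and F: "\<And>x. (F has_real_derivative F' x) (at x)"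
    and cont: "\<And>x. isCont F' x" and K: "\<And>x. \<bar>F' x\<bar> \<le> K"
  shows "integrable lborel (\<lambda>x. normal_density 0 \<sigma> x * (x * F x))"
    and "integrable lborel (\<lambda>x. normal_density 0 \<sigma> x * F' x)"
    and "(\<integral>x. normal_density 0 \<sigma> x * (x * F x) \<partial>lborel) = \<sigma>\<^sup>2 * (\<integral>x. normal_density 0 \<sigma> x * F' x \<partial>lborel)"
proof -
  let ?n = "normal_density 0 \<sigma>"
  note growth = DERIV_bounded_linear_growth[OF F K]
  have [measurable]: "F \<in> borel_measurable borel" "F' \<in> borel_measurable borel"
    using DERIV_isCont[OF F] cont by (auto intro!: borel_measurable_continuous_onI continuous_at_imp_continuous_on)
  have i1: "integrable lborel (\<lambda>x. ?n x * (\<bar>x\<bar> * (\<bar>F 0\<bar> + K * \<bar>x\<bar>)))"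
  proof -
    have "integrable lborel (\<lambda>x. \<bar>F 0\<bar> * (?n x * \<bar>x - 0\<bar> ^ 1) + K * (?n x * \<bar>x - 0\<bar> ^ 2))"
      using \<sigma> by (intro Bochner_Integration.integrable_add integrable_mult_right integrable_normal_moment_abs)
    then show ?thesis
      by (rule Bochner_Integration.integrable_cong[THEN iffD1, rotated -1])
        (auto simp: algebra_simps power2_eq_square)
  qed
  show i2: "integrable lborel (\<lambda>x. ?n x * (x * F x))"
  proof (rule Bochner_Integration.integrable_bound[OF i1])
    show "AE x in lborel. norm (?n x * (x * F x)) \<le> norm (?n x * (\<bar>x\<bar> * (\<bar>F 0\<bar> + K * \<bar>x\<bar>)))"
    proof (rule AE_I2)
      fix x
      have "?n x * (\<bar>x\<bar> * \<bar>F x\<bar>) \<le> ?n x * (\<bar>x\<bar> * (\<bar>F 0\<bar> + K * \<bar>x\<bar>))"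
        using growth by (intro mult_left_mono) auto
      also have "\<dots> \<le> norm (?n x * (\<bar>x\<bar> * (\<bar>F 0\<bar> + K * \<bar>x\<bar>)))" by simp
      finally show "norm (?n x * (x * F x)) \<le> norm (?n x * (\<bar>x\<bar> * (\<bar>F 0\<bar> + K * \<bar>x\<bar>)))"
        by (simp add: abs_mult)
    qed
  qed measurable
  show i3: "integrable lborel (\<lambda>x. ?n x * F' x)"
  proof (rule Bochner_Integration.integrable_bound)
    show "integrable lborel (\<lambda>x. ?n x * K)" using \<sigma> by simp
    show "AE x in lborel. norm (?n x * F' x) \<le> norm (?n x * K)"
    proof (rule AE_I2)
      fix x
      have "?n x * \<bar>F' x\<bar> \<le> ?n x * \<bar>K\<bar>" using order_trans[OF K abs_ge_self] by (intro mult_left_mono) auto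
      then show "norm (?n x * F' x) \<le> norm (?n x * K)" by (simp add: abs_mult)
    qed
  qed measurable
  have G: "((\<lambda>x. ?n x * F x) has_real_derivative (?n x * F' x - 1 / \<sigma>\<^sup>2 * (?n x * (x * F x)))) (at x)" for x
    by (rule derivative_eq_intros normal_density_has_real_derivative[OF \<sigma>] F refl)+ (simp add: field_simps)
  have bound: "\<bar>?n x * F x\<bar> \<le> ?n x * (\<bar>F 0\<bar> + K * \<bar>x\<bar>)" for x
    using growth[of x] by (auto simp: abs_mult intro!: mult_left_mono)
  have "(LBINT x=-\<infinity>..\<infinity>. (?n x * F' x - 1 / \<sigma>\<^sup>2 * (?n x * (x * F x)))) = 0 - 0"
  proof (rule interval_integral_FTC_integrable[where F="\<lambda>x. ?n x * F x"])
    show "((\<lambda>x. ?n x * F x) has_vector_derivative (?n x * F' x - 1 / \<sigma>\<^sup>2 * (?n x * (x * F x)))) (at x)" for x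
      using G by (simp add: has_real_derivative_iff_has_vector_derivative)
    show "isCont (\<lambda>x. ?n x * F' x - 1 / \<sigma>\<^sup>2 * (?n x * (x * F x))) x" for x
      by (intro isCont_diff isCont_mult continuous_const continuous_ident cont DERIV_isCont[OF F]
        DERIV_isCont[OF normal_density_has_real_derivative[OF \<sigma>]])
    show "set_integrable lborel (einterval (- \<infinity>) \<infinity>) (\<lambda>x. ?n x * F' x - 1 / \<sigma>\<^sup>2 * (?n x * (x * F x)))"
      unfolding set_integrable_def einterval_eq by (simp add: i2 i3)
    have "((\<lambda>x. ?n x * F x) \<longlongrightarrow> 0) at_bot" "((\<lambda>x. ?n x * F x) \<longlongrightarrow> 0) at_top"
      by (rule Lim_null_comparison[OF always_eventually normal_density_mult_affine_tendsto_0(2)[OF \<sigma>, of "\<bar>F 0\<bar>" K]], use bound in simp)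
        (rule Lim_null_comparison[OF always_eventually normal_density_mult_affine_tendsto_0(1)[OF \<sigma>, of "\<bar>F 0\<bar>" K]], use bound in simp)
    then show "(((\<lambda>x. ?n x * F x) \<circ> real_of_ereal) \<longlongrightarrow> 0) (at_right (- \<infinity>))"
      "(((\<lambda>x. ?n x * F x) \<circ> real_of_ereal) \<longlongrightarrow> 0) (at_left \<infinity>)"
      by (simp_all add: ereal_tendsto_simps)
  qed simp
  then have "(\<integral>x. ?n x * F' x \<partial>lborel) - 1 / \<sigma>\<^sup>2 * (\<integral>x. ?n x * (x * F x) \<partial>lborel) = 0"
    using i2 i3 by (simp add: interval_lebesgue_integral_def set_lebesgue_integral_def)
  then show "(\<integral>x. ?n x * (x * F x) \<partial>lborel) = \<sigma>\<^sup>2 * (\<integral>x. ?n x * F' x \<partial>lborel)"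
    using \<sigma> by (simp add: field_simps)
qed

text \<open>Together with Stein's identity for \<open>F - F 0\<close> this yields the one-dimensional Poincare inequality.\<close>

lemma sq_diff_le_mult_antiderivative:
  fixes g F :: "real \<Rightarrow> real"
  assumes g: "\<And>x. (g has_real_derivative g' x) (at x)"
    and F: "\<And>x. (F has_real_derivative (g' x)\<^sup>2) (at x)"
  shows "(g x - g 0)\<^sup>2 \<le> x * (F x - F 0)"
proof (cases "x = 0")
  case False
  \<comment> \<open>The secant slope of g. It makes \<open>\<psi>\<close> an antiderivative of (g' -
    s)^2, hence nondecreasing; this is Cauchy-Schwarz for the integral of g' between 0 and x,
    covering both signs of x.\<close>
  define s where "s = (g x - g 0) / x"
  define \<psi> where "\<psi> t = F t - 2 * s * g t + s\<^sup>2 * t" for t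
  have D: "(\<psi> has_real_derivative (g' t - s)\<^sup>2) (at t)" for t
    unfolding \<psi>_def by (rule derivative_eq_intros F g refl)+ (simp add: power2_eq_square algebra_simps)
  have mono: "\<psi> u \<le> \<psi> v" if "u \<le> v" for u v
    by (rule DERIV_nonneg_imp_nondecreasing[OF that]) (use D in \<open>auto intro!: exI\<close>)
  have "0 \<le> x * (\<psi> x - \<psi> 0)"
    using mono[of x 0] mono[of 0 x] by (cases "0 \<le> x") (auto intro: mult_nonneg_nonneg mult_nonpos_nonpos)
  also have "\<dots> = x * (F x - F 0) - (g x - g 0)\<^sup>2"
    using False by (simp add: \<psi>_def s_def power2_eq_square field_simps)
  finally show ?thesis by simp
qed simp

context prob_space
begin

lemma normal_stein:
  fixes F F' :: "real \<Rightarrow> real"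
  assumes Z: "distributed M lborel Z (normal_density 0 \<sigma>)" and \<sigma>: "0 < \<sigma>"
    and F: "\<And>x. (F has_real_derivative F' x) (at x)"
    and cont: "\<And>x. isCont F' x" and K: "\<And>x. \<bar>F' x\<bar> \<le> K"
  shows "integrable M (\<lambda>\<omega>. Z \<omega> * F (Z \<omega>))" and "integrable M (\<lambda>\<omega>. F' (Z \<omega>))"
    and "expectation (\<lambda>\<omega>. Z \<omega> * F (Z \<omega>)) = \<sigma>\<^sup>2 * expectation (\<lambda>\<omega>. F' (Z \<omega>))"
proof -
  have [measurable]: "F \<in> borel_measurable borel" "F' \<in> borel_measurable borel"
    using DERIV_isCont[OF F] cont by (auto intro!: borel_measurable_continuous_onI continuous_at_imp_continuous_on)
  note st = normal_density_stein[OF \<sigma> F cont K]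
  have m: "(\<lambda>x. x * F x) \<in> borel_measurable lborel" "F' \<in> borel_measurable lborel" by measurable
  show "integrable M (\<lambda>\<omega>. Z \<omega> * F (Z \<omega>))"
    using distributed_integrable[OF Z m(1)] st(1) by simp
  show "integrable M (\<lambda>\<omega>. F' (Z \<omega>))"
    using distributed_integrable[OF Z m(2)] st(2) by simp
  show "expectation (\<lambda>\<omega>. Z \<omega> * F (Z \<omega>)) = \<sigma>\<^sup>2 * expectation (\<lambda>\<omega>. F' (Z \<omega>))"
    using distributed_integral[OF Z m(1)] distributed_integral[OF Z m(2)] st(3) by simp
qed

text \<open>Both moments are instances of Stein's identity: F x = x gives the variance, F = 1 gives
  the mean.\<close>

lemma normal_sq_int:
  assumes Z: "distributed M lborel Z (normal_density 0 \<sigma>)" and \<sigma>: "0 < \<sigma>"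
  shows "sq_int M Z" "expectation (\<lambda>\<omega>. (Z \<omega>)\<^sup>2) = \<sigma>\<^sup>2" "expectation Z = 0"
proof -
  have "((\<lambda>x. x) has_real_derivative 1) (at x)" for x :: real by simp
  note s = normal_stein[OF Z \<sigma> this, where K=1]
  have "Z \<in> borel_measurable M" using distributed_measurable[OF Z] by simp
  then show "sq_int M Z" using s(1) by (simp add: sq_int_def power2_eq_square)
  show "expectation (\<lambda>\<omega>. (Z \<omega>)\<^sup>2) = \<sigma>\<^sup>2" using s(3) by (simp add: power2_eq_square prob_space)
  have "((\<lambda>x. 1) has_real_derivative 0) (at x)" for x :: real by simp
  note s = normal_stein[OF Z \<sigma> this, where K=1]
  show "expectation Z = 0" using s(3) by simp
qed

lemma normal_poincare:
  fixes g g' :: "real \<Rightarrow> real"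
  assumes Z: "distributed M lborel Z (normal_density 0 \<sigma>)" and \<sigma>: "0 < \<sigma>"
    and g: "\<And>x. (g has_real_derivative g' x) (at x)"
    and cont: "\<And>x. isCont g' x" and K: "\<And>x. \<bar>g' x\<bar> \<le> K"
  shows "expectation (\<lambda>\<omega>. (g (Z \<omega>))\<^sup>2) - (expectation (\<lambda>\<omega>. g (Z \<omega>)))\<^sup>2 \<le> \<sigma>\<^sup>2 * expectation (\<lambda>\<omega>. (g' (Z \<omega>))\<^sup>2)"
proof -
  have [measurable]: "g \<in> borel_measurable borel" "Z \<in> borel_measurable M"
    using g distributed_measurable[OF Z]
    by (auto intro!: borel_measurable_continuous_onI continuous_at_imp_continuous_on DERIV_isCont)
  \<comment> \<open>Stein's identity applied to this antiderivative differentiates it back to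
    (g')^2; the bound on g' keeps its derivative bounded, as the identity requires.\<close>
  obtain F where F: "\<And>x. (F has_real_derivative (g' x)\<^sup>2) (at x)"
  proof -
    have "\<exists>F. \<forall>x. - \<infinity> < ereal x \<longrightarrow> ereal x < \<infinity> \<longrightarrow> (F has_vector_derivative (g' x)\<^sup>2) (at x)"
      by (rule einterval_antiderivative) (auto intro!: continuous_intros cont)
    then show thesis using that by (auto simp: has_real_derivative_iff_has_vector_derivative)
  qed
  have gr: "\<bar>g x\<bar> \<le> \<bar>g 0\<bar> + K * \<bar>x\<bar>" for x by (rule DERIV_bounded_linear_growth[OF g K])
  have sqg: "sq_int M (\<lambda>\<omega>. g (Z \<omega>))"
  proof (rule sq_int_AE_bound(1))
    show "sq_int M (\<lambda>\<omega>. \<bar>g 0\<bar> + K * norm (Z \<omega>))"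
      by (intro sq_int_add sq_int_const sq_int_cmult sq_int_norm normal_sq_int[OF Z \<sigma>])
    show "AE \<omega> in M. norm (g (Z \<omega>)) \<le> norm (\<bar>g 0\<bar> + K * norm (Z \<omega>))"
      using gr by (intro AE_I2) (smt (verit) real_norm_def)
  qed measurable
  have sqd: "sq_int M (\<lambda>\<omega>. g (Z \<omega>) - g 0)" by (intro sq_int_diff sqg sq_int_const)
  have D: "((\<lambda>x. F x - F 0) has_real_derivative (g' x)\<^sup>2) (at x)" for x
    by (rule derivative_eq_intros F refl)+ simp
  have "\<bar>(g' x)\<^sup>2\<bar> \<le> K\<^sup>2" for x using power_mono[OF K[of x], of 2] by simp
  note st = normal_stein[OF Z \<sigma> D _ this]
  have ct: "isCont (\<lambda>x. (g' x)\<^sup>2) x" for x by (intro continuous_intros cont)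
  have int: "integrable M (\<lambda>\<omega>. g (Z \<omega>))" by (rule sq_int_imp_integrable[OF sqg])
  have int2: "integrable M (\<lambda>\<omega>. (g (Z \<omega>))\<^sup>2)" using sq_int_integrable[OF sqg] by simp
  have "expectation (\<lambda>\<omega>. (g (Z \<omega>))\<^sup>2) - (expectation (\<lambda>\<omega>. g (Z \<omega>)))\<^sup>2
    = expectation (\<lambda>\<omega>. (g (Z \<omega>) - g 0)\<^sup>2) - (expectation (\<lambda>\<omega>. g (Z \<omega>) - g 0))\<^sup>2"
    using int int2 by (simp add: power2_diff prob_space)
  \<comment> \<open>Centring at g 0 instead of the mean only increases the value, and g 0 is the
    centre for which the pointwise secant bound is available.\<close>
  also have "\<dots> \<le> expectation (\<lambda>\<omega>. (g (Z \<omega>) - g 0)\<^sup>2)" by simp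
  also have "\<dots> \<le> expectation (\<lambda>\<omega>. Z \<omega> * (F (Z \<omega>) - F 0))"
    using sq_int_integrable[OF sqd] st(1)[OF ct] sq_diff_le_mult_antiderivative[OF g F]
    by (intro integral_mono) auto
  also have "\<dots> = \<sigma>\<^sup>2 * expectation (\<lambda>\<omega>. (g' (Z \<omega>))\<^sup>2)" by (rule st(3)[OF ct])
  finally show ?thesis .
qed

text \<open>The bound is \<open>E (f - E[f | X] - E[f | Y] + E f)^2 \<ge> 0\<close>, expanded.\<close>

lemma efron_stein_pair:
  fixes f :: "'b \<Rightarrow> 'c \<Rightarrow> real"
  assumes ind: "indep_pair M S X T Y"
    and f[measurable]: "case_prod f \<in> borel_measurable (S \<Otimes>\<^sub>M T)"
    and sq: "sq_int M (\<lambda>\<omega>. f (X \<omega>) (Y \<omega>))"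
    and sqY: "\<And>x. x \<in> space S \<Longrightarrow> sq_int M (\<lambda>\<omega>. f x (Y \<omega>))"
    and sqX: "\<And>y. y \<in> space T \<Longrightarrow> sq_int M (\<lambda>\<omega>. f (X \<omega>) y)"
    and q: "integrable M (\<lambda>\<omega>. q (X \<omega>))" and p: "integrable M (\<lambda>\<omega>. p (Y \<omega>))"
    and varY: "\<And>x. x \<in> space S \<Longrightarrow> expectation (\<lambda>\<omega>. (f x (Y \<omega>))\<^sup>2) - (expectation (\<lambda>\<omega>. f x (Y \<omega>)))\<^sup>2 \<le> q x"
    and varX: "\<And>y. y \<in> space T \<Longrightarrow> expectation (\<lambda>\<omega>. (f (X \<omega>) y)\<^sup>2) - (expectation (\<lambda>\<omega>. f (X \<omega>) y))\<^sup>2 \<le> p y"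
  shows "expectation (\<lambda>\<omega>. (f (X \<omega>) (Y \<omega>))\<^sup>2) - (expectation (\<lambda>\<omega>. f (X \<omega>) (Y \<omega>)))\<^sup>2
    \<le> expectation (\<lambda>\<omega>. q (X \<omega>)) + expectation (\<lambda>\<omega>. p (Y \<omega>))"
proof -
  have X[measurable]: "X \<in> measurable M S" and Y[measurable]: "Y \<in> measurable M T"
    using ind by (auto simp: indep_pair_def)
  have Xs: "X \<omega> \<in> space S" if "\<omega> \<in> space M" for \<omega> using that X by (rule measurable_space[rotated])
  have Ys: "Y \<omega> \<in> space T" if "\<omega> \<in> space M" for \<omega> using that Y by (rule measurable_space[rotated])
  \<comment> \<open>\<open>a (X _)\<close> and \<open>A (Y _)\<close> are the conditional means of f
    given X and given Y; m is the full mean.\<close>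
  define a A m where "a x = expectation (\<lambda>\<omega>. f x (Y \<omega>))" and "A y = expectation (\<lambda>\<omega>. f (X \<omega>) y)"
    and "m = expectation (\<lambda>\<omega>. f (X \<omega>) (Y \<omega>))" for x y
  have [measurable]: "a \<in> borel_measurable S" "A \<in> borel_measurable T"
    unfolding a_def[abs_def] A_def[abs_def] by measurable
  have f2: "integrable M (\<lambda>\<omega>. (f (X \<omega>) (Y \<omega>))\<^sup>2)" using sq_int_integrable[OF sq] by simp
  have f1: "integrable M (\<lambda>\<omega>. f (X \<omega>) (Y \<omega>))" by (rule sq_int_imp_integrable[OF sq])
  note it2 = indep_pair_iterated_integral[OF ind, of "\<lambda>x y. (f x y)\<^sup>2"]
  note it1 = indep_pair_iterated_integral[OF ind f f1]
  have a2: "(a x)\<^sup>2 \<le> expectation (\<lambda>\<omega>. (f x (Y \<omega>))\<^sup>2)" if "x \<in> space S" for x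
    unfolding a_def by (rule expectation_sq_le[OF sqY[OF that]])
  have A2: "(A y)\<^sup>2 \<le> expectation (\<lambda>\<omega>. (f (X \<omega>) y)\<^sup>2)" if "y \<in> space T" for y
    unfolding A_def by (rule expectation_sq_le[OF sqX[OF that]])
  have sa: "sq_int M (\<lambda>\<omega>. a (X \<omega>))"
    unfolding sq_int_def
  proof (rule conjI[OF _ Bochner_Integration.integrable_bound])
    show "integrable M (\<lambda>\<omega>. \<integral>\<omega>'. (f (X \<omega>) (Y \<omega>'))\<^sup>2 \<partial>M)" by (rule it2(1)) (use f2 in auto)
    show "AE \<omega> in M. norm ((norm (a (X \<omega>)))\<^sup>2) \<le> norm (\<integral>\<omega>'. (f (X \<omega>) (Y \<omega>'))\<^sup>2 \<partial>M)"
      using a2 Xs by (intro AE_I2) auto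
  qed measurable
  have sA: "sq_int M (\<lambda>\<omega>. A (Y \<omega>))"
    unfolding sq_int_def
  proof (rule conjI[OF _ Bochner_Integration.integrable_bound])
    show "integrable M (\<lambda>\<omega>'. \<integral>\<omega>. (f (X \<omega>) (Y \<omega>'))\<^sup>2 \<partial>M)" by (rule it2(3)) (use f2 in auto)
    show "AE \<omega> in M. norm ((norm (A (Y \<omega>)))\<^sup>2) \<le> norm (\<integral>\<omega>'. (f (X \<omega>') (Y \<omega>))\<^sup>2 \<partial>M)"
      using A2 Ys by (intro AE_I2) auto
  qed measurable
  have ifa: "integrable M (\<lambda>\<omega>. f (X \<omega>) (Y \<omega>) * a (X \<omega>))" using sq_int_inner_integrable[OF sq sa] by simp
  have ifA: "integrable M (\<lambda>\<omega>. f (X \<omega>) (Y \<omega>) * A (Y \<omega>))" using sq_int_inner_integrable[OF sq sA] by simp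
  have iaA: "integrable M (\<lambda>\<omega>. a (X \<omega>) * A (Y \<omega>))" using sq_int_inner_integrable[OF sa sA] by simp
  have Ea: "expectation (\<lambda>\<omega>. a (X \<omega>)) = m" unfolding m_def a_def using it1(2) by simp
  have EA: "expectation (\<lambda>\<omega>. A (Y \<omega>)) = m" unfolding m_def A_def using it1(4) by simp
  have Efa: "expectation (\<lambda>\<omega>. f (X \<omega>) (Y \<omega>) * a (X \<omega>)) = expectation (\<lambda>\<omega>. (a (X \<omega>))\<^sup>2)"
    using indep_pair_iterated_integral(2)[OF ind, of "\<lambda>x y. f x y * a x"] ifa
    by (simp add: power2_eq_square) (simp add: a_def)
  have EfA: "expectation (\<lambda>\<omega>. f (X \<omega>) (Y \<omega>) * A (Y \<omega>)) = expectation (\<lambda>\<omega>. (A (Y \<omega>))\<^sup>2)"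
    using indep_pair_iterated_integral(4)[OF ind, of "\<lambda>x y. f x y * A y"] ifA
    by (simp add: power2_eq_square) (simp add: A_def)
  \<comment> \<open>Independence separates the two conditional means, each of expectation m.\<close>
  have EaA: "expectation (\<lambda>\<omega>. a (X \<omega>) * A (Y \<omega>)) = m\<^sup>2"
    using indep_pair_iterated_integral(2)[OF ind, of "\<lambda>x y. a x * A y"] iaA Ea EA
    by (simp add: power2_eq_square)
  note ints = f1 f2 ifa ifA iaA sq_int_imp_integrable[OF sa] sq_int_imp_integrable[OF sA]
    sq_int_integrable[OF sa, simplified] sq_int_integrable[OF sA, simplified]
  have "0 \<le> expectation (\<lambda>\<omega>. (f (X \<omega>) (Y \<omega>) - A (Y \<omega>) - a (X \<omega>) + m)\<^sup>2)" by simp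
  also have "\<dots> = expectation (\<lambda>\<omega>. (f (X \<omega>) (Y \<omega>))\<^sup>2 + (A (Y \<omega>))\<^sup>2 + (a (X \<omega>))\<^sup>2 + m\<^sup>2
      - 2 * (f (X \<omega>) (Y \<omega>) * A (Y \<omega>)) - 2 * (f (X \<omega>) (Y \<omega>) * a (X \<omega>)) + 2 * m * f (X \<omega>) (Y \<omega>)
      + 2 * (a (X \<omega>) * A (Y \<omega>)) - 2 * m * A (Y \<omega>) - 2 * m * a (X \<omega>))"
    by (intro Bochner_Integration.integral_cong) (auto simp: power2_eq_square algebra_simps)
  also have "\<dots> = expectation (\<lambda>\<omega>. (f (X \<omega>) (Y \<omega>))\<^sup>2) - expectation (\<lambda>\<omega>. (A (Y \<omega>))\<^sup>2) - expectation (\<lambda>\<omega>. (a (X \<omega>))\<^sup>2) + m\<^sup>2"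
    using ints by (simp add: Ea EA Efa EfA EaA m_def[symmetric] prob_space power2_eq_square)
  finally have main: "0 \<le> \<dots>" .
  have "expectation (\<lambda>\<omega>. (f (X \<omega>) (Y \<omega>))\<^sup>2) - expectation (\<lambda>\<omega>. (a (X \<omega>))\<^sup>2)
      = (\<integral>\<omega>. (\<integral>\<omega>'. (f (X \<omega>) (Y \<omega>'))\<^sup>2 \<partial>M) - (a (X \<omega>))\<^sup>2 \<partial>M)"
    using it2(1,2) f2 ints by simp
  also have "\<dots> \<le> expectation (\<lambda>\<omega>. q (X \<omega>))"
    using it2(1) f2 ints q varY[OF Xs] by (intro integral_mono) (auto simp: a_def)
  finally have 1: "expectation (\<lambda>\<omega>. (f (X \<omega>) (Y \<omega>))\<^sup>2) - expectation (\<lambda>\<omega>. (a (X \<omega>))\<^sup>2) \<le> expectation (\<lambda>\<omega>. q (X \<omega>))" .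
  have "expectation (\<lambda>\<omega>. (f (X \<omega>) (Y \<omega>))\<^sup>2) - expectation (\<lambda>\<omega>. (A (Y \<omega>))\<^sup>2)
      = (\<integral>\<omega>'. (\<integral>\<omega>. (f (X \<omega>) (Y \<omega>'))\<^sup>2 \<partial>M) - (A (Y \<omega>'))\<^sup>2 \<partial>M)"
    using it2(3,4) f2 ints by simp
  also have "\<dots> \<le> expectation (\<lambda>\<omega>. p (Y \<omega>))"
    using it2(3) f2 ints p varX[OF Ys] by (intro integral_mono) (auto simp: A_def)
  finally have 2: "expectation (\<lambda>\<omega>. (f (X \<omega>) (Y \<omega>))\<^sup>2) - expectation (\<lambda>\<omega>. (A (Y \<omega>))\<^sup>2) \<le> expectation (\<lambda>\<omega>. p (Y \<omega>))" .
  \<comment> \<open>E f^2 - m^2 is at most (E f^2 - E a^2) + (E f^2 - E A^2) by \<open>main\<close>,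
    and the two brackets are the averaged conditional variances.\<close>
  show ?thesis using main 1 2 by (simp add: m_def)
qed

end

section \<open>The Poincare inequality for Gaussian vectors\<close>

definition gaussian_vector :: "'w measure \<Rightarrow> real \<Rightarrow> ('w \<Rightarrow> real ^ 'd::finite) \<Rightarrow> bool" where
  "gaussian_vector M h V \<longleftrightarrow> 0 < h \<and> V \<in> borel_measurable M \<and>
     prob_space.indep_vars M (\<lambda>_. borel) (\<lambda>j \<omega>. V \<omega> $ j) UNIV \<and>
     (\<forall>j. distributed M lborel (\<lambda>\<omega>. V \<omega> $ j) (\<lambda>x. ennreal (normal_density 0 (sqrt h) x)))"

text \<open>The gradient is an explicit vector field because its coordinates are differentiated
  again later. The notion is used for the payoff f and for the projections of b onto unit
  vectors.\<close>

definition bounded_gradient :: "(real ^ 'd::finite \<Rightarrow> real) \<Rightarrow> (real ^ 'd \<Rightarrow> real ^ 'd) \<Rightarrow> real \<Rightarrow> bool" where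
  "bounded_gradient g g1 K \<longleftrightarrow>
     (\<forall>x. (g has_derivative (\<lambda>v. g1 x \<bullet> v)) (at x)) \<and> continuous_on UNIV g1 \<and> (\<forall>x. norm (g1 x) \<le> K)"

lemma borel_measurable_vec_nth'[measurable (raw)]:
  fixes f :: "'w \<Rightarrow> real ^ 'd::finite"
  assumes "f \<in> borel_measurable M"
  shows "(\<lambda>x. f x $ i) \<in> borel_measurable M"
  by (rule measurable_compose[OF assms borel_measurable_nth])

lemma sum_axis_eq: "(\<Sum>i\<in>UNIV. v $ i *\<^sub>R axis i 1) = (v :: real ^ 'd::finite)"
  using basis_expansion[of v] by (simp add: scalar_mult_eq_scaleR)

lemma bounded_gradient_directional:
  assumes "bounded_gradient g g1 K"
  shows "((\<lambda>t. g (x + t *\<^sub>R v)) has_real_derivative g1 (x + t *\<^sub>R v) \<bullet> v) (at t)"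
proof -
  have "(g has_derivative (\<lambda>w. g1 (x + t *\<^sub>R v) \<bullet> w)) (at (x + t *\<^sub>R v))"
    using assms by (simp add: bounded_gradient_def)
  then have "((\<lambda>t. g (x + t *\<^sub>R v)) has_derivative (\<lambda>s. g1 (x + t *\<^sub>R v) \<bullet> (s *\<^sub>R v))) (at t)"
    by (rule has_derivative_compose[rotated]) (auto intro!: derivative_eq_intros)
  then show ?thesis
    unfolding has_field_derivative_def by (rule has_derivative_eq_rhs) (simp add: fun_eq_iff)
qed

lemma bounded_gradient_lipschitz:
  fixes g :: "real ^ 'd::finite \<Rightarrow> real"
  assumes "bounded_gradient g g1 K"
  shows "K-lipschitz_on UNIV g"
proof (rule lipschitz_onI)
  have K: "norm (g1 x) \<le> K" for x using assms by (simp add: bounded_gradient_def)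
  then show "0 \<le> K" using norm_ge_zero order_trans by blast
  have on: "onorm (\<lambda>v. g1 x \<bullet> v) \<le> K" for x
  proof (rule onorm_le)
    fix v show "norm (g1 x \<bullet> v) \<le> K * norm v"
      using Cauchy_Schwarz_ineq2[of "g1 x" v] mult_right_mono[OF K[of x] norm_ge_zero[of v]] by simp
  qed
  show "dist (g x) (g y) \<le> K * dist x y" for x y
    unfolding dist_norm
    by (rule differentiable_bound[where S=UNIV and f'="\<lambda>x v. g1 x \<bullet> v"])
      (use assms on in \<open>auto simp: bounded_gradient_def intro: has_derivative_at_withinI\<close>)
qed

lemma bounded_gradient_measurable:
  assumes "bounded_gradient g g1 K"
  shows "g \<in> borel_measurable borel" "g1 \<in> borel_measurable borel"
  using assms lipschitz_on_continuous_on[OF bounded_gradient_lipschitz[OF assms]]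
  by (auto simp: bounded_gradient_def intro: borel_measurable_continuous_onI)

lemma norm_vec_sq: "(norm (x :: real ^ 'd::finite))\<^sup>2 = (\<Sum>i\<in>UNIV. (x $ i)\<^sup>2)"
  unfolding power2_norm_eq_inner inner_vec_def by (simp add: power2_eq_square)

context prob_space
begin

lemma gaussian_vector_coord:
  fixes V :: "'a \<Rightarrow> real ^ 'd::finite"
  assumes V: "gaussian_vector M h V"
  shows "sq_int M (\<lambda>\<omega>. V \<omega> $ j)" "expectation (\<lambda>\<omega>. (V \<omega> $ j)\<^sup>2) = h" "expectation (\<lambda>\<omega>. V \<omega> $ j) = 0"
  using V normal_sq_int[of "\<lambda>\<omega>. V \<omega> $ j" "sqrt h"] by (auto simp: gaussian_vector_def)

lemma gaussian_vector_sq_int_sum: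
  fixes V :: "'a \<Rightarrow> real ^ 'd::finite"
  assumes V: "gaussian_vector M h V"
  shows "sq_int M (\<lambda>\<omega>. \<Sum>i\<in>I. V \<omega> $ i *\<^sub>R axis i 1 :: real ^ 'd)"
proof (rule sq_int_sum)
  fix i
  show "sq_int M (\<lambda>\<omega>. V \<omega> $ i *\<^sub>R axis i 1 :: real ^ 'd)"
    using gaussian_vector_coord(1)[OF V, of i] by (auto simp: sq_int_def norm_axis_1)
qed

lemma gaussian_vector_L2:
  fixes V :: "'a \<Rightarrow> real ^ 'd::finite"
  assumes V: "gaussian_vector M h V"
  shows "sq_int M V" "L2 M V = sqrt (real CARD('d) * h)" "expectation V = 0"
proof -
  show sq: "sq_int M V" using gaussian_vector_sq_int_sum[OF V, of UNIV] by (simp add: sum_axis_eq)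
  have "expectation (\<lambda>\<omega>. (norm (V \<omega>))\<^sup>2) = (\<Sum>i\<in>UNIV. expectation (\<lambda>\<omega>. (V \<omega> $ i)\<^sup>2))"
    unfolding norm_vec_sq
    using sq_int_integrable[OF gaussian_vector_coord(1)[OF V]] by (intro Bochner_Integration.integral_sum) simp
  also have "\<dots> = real CARD('d) * h" by (simp add: gaussian_vector_coord(2)[OF V])
  finally show "L2 M V = sqrt (real CARD('d) * h)" by (simp add: L2_def)
  show "expectation V = 0"
  proof (subst vec_eq_iff, rule allI)
    fix i
    have "expectation (\<lambda>\<omega>. V \<omega> $ i) = expectation V $ i"
      using integral_bounded_linear[OF bounded_linear_vec_nth sq_int_imp_integrable[OF sq]] by simp
    then show "expectation V $ i = 0 $ i" using gaussian_vector_coord(3)[OF V, of i] by simp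
  qed
qed

text \<open>Partial sums over coordinate axes keep a subset of the coordinates inside the full
  space, so that coordinates can be added one at a time without changing the type.\<close>

lemma gaussian_vector_split:
  fixes V :: "'a \<Rightarrow> real ^ 'd::finite"
  assumes V: "gaussian_vector M h V" and j: "j \<notin> I"
  shows "indep_pair M borel (\<lambda>\<omega>. \<Sum>i\<in>I. V \<omega> $ i *\<^sub>R axis i 1 :: real ^ 'd) borel (\<lambda>\<omega>. V \<omega> $ j)"
proof -
  have "indep_vars (\<lambda>_. borel) (\<lambda>j \<omega>. V \<omega> $ j) UNIV" using V by (simp add: gaussian_vector_def)
  from indep_var_restrict[OF this, of I "{j}"] j
  have "indep_pair M (PiM I (\<lambda>_. borel)) (\<lambda>\<omega>. \<lambda>i\<in>I. V \<omega> $ i) (PiM {j} (\<lambda>_. borel)) (\<lambda>\<omega>. \<lambda>i\<in>{j}. V \<omega> $ i)"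
    by (intro indep_var_imp_indep_pair) auto
  then have "indep_pair M borel (\<lambda>\<omega>. (\<lambda>x. \<Sum>i\<in>I. x i *\<^sub>R axis i 1 :: real ^ 'd) (\<lambda>i\<in>I. V \<omega> $ i))
      borel (\<lambda>\<omega>. (\<lambda>x. x j) (\<lambda>i\<in>{j}. V \<omega> $ i))"
    by (rule indep_pair_compose)
      (auto intro!: borel_measurable_sum borel_measurable_scaleR measurable_component_singleton)
  then show ?thesis by (simp cong: sum.cong)
qed

lemma gaussian_poincare_partial:
  fixes V :: "'a \<Rightarrow> real ^ 'd::finite"
  assumes V: "gaussian_vector M h V" and g: "bounded_gradient g g1 K"
  shows "expectation (\<lambda>\<omega>. (g (c + (\<Sum>i\<in>I. V \<omega> $ i *\<^sub>R axis i 1)))\<^sup>2)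
      - (expectation (\<lambda>\<omega>. g (c + (\<Sum>i\<in>I. V \<omega> $ i *\<^sub>R axis i 1))))\<^sup>2
    \<le> (\<Sum>j\<in>I. h * expectation (\<lambda>\<omega>. (g1 (c + (\<Sum>i\<in>I. V \<omega> $ i *\<^sub>R axis i 1)) $ j)\<^sup>2))"
proof -
  have h: "0 < h" and Vm[measurable]: "V \<in> borel_measurable M"
    using V by (auto simp: gaussian_vector_def)
  note [measurable] = bounded_gradient_measurable[OF g]
  have lip: "K-lipschitz_on UNIV g" by (rule bounded_gradient_lipschitz[OF g])
  have cg1: "continuous_on UNIV g1" and K: "norm (g1 x) \<le> K" for x
    using g by (auto simp: bounded_gradient_def)
  have g1b: "\<bar>g1 x $ j\<bar> \<le> K" for x j using component_le_norm_cart[of "g1 x" j] K[of x] by linarith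
  then have g1b2: "\<bar>(g1 x $ j)\<^sup>2\<bar> \<le> K\<^sup>2" for x j using power_mono[OF g1b[of x j], of 2] by simp
  have "finite I" by simp
  then show ?thesis
  proof (induction I arbitrary: c rule: finite_induct)
    case empty
    show ?case by (simp add: prob_space)
  next
    case (insert j I)
    define X where "X \<omega> = (\<Sum>i\<in>I. V \<omega> $ i *\<^sub>R axis i 1 :: real ^ 'd)" for \<omega>
    define Y where "Y \<omega> = V \<omega> $ j" for \<omega>
    define f where "f x y = g (c + x + y *\<^sub>R axis j 1)" for x y
    define q where "q x = h * expectation (\<lambda>\<omega>. (g1 (c + x + Y \<omega> *\<^sub>R axis j 1) $ j)\<^sup>2)" for x
    define p where "p y = (\<Sum>k\<in>I. h * expectation (\<lambda>\<omega>. (g1 (c + X \<omega> + y *\<^sub>R axis j 1) $ k)\<^sup>2))" for y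
    have ind: "indep_pair M borel X borel Y"
      unfolding X_def[abs_def] Y_def[abs_def] by (rule gaussian_vector_split[OF V]) (use insert in auto)
    have [measurable]: "X \<in> borel_measurable M" "Y \<in> borel_measurable M"
      using ind by (auto simp: indep_pair_def)
    have sX: "sq_int M X" unfolding X_def[abs_def] by (rule gaussian_vector_sq_int_sum[OF V])
    have sY: "sq_int M Y" unfolding Y_def[abs_def] by (rule gaussian_vector_coord[OF V])
    have sYv: "sq_int M (\<lambda>\<omega>. Y \<omega> *\<^sub>R axis j 1 :: real ^ 'd)"
      using sY by (simp add: sq_int_def norm_axis_1)
    have S: "X \<omega> + Y \<omega> *\<^sub>R axis j 1 = (\<Sum>i\<in>insert j I. V \<omega> $ i *\<^sub>R axis i 1)" for \<omega>
      using insert by (simp add: X_def Y_def)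
    have fm: "case_prod f \<in> borel_measurable (borel \<Otimes>\<^sub>M borel)" unfolding f_def by measurable
    have gm: "(\<lambda>(x, y). (g1 (c + x + y *\<^sub>R axis j 1) $ k)\<^sup>2) \<in> borel_measurable (borel \<Otimes>\<^sub>M borel)" for k
      by measurable
    have gi: "integrable M (\<lambda>\<omega>. (g1 (c + X \<omega> + Y \<omega> *\<^sub>R axis j 1) $ k)\<^sup>2)" for k
      by (rule integrable_const_bound[where B="K\<^sup>2"]) (use g1b2 in auto)
    note itk = indep_pair_iterated_integral[OF ind gm gi]
    have "expectation (\<lambda>\<omega>. (f (X \<omega>) (Y \<omega>))\<^sup>2) - (expectation (\<lambda>\<omega>. f (X \<omega>) (Y \<omega>)))\<^sup>2
       \<le> expectation (\<lambda>\<omega>. q (X \<omega>)) + expectation (\<lambda>\<omega>. p (Y \<omega>))"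
    proof (rule efron_stein_pair[OF ind fm])
      show "sq_int M (\<lambda>\<omega>. f (X \<omega>) (Y \<omega>))"
        unfolding f_def by (intro sq_int_Lipschitz[OF _ lip] sq_int_add sq_int_const sX sYv)
      show "sq_int M (\<lambda>\<omega>. f x (Y \<omega>))" for x
        unfolding f_def by (intro sq_int_Lipschitz[OF _ lip] sq_int_add sq_int_const sYv)
      show "sq_int M (\<lambda>\<omega>. f (X \<omega>) y)" for y
        unfolding f_def by (intro sq_int_Lipschitz[OF _ lip] sq_int_add sq_int_const sX)
      show "integrable M (\<lambda>\<omega>. q (X \<omega>))"
        unfolding q_def using itk(1)[of j] by simp
      show "integrable M (\<lambda>\<omega>. p (Y \<omega>))"
        unfolding p_def using itk(3) by simp
      show "expectation (\<lambda>\<omega>. (f x (Y \<omega>))\<^sup>2) - (expectation (\<lambda>\<omega>. f x (Y \<omega>)))\<^sup>2 \<le> q x" for x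
      proof -
        have Z: "distributed M lborel Y (normal_density 0 (sqrt h))"
          using V by (simp add: gaussian_vector_def Y_def[abs_def])
        have D: "((\<lambda>t. g (c + x + t *\<^sub>R axis j 1)) has_real_derivative g1 (c + x + t *\<^sub>R axis j 1) $ j) (at t)" for t
          using bounded_gradient_directional[OF g, of "c + x" "axis j 1" t] by (simp add: inner_axis)
        have ct: "isCont (\<lambda>t. g1 (c + x + t *\<^sub>R axis j 1) $ j) t" for t
        proof -
          have "continuous_on UNIV (\<lambda>t. g1 (c + x + t *\<^sub>R axis j 1) $ j)"
            by (intro continuous_on_compose2[OF cg1] continuous_intros) auto
          then show ?thesis by (simp add: continuous_on_eq_continuous_at)
        qed
        show ?thesis
          using normal_poincare[OF Z _ D ct g1b] h unfolding f_def q_def by simp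
      qed
      show "expectation (\<lambda>\<omega>. (f (X \<omega>) y)\<^sup>2) - (expectation (\<lambda>\<omega>. f (X \<omega>) y))\<^sup>2 \<le> p y" for y
        using insert.IH[of "c + y *\<^sub>R axis j 1"]
        unfolding f_def p_def X_def add.assoc add.commute[of "y *\<^sub>R axis j 1"] .
    qed
    also have "expectation (\<lambda>\<omega>. q (X \<omega>)) = h * expectation (\<lambda>\<omega>. (g1 (c + X \<omega> + Y \<omega> *\<^sub>R axis j 1) $ j)\<^sup>2)"
      unfolding q_def using itk(2)[of j] by simp
    also have "expectation (\<lambda>\<omega>. p (Y \<omega>)) = (\<Sum>k\<in>I. h * expectation (\<lambda>\<omega>. (g1 (c + X \<omega> + Y \<omega> *\<^sub>R axis j 1) $ k)\<^sup>2))"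
      unfolding p_def using itk(3,4) by (subst Bochner_Integration.integral_sum) auto
    finally show ?case
      using insert.hyps by (simp add: f_def add.assoc S)
  qed
qed

lemma gaussian_poincare:
  fixes V :: "'a \<Rightarrow> real ^ 'd::finite"
  assumes V: "gaussian_vector M h V" and g: "bounded_gradient g g1 K"
  shows "expectation (\<lambda>\<omega>. (g (c + V \<omega>))\<^sup>2) - (expectation (\<lambda>\<omega>. g (c + V \<omega>)))\<^sup>2 \<le> h * K\<^sup>2"
proof -
  have h: "0 < h" and [measurable]: "V \<in> borel_measurable M"
    using V by (auto simp: gaussian_vector_def)
  note [measurable] = bounded_gradient_measurable[OF g]
  have K: "norm (g1 x) \<le> K" for x using g by (auto simp: bounded_gradient_def)
  have K2: "(norm (g1 x))\<^sup>2 \<le> K\<^sup>2" for x by (intro power_mono K) simp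
  have b: "(g1 x $ j)\<^sup>2 \<le> K\<^sup>2" for x j
    using power_mono[OF component_le_norm_cart[of "g1 x" j], of 2] K2[of x] by simp
  have i: "integrable M (\<lambda>\<omega>. (g1 (c + V \<omega>) $ j)\<^sup>2)" for j
    by (rule integrable_const_bound[where B="K\<^sup>2"]) (use b in auto)
  have "expectation (\<lambda>\<omega>. (g (c + V \<omega>))\<^sup>2) - (expectation (\<lambda>\<omega>. g (c + V \<omega>)))\<^sup>2
    \<le> (\<Sum>j\<in>UNIV. h * expectation (\<lambda>\<omega>. (g1 (c + V \<omega>) $ j)\<^sup>2))"
    using gaussian_poincare_partial[OF V g, of c UNIV] by (simp add: sum_axis_eq)
  also have "\<dots> = h * expectation (\<lambda>\<omega>. (norm (g1 (c + V \<omega>)))\<^sup>2)"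
    unfolding norm_vec_sq using i by (simp add: sum_distrib_left)
  also have "\<dots> \<le> h * K\<^sup>2"
  proof (intro mult_left_mono)
    have "expectation (\<lambda>\<omega>. (norm (g1 (c + V \<omega>)))\<^sup>2) \<le> expectation (\<lambda>\<omega>. K\<^sup>2)"
      unfolding norm_vec_sq using i K2 by (intro integral_mono) (auto simp: norm_vec_sq)
    then show "expectation (\<lambda>\<omega>. (norm (g1 (c + V \<omega>)))\<^sup>2) \<le> K\<^sup>2" by (simp add: prob_space)
  qed (use h in simp)
  finally show ?thesis .
qed

end

section \<open>Mean increments of a function with controlled Laplacian\<close>

text \<open>Assumption (R1) controls only the Laplacian and not the individual second derivatives, so integration
  by parts in each coordinate needs a compactly supported cutoff.\<close>

definition cutoff :: "real \<Rightarrow> real ^ 'd::finite \<Rightarrow> real" where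
  "cutoff R v = (max 0 (1 - (norm v)\<^sup>2 / R\<^sup>2))\<^sup>2"

definition cutoff_deriv :: "real \<Rightarrow> 'd \<Rightarrow> real ^ 'd::finite \<Rightarrow> real" where
  "cutoff_deriv R i v = - 4 * (v $ i / R\<^sup>2) * max 0 (1 - (norm v)\<^sup>2 / R\<^sup>2)"

text \<open>Squaring the positive part is what makes the cutoff continuously differentiable across
  the sphere of radius R. At u = 0 the difference quotient is again the positive part, which tends
  to 0.\<close>

lemma max_0_sq_has_real_derivative:
  "((\<lambda>u. (max 0 u)\<^sup>2) has_real_derivative 2 * max 0 (u::real)) (at u)"
proof -
  consider "u > 0" | "u < 0" | "u = 0" by linarith
  then show ?thesis
  proof cases
    case 1
    have "((\<lambda>u. u\<^sup>2) has_real_derivative 2 * max 0 u) (at u)"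
      using 1 by (auto intro!: derivative_eq_intros)
    then show ?thesis
      by (rule has_field_derivative_transform_within_open[where S="{0<..}"]) (use 1 in auto)
  next
    case 2
    have "((\<lambda>u. 0) has_real_derivative 2 * max 0 u) (at u)"
      using 2 by (auto intro!: derivative_eq_intros)
    then show ?thesis
      by (rule has_field_derivative_transform_within_open[where S="{..<0}"]) (use 2 in auto)
  next
    case 3
    have "((\<lambda>h. max 0 h) \<longlongrightarrow> max 0 0) (at (0::real))"
      by (intro tendsto_intros)
    moreover have "\<forall>\<^sub>F h in at (0::real). max 0 h = (max 0 h)\<^sup>2 / h"
      by (auto simp: eventually_at power2_eq_square max_def intro!: exI[of _ 1])
    ultimately have "((\<lambda>h::real. (max 0 h)\<^sup>2 / h) \<longlongrightarrow> 0) (at 0)"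
      by (auto dest: Lim_transform_eventually)
    then show ?thesis using 3 by (simp add: has_field_derivative_iff)
  qed
qed

lemma cutoff_has_real_derivative:
  "((\<lambda>t. cutoff R (x + t *\<^sub>R axis i 1)) has_real_derivative cutoff_deriv R i x) (at 0)"
proof -
  have "((\<lambda>t. 1 - c * ((x + t *\<^sub>R axis i 1) \<bullet> (x + t *\<^sub>R axis i 1))) has_real_derivative - 2 * (c * (x $ i))) (at 0)" for c
    by (auto intro!: derivative_eq_intros simp: has_field_derivative_def inner_axis inner_axis' fun_eq_iff
        algebra_simps)
  from this[of "1 / R\<^sup>2"]
  have "((\<lambda>t. 1 - ((x + t *\<^sub>R axis i 1) \<bullet> (x + t *\<^sub>R axis i 1)) / R\<^sup>2) has_real_derivative - 2 * (x $ i / R\<^sup>2)) (at 0)"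
    by simp
  then have "((\<lambda>t. 1 - (norm (x + t *\<^sub>R axis i 1))\<^sup>2 / R\<^sup>2) has_real_derivative - 2 * (x $ i / R\<^sup>2)) (at 0)"
    by (simp add: power2_norm_eq_inner)
  from DERIV_chain2[OF max_0_sq_has_real_derivative this]
  show ?thesis by (simp add: cutoff_def cutoff_deriv_def mult_ac)
qed

lemma cutoff_bounds: "0 \<le> cutoff R v" "cutoff R v \<le> 1"
proof -
  show "0 \<le> cutoff R v" by (simp add: cutoff_def)
  have "(max 0 (1 - (norm v)\<^sup>2 / R\<^sup>2))\<^sup>2 \<le> 1\<^sup>2" by (rule power_mono) auto
  then show "cutoff R v \<le> 1" by (simp add: cutoff_def)
qed

lemma cutoff_outside:
  assumes "0 < R" "R \<le> norm v"
  shows "cutoff R v = 0" "cutoff_deriv R i v = 0"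
proof -
  have "R\<^sup>2 \<le> (norm v)\<^sup>2" using assms by (intro power_mono) auto
  then have "max 0 (1 - (norm v)\<^sup>2 / R\<^sup>2) = 0" using assms by (simp add: field_simps max_def)
  then show "cutoff R v = 0" "cutoff_deriv R i v = 0" by (simp_all add: cutoff_def cutoff_deriv_def)
qed

lemma continuous_on_cutoff: "continuous_on UNIV (cutoff R)" "continuous_on UNIV (cutoff_deriv R i)"
  unfolding cutoff_def[abs_def] cutoff_deriv_def[abs_def] divide_inverse
  by (intro continuous_intros)+

text \<open>Second partial derivatives may be unbounded, but multiplied by a cutoff they are bounded
  by compactness, as the coordinatewise Stein identity demands.\<close>

lemma continuous_support_bounded:
  fixes f :: "real ^ 'd::finite \<Rightarrow> real"
  assumes f: "continuous_on UNIV f" and 0: "\<And>v. R \<le> norm v \<Longrightarrow> f v = 0"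
  obtains B where "\<And>v. \<bar>f v\<bar> \<le> B"
proof -
  have "compact (f ` cball 0 R)"
    by (intro compact_continuous_image continuous_on_subset[OF f]) auto
  then obtain B where B: "\<And>v. v \<in> cball 0 R \<Longrightarrow> \<bar>f v\<bar> \<le> B"
    using compact_imp_bounded by (fastforce simp: bounded_iff)
  have "\<bar>f v\<bar> \<le> max B 0" for v using B[of v] 0[of v] by (cases "norm v \<le> R") auto
  then show thesis by (rule that)
qed

lemma cutoff_tendsto:
  "(\<lambda>n. cutoff (real (Suc n)) v) \<longlonglongrightarrow> 1" "(\<lambda>n. cutoff_deriv (real (Suc n)) i v) \<longlonglongrightarrow> 0"
proof -
  have "(\<lambda>n. c / (real (Suc n))\<^sup>2) \<longlonglongrightarrow> 0" for c
    by real_asymp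
  note z = this
  have "(\<lambda>n. (max 0 (1 - (norm v)\<^sup>2 / (real (Suc n))\<^sup>2))\<^sup>2) \<longlonglongrightarrow> (max 0 (1 - 0))\<^sup>2"
    by (intro tendsto_power tendsto_max tendsto_diff tendsto_const z)
  then show "(\<lambda>n. cutoff (real (Suc n)) v) \<longlonglongrightarrow> 1" by (simp add: cutoff_def)
  have "(\<lambda>n. - 4 * (v $ i / (real (Suc n))\<^sup>2) * max 0 (1 - (norm v)\<^sup>2 / (real (Suc n))\<^sup>2)) \<longlonglongrightarrow> - 4 * 0 * max 0 (1 - 0)"
    by (intro tendsto_mult tendsto_max tendsto_diff tendsto_const z)
  then show "(\<lambda>n. cutoff_deriv (real (Suc n)) i v) \<longlonglongrightarrow> 0" by (simp add: cutoff_deriv_def)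
qed

text \<open>The bound is uniform in n because the radii are at least 1; it supplies the integrable
  majorant when the cutoff is removed.\<close>

lemma cutoff_deriv_bound: "\<bar>cutoff_deriv (real (Suc n)) i v\<bar> \<le> 4 * norm v"
proof -
  let ?R = "real (Suc n)"
  have m: "0 \<le> max 0 (1 - (norm v)\<^sup>2 / ?R\<^sup>2)" "max 0 (1 - (norm v)\<^sup>2 / ?R\<^sup>2) \<le> 1" by auto
  have "\<bar>v $ i\<bar> / ?R\<^sup>2 \<le> \<bar>v $ i\<bar> / 1"
    by (intro divide_left_mono) (auto simp: one_le_power)
  then have "\<bar>v $ i / ?R\<^sup>2\<bar> \<le> norm v" using component_le_norm_cart[of v i] by simp
  then have "\<bar>v $ i / ?R\<^sup>2\<bar> * max 0 (1 - (norm v)\<^sup>2 / ?R\<^sup>2) \<le> norm v * 1"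
    using m by (intro mult_mono) auto
  then show ?thesis using m by (simp add: cutoff_deriv_def abs_mult)
qed

context prob_space
begin

text \<open>Coordinate i is independent of the vector of the others, so freezing the latter reduces
  the claim to Stein's identity on a line.\<close>

lemma gaussian_coord_stein:
  fixes V :: "'a \<Rightarrow> real ^ 'd::finite"
  assumes V: "gaussian_vector M h V"
    and c: "continuous_on UNIV \<phi>" and c': "continuous_on UNIV \<phi>'"
    and D: "\<And>x. ((\<lambda>t. \<phi> (x + t *\<^sub>R axis i 1)) has_real_derivative \<phi>' x) (at 0)"
    and B: "\<And>x. \<bar>\<phi> x\<bar> \<le> B" and K: "\<And>x. \<bar>\<phi>' x\<bar> \<le> K"
  shows "integrable M (\<lambda>\<omega>. V \<omega> $ i * \<phi> (V \<omega>))"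
    and "expectation (\<lambda>\<omega>. V \<omega> $ i * \<phi> (V \<omega>)) = h * expectation (\<lambda>\<omega>. \<phi>' (V \<omega>))"
proof -
  have h: "0 < h" and Vm[measurable]: "V \<in> borel_measurable M"
    and Z: "distributed M lborel (\<lambda>\<omega>. V \<omega> $ i) (normal_density 0 (sqrt h))"
    using V by (auto simp: gaussian_vector_def)
  have [measurable]: "\<phi> \<in> borel_measurable borel" "\<phi>' \<in> borel_measurable borel"
    using c c' by (auto intro: borel_measurable_continuous_onI)
  define X where "X \<omega> = (\<Sum>k\<in>UNIV - {i}. V \<omega> $ k *\<^sub>R axis k 1 :: real ^ 'd)" for \<omega>
  define Y where "Y \<omega> = V \<omega> $ i" for \<omega>
  have ind: "indep_pair M borel X borel Y"
    unfolding X_def[abs_def] Y_def[abs_def] by (rule gaussian_vector_split[OF V]) auto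
  have S: "V \<omega> = X \<omega> + Y \<omega> *\<^sub>R axis i 1" for \<omega>
    unfolding X_def Y_def
    by (subst sum_axis_eq[symmetric], subst sum.remove[of UNIV i]) auto
  show int: "integrable M (\<lambda>\<omega>. V \<omega> $ i * \<phi> (V \<omega>))"
  proof (rule Bochner_Integration.integrable_bound)
    show "integrable M (\<lambda>\<omega>. B * norm (V \<omega> $ i))"
      by (intro integrable_mult_right sq_int_imp_integrable_norm gaussian_vector_coord[OF V])
    show "AE \<omega> in M. norm (V \<omega> $ i * \<phi> (V \<omega>)) \<le> norm (B * norm (V \<omega> $ i))"
    proof (rule AE_I2)
      fix \<omega>
      have "\<bar>V \<omega> $ i\<bar> * \<bar>\<phi> (V \<omega>)\<bar> \<le> \<bar>V \<omega> $ i\<bar> * \<bar>B\<bar>"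
        using B[of "V \<omega>"] by (intro mult_left_mono) auto
      then show "norm (V \<omega> $ i * \<phi> (V \<omega>)) \<le> norm (B * norm (V \<omega> $ i))"
        by (simp add: abs_mult mult.commute)
    qed
  qed measurable
  have int': "integrable M (\<lambda>\<omega>. \<phi>' (V \<omega>))"
    by (rule integrable_const_bound[where B=K]) (use K in auto)
  have "expectation (\<lambda>\<omega>. V \<omega> $ i * \<phi> (V \<omega>))
      = (\<integral>\<omega>. (\<integral>\<omega>'. Y \<omega>' * \<phi> (X \<omega> + Y \<omega>' *\<^sub>R axis i 1) \<partial>M) \<partial>M)"
  proof -
    have e: "V \<omega> $ i * \<phi> (V \<omega>) = Y \<omega> * \<phi> (X \<omega> + Y \<omega> *\<^sub>R axis i 1)" for \<omega>
      by (simp only: S[symmetric]) (simp only: Y_def)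
    show ?thesis unfolding e
      by (rule indep_pair_iterated_integral(2)[OF ind, of "\<lambda>x y. y * \<phi> (x + y *\<^sub>R axis i 1)"])
        (use int in \<open>simp_all add: e\<close>)
  qed
  also have "\<dots> = (\<integral>\<omega>. h * (\<integral>\<omega>'. \<phi>' (X \<omega> + Y \<omega>' *\<^sub>R axis i 1) \<partial>M) \<partial>M)"
  proof (rule Bochner_Integration.integral_cong[OF refl])
    fix \<omega>
    let ?x = "X \<omega>"
    \<comment> \<open>The assumption differentiates at the start of each axis-parallel line only;
      moving the base point along the line gives the derivative everywhere.\<close>
    have D': "((\<lambda>t. \<phi> (?x + t *\<^sub>R axis i 1)) has_real_derivative \<phi>' (?x + t *\<^sub>R axis i 1)) (at t)" for t
    proof -
      have "((\<lambda>s. \<phi> (?x + (s + t) *\<^sub>R axis i 1)) has_real_derivative \<phi>' (?x + t *\<^sub>R axis i 1)) (at 0)"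
        using D[of "?x + t *\<^sub>R axis i 1"] by (simp add: algebra_simps)
      then show ?thesis using DERIV_shift[of "\<lambda>t. \<phi> (?x + t *\<^sub>R axis i 1)" _ 0 t] by simp
    qed
    have ct: "isCont (\<lambda>t. \<phi>' (?x + t *\<^sub>R axis i 1)) t" for t
    proof -
      have "continuous_on UNIV (\<lambda>t. \<phi>' (?x + t *\<^sub>R axis i 1))"
        by (intro continuous_on_compose2[OF c'] continuous_intros) auto
      then show ?thesis by (simp add: continuous_on_eq_continuous_at)
    qed
    show "(\<integral>\<omega>'. Y \<omega>' * \<phi> (?x + Y \<omega>' *\<^sub>R axis i 1) \<partial>M) = h * (\<integral>\<omega>'. \<phi>' (?x + Y \<omega>' *\<^sub>R axis i 1) \<partial>M)"
      using normal_stein(3)[OF Z _ D' ct K] h by (simp add: Y_def)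
  qed
  also have "\<dots> = h * expectation (\<lambda>\<omega>. \<phi>' (V \<omega>))"
    using indep_pair_iterated_integral(2)[OF ind, of "\<lambda>x y. \<phi>' (x + y *\<^sub>R axis i 1)"] int'
    by (simp add: S[symmetric])
  finally show "expectation (\<lambda>\<omega>. V \<omega> $ i * \<phi> (V \<omega>)) = h * expectation (\<lambda>\<omega>. \<phi>' (V \<omega>))" .
qed

text \<open>The coordinate identities are applied to the cutoff times the i-th partial derivative
  and summed over i before the cutoff is removed. Only the sum of the second partials has a growth
  bound, so the limit can be taken only after summation. The factor r is the chain rule, the factor
  h the variance.\<close>

lemma gaussian_laplacian_stein:
  fixes V :: "'a \<Rightarrow> real ^ 'd::finite" and g2 :: "'d \<Rightarrow> real ^ 'd \<Rightarrow> real"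
  assumes V: "gaussian_vector M h V" and g: "bounded_gradient g g1 K"
    and c2: "\<And>i. continuous_on UNIV (g2 i)"
    and D2: "\<And>i x. ((\<lambda>t. g1 (x + t *\<^sub>R axis i 1) $ i) has_real_derivative g2 i x) (at 0)"
    and lap: "\<And>x. \<bar>\<Sum>i\<in>UNIV. g2 i x\<bar> \<le> C * (1 + norm (x - x0))"
  shows "integrable M (\<lambda>\<omega>. \<Sum>i\<in>UNIV. g2 i (y + r *\<^sub>R V \<omega>))"
    and "expectation (\<lambda>\<omega>. V \<omega> \<bullet> g1 (y + r *\<^sub>R V \<omega>)) = r * h * expectation (\<lambda>\<omega>. \<Sum>i\<in>UNIV. g2 i (y + r *\<^sub>R V \<omega>))"
proof -
  have h: "0 < h" and Vm[measurable]: "V \<in> borel_measurable M"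
    using V by (auto simp: gaussian_vector_def)
  have cg1: "continuous_on UNIV g1" and K: "norm (g1 x) \<le> K" for x
    using g by (auto simp: bounded_gradient_def)
  have K0: "0 \<le> K" using K norm_ge_zero order_trans by blast
  have g1b: "\<bar>g1 x $ j\<bar> \<le> K" for x j using component_le_norm_cart[of "g1 x" j] K[of x] by linarith
  note [measurable] = bounded_gradient_measurable[OF g]
  have [measurable]: "g2 i \<in> borel_measurable borel" for i using c2 by (rule borel_measurable_continuous_onI)
  have [measurable]: "cutoff R \<in> borel_measurable borel" "cutoff_deriv R i \<in> borel_measurable borel"
    for R and i :: 'd
    by (rule borel_measurable_continuous_onI continuous_on_cutoff)+
  note sqV = gaussian_vector_L2(1)[OF V]
  note iV = sq_int_imp_integrable_norm[OF sqV]
  have C0: "0 \<le> C"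
    using lap[of x0] by (simp add: order_trans[OF abs_ge_zero])
  define lp where "lp \<omega> = (\<Sum>i\<in>UNIV. g2 i (y + r *\<^sub>R V \<omega>))" for \<omega>
  have [measurable]: "lp \<in> borel_measurable M" unfolding lp_def[abs_def] by measurable
  define w where "w \<omega> = C * (1 + norm (y - x0)) + C * \<bar>r\<bar> * norm (V \<omega>)" for \<omega>
  have iw: "integrable M w" unfolding w_def[abs_def] using iV by simp
  have lpw: "\<bar>lp \<omega>\<bar> \<le> w \<omega>" for \<omega>
  proof -
    have "norm (y + r *\<^sub>R V \<omega> - x0) \<le> norm (y - x0) + \<bar>r\<bar> * norm (V \<omega>)"
      using norm_triangle_ineq[of "y - x0" "r *\<^sub>R V \<omega>"] by (simp add: algebra_simps)
    then have "C * (1 + norm (y + r *\<^sub>R V \<omega> - x0)) \<le> C * (1 + (norm (y - x0) + \<bar>r\<bar> * norm (V \<omega>)))"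
      using C0 by (intro mult_left_mono) auto
    then show ?thesis using lap[of "y + r *\<^sub>R V \<omega>"] by (simp add: lp_def w_def algebra_simps)
  qed
  show ilp: "integrable M (\<lambda>\<omega>. \<Sum>i\<in>UNIV. g2 i (y + r *\<^sub>R V \<omega>))"
    using Bochner_Integration.integrable_bound[OF iw, of lp] lpw
    by (simp add: lp_def[abs_def] order_trans[OF _ abs_ge_self])
  \<comment> \<open>\<open>L\<close> and \<open>E\<close> are the two sides of the summed identity
    at cutoff radius n + 1; the part of \<open>E\<close> with \<open>cutoff_deriv\<close> disappears
    in the limit.\<close>
  define L where "L n \<omega> = cutoff (real (Suc n)) (V \<omega>) * (V \<omega> \<bullet> g1 (y + r *\<^sub>R V \<omega>))" for n \<omega>
  define E where "E n \<omega> = (\<Sum>i\<in>UNIV. cutoff_deriv (real (Suc n)) i (V \<omega>) * g1 (y + r *\<^sub>R V \<omega>) $ i)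
      + cutoff (real (Suc n)) (V \<omega>) * (r * lp \<omega>)" for n \<omega>
  have LE: "expectation (L n) = h * expectation (E n)" for n
  proof -
    define R where "R = real (Suc n)"
    have R: "0 < R" by (simp add: R_def)
    define \<phi> where "\<phi> i v = cutoff R v * g1 (y + r *\<^sub>R v) $ i" for i v
    define \<phi>' where "\<phi>' i v = cutoff_deriv R i v * g1 (y + r *\<^sub>R v) $ i + cutoff R v * (r * g2 i (y + r *\<^sub>R v))" for i v
    have c\<phi>: "continuous_on UNIV (\<phi> i)" for i
      unfolding \<phi>_def[abs_def]
      by (intro continuous_intros continuous_on_cutoff continuous_on_compose2[OF cg1]) auto
    have c\<phi>': "continuous_on UNIV (\<phi>' i)" for i
      unfolding \<phi>'_def[abs_def]
      by (intro continuous_intros continuous_on_cutoff continuous_on_compose2[OF cg1] continuous_on_compose2[OF c2]) auto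
    have D: "((\<lambda>t. \<phi> i (x + t *\<^sub>R axis i 1)) has_real_derivative \<phi>' i x) (at 0)" for i x
    proof -
      have 1: "((\<lambda>s. g1 ((y + r *\<^sub>R x) + s *\<^sub>R axis i 1) $ i) has_real_derivative g2 i (y + r *\<^sub>R x)) (at (r * 0))"
        using D2[of "y + r *\<^sub>R x" i] by simp
      have 2: "((\<lambda>t. r * t) has_real_derivative r) (at 0)" by (auto intro!: derivative_eq_intros)
      have "((\<lambda>t. g1 ((y + r *\<^sub>R x) + (r * t) *\<^sub>R axis i 1) $ i) has_real_derivative g2 i (y + r *\<^sub>R x) * r) (at 0)"
        by (rule DERIV_chain2[OF 1 2])
      then have "((\<lambda>t. g1 (y + r *\<^sub>R (x + t *\<^sub>R axis i 1)) $ i) has_real_derivative g2 i (y + r *\<^sub>R x) * r) (at 0)"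
        by (simp add: algebra_simps)
      from DERIV_mult[OF cutoff_has_real_derivative[of R x i] this]
      show ?thesis unfolding \<phi>_def \<phi>'_def by (simp add: algebra_simps)
    qed
    have B: "\<bar>\<phi> i v\<bar> \<le> 1 * K" for i v
      unfolding \<phi>_def abs_mult using cutoff_bounds[of R v] g1b by (intro mult_mono) auto
    have st: "integrable M (\<lambda>\<omega>. V \<omega> $ i * \<phi> i (V \<omega>)) \<and> integrable M (\<lambda>\<omega>. \<phi>' i (V \<omega>)) \<and>
      expectation (\<lambda>\<omega>. V \<omega> $ i * \<phi> i (V \<omega>)) = h * expectation (\<lambda>\<omega>. \<phi>' i (V \<omega>))" for i
    proof -
      \<comment> \<open>This bound depends on R and serves integrability at fixed radius; domination
        as R grows comes from \<open>w\<close> instead.\<close>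
      obtain B' where B': "\<And>v. \<bar>\<phi>' i v\<bar> \<le> B'"
        using continuous_support_bounded[OF c\<phi>', of R] cutoff_outside[OF R] by (metis \<phi>'_def add_0 mult_zero_left)
      have [measurable]: "\<phi>' i \<in> borel_measurable borel" using c\<phi>' by (rule borel_measurable_continuous_onI)
      have "integrable M (\<lambda>\<omega>. \<phi>' i (V \<omega>))"
        by (rule integrable_const_bound[where B=B']) (use B' in auto)
      then show ?thesis using gaussian_coord_stein[OF V c\<phi> c\<phi>' D B B'] by simp
    qed
    have "expectation (L n) = expectation (\<lambda>\<omega>. \<Sum>i\<in>UNIV. V \<omega> $ i * \<phi> i (V \<omega>))"
      by (simp add: L_def[abs_def] \<phi>_def inner_vec_def sum_distrib_left R_def mult_ac)
    also have "\<dots> = h * expectation (\<lambda>\<omega>. \<Sum>i\<in>UNIV. \<phi>' i (V \<omega>))"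
      using st by (simp add: sum_distrib_left)
    also have "(\<lambda>\<omega>. \<Sum>i\<in>UNIV. \<phi>' i (V \<omega>)) = E n"
      by (simp add: E_def[abs_def] \<phi>'_def lp_def sum.distrib sum_distrib_left R_def)
    finally show ?thesis .
  qed
  have "(\<lambda>n. expectation (L n)) \<longlonglongrightarrow> expectation (\<lambda>\<omega>. V \<omega> \<bullet> g1 (y + r *\<^sub>R V \<omega>))"
  proof (rule integral_dominated_convergence[where w="\<lambda>\<omega>. K * norm (V \<omega>)"])
    show "AE \<omega> in M. (\<lambda>n. L n \<omega>) \<longlonglongrightarrow> V \<omega> \<bullet> g1 (y + r *\<^sub>R V \<omega>)"
    proof (rule AE_I2)
      fix \<omega>
      have "(\<lambda>n. L n \<omega>) \<longlonglongrightarrow> 1 * (V \<omega> \<bullet> g1 (y + r *\<^sub>R V \<omega>))"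
        unfolding L_def by (intro tendsto_mult cutoff_tendsto tendsto_const)
      then show "(\<lambda>n. L n \<omega>) \<longlonglongrightarrow> V \<omega> \<bullet> g1 (y + r *\<^sub>R V \<omega>)" by simp
    qed
    show "AE \<omega> in M. norm (L n \<omega>) \<le> K * norm (V \<omega>)" for n
    proof (rule AE_I2)
      fix \<omega>
      have "\<bar>V \<omega> \<bullet> g1 (y + r *\<^sub>R V \<omega>)\<bar> \<le> norm (V \<omega>) * K"
        using Cauchy_Schwarz_ineq2[of "V \<omega>" "g1 (y + r *\<^sub>R V \<omega>)"] mult_left_mono[OF K norm_ge_zero[of "V \<omega>"]]
        by (rule order_trans)
      then have "\<bar>cutoff (real (Suc n)) (V \<omega>)\<bar> * \<bar>V \<omega> \<bullet> g1 (y + r *\<^sub>R V \<omega>)\<bar> \<le> 1 * (norm (V \<omega>) * K)"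
        using cutoff_bounds[of "real (Suc n)" "V \<omega>"] by (intro mult_mono) auto
      then show "norm (L n \<omega>) \<le> K * norm (V \<omega>)" by (simp add: L_def abs_mult mult.commute)
    qed
    show "L n \<in> borel_measurable M" for n unfolding L_def[abs_def] by measurable
  qed (use iV in auto)
  moreover have "(\<lambda>n. h * expectation (E n)) \<longlonglongrightarrow> h * expectation (\<lambda>\<omega>. r * lp \<omega>)"
  proof (intro tendsto_mult_left integral_dominated_convergence[where w="\<lambda>\<omega>. real CARD('d) * (4 * norm (V \<omega>) * K) + \<bar>r\<bar> * w \<omega>"])
    show "AE \<omega> in M. (\<lambda>n. E n \<omega>) \<longlonglongrightarrow> r * lp \<omega>"
    proof (rule AE_I2)
      fix \<omega>
      have "(\<lambda>n. E n \<omega>) \<longlonglongrightarrow> (\<Sum>i\<in>(UNIV::'d set). 0 * g1 (y + r *\<^sub>R V \<omega>) $ i) + 1 * (r * lp \<omega>)"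
        unfolding E_def by (intro tendsto_mult cutoff_tendsto tendsto_const tendsto_add tendsto_sum)
      then show "(\<lambda>n. E n \<omega>) \<longlonglongrightarrow> r * lp \<omega>" by simp
    qed
    show "AE \<omega> in M. norm (E n \<omega>) \<le> real CARD('d) * (4 * norm (V \<omega>) * K) + \<bar>r\<bar> * w \<omega>" for n
    proof (rule AE_I2)
      fix \<omega>
      have "\<bar>\<Sum>i\<in>UNIV. cutoff_deriv (real (Suc n)) i (V \<omega>) * g1 (y + r *\<^sub>R V \<omega>) $ i\<bar>
        \<le> (\<Sum>i\<in>(UNIV::'d set). 4 * norm (V \<omega>) * K)"
        by (rule order_trans[OF sum_abs sum_mono], unfold abs_mult, intro mult_mono cutoff_deriv_bound g1b) auto
      moreover have "\<bar>cutoff (real (Suc n)) (V \<omega>)\<bar> * \<bar>r * lp \<omega>\<bar> \<le> 1 * (\<bar>r\<bar> * w \<omega>)"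
        using cutoff_bounds[of "real (Suc n)" "V \<omega>"] lpw[of \<omega>]
        by (intro mult_mono) (auto simp: abs_mult intro: mult_left_mono)
      moreover have "norm (E n \<omega>) \<le> \<bar>\<Sum>i\<in>UNIV. cutoff_deriv (real (Suc n)) i (V \<omega>) * g1 (y + r *\<^sub>R V \<omega>) $ i\<bar>
          + \<bar>cutoff (real (Suc n)) (V \<omega>)\<bar> * \<bar>r * lp \<omega>\<bar>"
        unfolding E_def real_norm_def abs_mult[of "cutoff _ _", symmetric] by (rule abs_triangle_ineq)
      ultimately show "norm (E n \<omega>) \<le> real CARD('d) * (4 * norm (V \<omega>) * K) + \<bar>r\<bar> * w \<omega>"
        by (simp only: sum_constant mult_1_left)
    qed
    show "E n \<in> borel_measurable M" for n unfolding E_def[abs_def] by measurable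
  qed (use iV iw in auto)
  ultimately have "expectation (\<lambda>\<omega>. V \<omega> \<bullet> g1 (y + r *\<^sub>R V \<omega>)) = h * expectation (\<lambda>\<omega>. r * lp \<omega>)"
    unfolding LE by (rule LIMSEQ_unique)
  then show "expectation (\<lambda>\<omega>. V \<omega> \<bullet> g1 (y + r *\<^sub>R V \<omega>)) = r * h * expectation (\<lambda>\<omega>. \<Sum>i\<in>UNIV. g2 i (y + r *\<^sub>R V \<omega>))"
    by (simp add: lp_def)
qed

text \<open>The constant \<open>2 / 3\<close> is \<open>\<integral>_0^1 2 r^2 dr\<close>, from \<open>E |r V| \<le> r sqrt (d h)\<close> and the weight \<open>2 r\<close> in the time integral.\<close>

lemma gaussian_mean_increment_le:
  fixes V :: "'a \<Rightarrow> real ^ 'd::finite" and g2 :: "'d \<Rightarrow> real ^ 'd \<Rightarrow> real"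
  assumes V: "gaussian_vector M h V" and g: "bounded_gradient g g1 K"
    and c2: "\<And>i. continuous_on UNIV (g2 i)"
    and D2: "\<And>i x. ((\<lambda>t. g1 (x + t *\<^sub>R axis i 1) $ i) has_real_derivative g2 i x) (at 0)"
    and lap: "\<And>x. \<bar>\<Sum>i\<in>UNIV. g2 i x\<bar> \<le> 2 * a * (1 + norm (x - x0))" and a: "0 \<le> a"
  shows "expectation (\<lambda>\<omega>. g (y + V \<omega>)) - g y \<le> h * a * (1 + norm (y - x0) + 2 / 3 * sqrt (real CARD('d) * h))"
proof -
  have h: "0 < h" and Vm[measurable]: "V \<in> borel_measurable M"
    using V by (auto simp: gaussian_vector_def)
  have cg1: "continuous_on UNIV g1" and K: "norm (g1 x) \<le> K" for x
    using g by (auto simp: bounded_gradient_def)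
  have K0: "0 \<le> K" using K norm_ge_zero order_trans by blast
  note [measurable] = bounded_gradient_measurable[OF g]
  note sqV = gaussian_vector_L2(1)[OF V]
  note iV = sq_int_imp_integrable_norm[OF sqV]
  interpret P: pair_sigma_finite lborel M ..
  define H where "H r \<omega> = (V \<omega> \<bullet> g1 (y + r *\<^sub>R V \<omega>)) * indicator {0..1::real} r" for r \<omega>
  have Hm[measurable]: "case_prod H \<in> borel_measurable (lborel \<Otimes>\<^sub>M M)"
    unfolding H_def by measurable
  have inner: "\<bar>V \<omega> \<bullet> g1 x\<bar> \<le> K * norm (V \<omega>)" for \<omega> x
    using Cauchy_Schwarz_ineq2[of "V \<omega>" "g1 x"] mult_left_mono[OF K[of x] norm_ge_zero[of "V \<omega>"]]
    by (simp add: mult.commute)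
  have Hint: "integrable (lborel \<Otimes>\<^sub>M M) (case_prod H)"
  proof (rule Bochner_Integration.integrable_bound)
    show "integrable (lborel \<Otimes>\<^sub>M M) (\<lambda>(r, \<omega>). indicator {0..1::real} r * (K * norm (V \<omega>)))"
      by (rule P.Fubini_integrable)
         (use iV K0 in \<open>auto simp: abs_mult\<close>)
    show "AE x in lborel \<Otimes>\<^sub>M M. norm (case_prod H x) \<le> norm (case x of (r, \<omega>) \<Rightarrow> indicator {0..1::real} r * (K * norm (V \<omega>)))"
    proof (rule AE_I2)
      fix x show "norm (case_prod H x) \<le> norm (case x of (r, \<omega>) \<Rightarrow> indicator {0..1::real} r * (K * norm (V \<omega>)))"
        using inner K0 by (cases x) (auto simp: H_def indicator_def)
    qed
  qed measurable
  \<comment> \<open>The increment of g is the integral of its derivative along the segment from y to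
    y + V; Fubini then moves the expectation inside the r-integral, where Stein's identity applies
    for each r.\<close>
  have FTC: "(\<integral>r. H r \<omega> \<partial>lborel) = g (y + V \<omega>) - g y" for \<omega>
  proof -
    have "(\<integral>r. g1 (y + r *\<^sub>R V \<omega>) \<bullet> V \<omega> * indicator {0..1} r \<partial>lborel) = g (y + 1 *\<^sub>R V \<omega>) - g (y + 0 *\<^sub>R V \<omega>)"
    proof (rule integral_FTC_Icc_real)
      show "((\<lambda>r. g (y + r *\<^sub>R V \<omega>)) has_real_derivative g1 (y + r *\<^sub>R V \<omega>) \<bullet> V \<omega>) (at r)" for r
        by (rule bounded_gradient_directional[OF g])
      show "isCont (\<lambda>r. g1 (y + r *\<^sub>R V \<omega>) \<bullet> V \<omega>) r" for r
      proof -
        have "continuous_on UNIV (\<lambda>r. g1 (y + r *\<^sub>R V \<omega>) \<bullet> V \<omega>)"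
          by (intro continuous_intros continuous_on_compose2[OF cg1]) auto
        then show ?thesis by (simp add: continuous_on_eq_continuous_at)
      qed
    qed simp
    then show ?thesis by (simp add: H_def inner_commute)
  qed
  have ig: "integrable M (\<lambda>\<omega>. g (y + V \<omega>))"
    by (intro sq_int_imp_integrable sq_int_Lipschitz[OF _ bounded_gradient_lipschitz[OF g]] sq_int_add sq_int_const sqV)
  define A where "A = 1 + norm (y - x0)"
  define s where "s = sqrt (real CARD('d) * h)"
  have "expectation (\<lambda>\<omega>. g (y + V \<omega>)) - g y = expectation (\<lambda>\<omega>. g (y + V \<omega>) - g y)"
    using ig by (simp add: prob_space)
  also have "\<dots> = (\<integral>\<omega>. (\<integral>r. H r \<omega> \<partial>lborel) \<partial>M)" by (simp add: FTC)
  also have "\<dots> = (\<integral>r. (\<integral>\<omega>. H r \<omega> \<partial>M) \<partial>lborel)"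
    by (rule P.Fubini_integral[OF Hint])
  also have "\<dots> \<le> (\<integral>r. (2 * a * h * (r * A + r\<^sup>2 * s)) * indicator {0..1} r \<partial>lborel)"
  proof (rule integral_mono)
    show "integrable lborel (\<lambda>r. \<integral>\<omega>. H r \<omega> \<partial>M)"
      using P.integrable_fst'[OF Hint] by simp
    show "integrable lborel (\<lambda>r. (2 * a * h * (r * A + r\<^sup>2 * s)) * indicator {0..1} r)"
      by (rule borel_integrable_atLeastAtMost) (auto intro!: continuous_intros)
    show "(\<integral>\<omega>. H r \<omega> \<partial>M) \<le> (2 * a * h * (r * A + r\<^sup>2 * s)) * indicator {0..1} r" for r
    proof (cases "r \<in> {0..1}")
      case True
      have "(\<integral>\<omega>. H r \<omega> \<partial>M) = r * h * expectation (\<lambda>\<omega>. \<Sum>i\<in>UNIV. g2 i (y + r *\<^sub>R V \<omega>))"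
        using gaussian_laplacian_stein(2)[OF V g c2 D2 lap, of y r] True by (simp add: H_def)
      also have "\<dots> \<le> r * h * expectation (\<lambda>\<omega>. 2 * a * (A + r * norm (V \<omega>)))"
      proof (intro mult_left_mono integral_mono gaussian_laplacian_stein(1)[OF V g c2 D2 lap])
        show "integrable M (\<lambda>\<omega>. 2 * a * (A + r * norm (V \<omega>)))" using iV by simp
        show "(\<Sum>i\<in>UNIV. g2 i (y + r *\<^sub>R V \<omega>)) \<le> 2 * a * (A + r * norm (V \<omega>))" for \<omega>
        proof -
          have "norm (y + r *\<^sub>R V \<omega> - x0) \<le> norm (y - x0) + r * norm (V \<omega>)"
            using norm_triangle_ineq[of "y - x0" "r *\<^sub>R V \<omega>"] True by (simp add: algebra_simps)
          then have "2 * a * (1 + norm (y + r *\<^sub>R V \<omega> - x0)) \<le> 2 * a * (A + r * norm (V \<omega>))"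
            using a by (intro mult_left_mono) (auto simp: A_def)
          then show ?thesis using lap[of "y + r *\<^sub>R V \<omega>"] by linarith
        qed
      qed (use True h in simp)
      also have "\<dots> = r * h * (2 * a * (A + r * expectation (\<lambda>\<omega>. norm (V \<omega>))))"
        using iV by (simp add: prob_space)
      also have "\<dots> \<le> r * h * (2 * a * (A + r * s))"
        using expectation_norm_le_L2[OF sqV] gaussian_vector_L2(2)[OF V] True h a
        by (intro mult_left_mono add_mono) (auto simp: s_def)
      finally show ?thesis using True by (simp add: power2_eq_square algebra_simps)
    qed (simp add: H_def)
  qed
  also have "\<dots> = 2 * a * h * (1\<^sup>2 / 2 * A + 1 ^ 3 / 3 * s) - 2 * a * h * (0\<^sup>2 / 2 * A + 0 ^ 3 / 3 * s)"
    by (rule integral_FTC_Icc_real) (auto intro!: derivative_eq_intros continuous_intros simp: power2_eq_square)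
  also have "\<dots> = h * a * (1 + norm (y - x0) + 2 / 3 * sqrt (real CARD('d) * h))"
    by (simp add: A_def s_def algebra_simps)
  finally show ?thesis .
qed

end

section \<open>One Euler step under (R1)\<close>

lemma blinfun_apply_eq_sum_axis:
  fixes A :: "(real ^ 'd::finite) \<Rightarrow>\<^sub>L 'b::real_normed_vector"
  shows "blinfun_apply A v = (\<Sum>i\<in>UNIV. v $ i *\<^sub>R blinfun_apply A (axis i 1))"
  by (subst (1) sum_axis_eq[of v, symmetric]) (simp add: blinfun.sum_right blinfun.scaleR_right)

lemma has_derivative_along_axis:
  fixes f :: "'a::real_normed_vector \<Rightarrow> 'b::real_normed_vector"
  assumes "(f has_derivative f') (at x)"
  shows "((\<lambda>t. f (x + t *\<^sub>R v)) has_vector_derivative f' v) (at 0)"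
proof -
  have "(f has_derivative f') (at (x + 0 *\<^sub>R v))" using assms by simp
  then have "((\<lambda>t. f (x + t *\<^sub>R v)) has_derivative (\<lambda>s. f' (s *\<^sub>R v))) (at 0)"
    by (rule has_derivative_compose[rotated]) (auto intro!: derivative_eq_intros)
  moreover have "f' (s *\<^sub>R v) = s *\<^sub>R f' v" for s
    using assms by (simp add: has_derivative_def bounded_linear.linear linear_scale)
  ultimately show ?thesis by (simp add: has_vector_derivative_def)
qed

text \<open>Difference quotients along v are at most K |v|, hence so are the directional
  derivatives; testing with v equal to the gradient itself bounds its norm by K.\<close>

lemma C1_lipschitz_bounded_gradient:
  fixes f :: "real ^ 'd::finite \<Rightarrow> real"
  assumes f: "C1_map f" and lip: "K-lipschitz_on UNIV f"
  obtains f1 where "bounded_gradient f f1 K"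
proof -
  obtain f' :: "real ^ 'd \<Rightarrow> (real ^ 'd) \<Rightarrow>\<^sub>L real"
    where f': "\<And>x. (f has_derivative blinfun_apply (f' x)) (at x)" and c: "continuous_on UNIV f'"
    using f by (auto simp: C1_map_def)
  define f1 where "f1 x = (\<chi> i. blinfun_apply (f' x) (axis i 1))" for x
  have f1: "f1 x \<bullet> v = blinfun_apply (f' x) v" for x v
    by (subst blinfun_apply_eq_sum_axis) (simp add: f1_def inner_vec_def mult.commute)
  have bd: "\<bar>f1 x \<bullet> v\<bar> \<le> K * norm v" for x v
  proof -
    have "((\<lambda>t. f (x + t *\<^sub>R v)) has_real_derivative f1 x \<bullet> v) (at 0)"
      using has_derivative_along_axis[OF f'] by (simp add: f1 has_real_derivative_iff_has_vector_derivative)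
    then have "((\<lambda>t. \<bar>(f (x + t *\<^sub>R v) - f x) / t\<bar>) \<longlongrightarrow> \<bar>f1 x \<bullet> v\<bar>) (at 0)"
      by (intro tendsto_rabs) (simp add: has_field_derivative_iff)
    moreover have "\<bar>(f (x + t *\<^sub>R v) - f x) / t\<bar> \<le> K * norm v" if "t \<noteq> 0" for t
      using lipschitz_on_normD[OF lip, of "x + t *\<^sub>R v" x] that by (simp add: field_simps)
    then have "\<forall>\<^sub>F t in at 0. \<bar>(f (x + t *\<^sub>R v) - f x) / t\<bar> \<le> K * norm v"
      by (auto simp: eventually_at intro!: exI[of _ 1])
    ultimately show ?thesis by (rule tendsto_upperbound) simp
  qed
  have "norm (f1 x) \<le> K" for x
  proof (cases "f1 x = 0")
    case True then show ?thesis using lipschitz_on_nonneg[OF lip] by simp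
  next
    case False
    have "norm (f1 x) * norm (f1 x) \<le> K * norm (f1 x)"
      using bd[of x "f1 x"] by (simp add: power2_norm_eq_inner[symmetric] power2_eq_square)
    then show ?thesis using False by simp
  qed
  moreover have "continuous_on UNIV f1"
    unfolding f1_def[abs_def] by (intro continuous_on_vec_lambda continuous_intros c)
  ultimately have "bounded_gradient f f1 K"
    using f' by (simp add: bounded_gradient_def f1)
  then show thesis by (rule that)
qed

text \<open>Projecting b onto a unit vector reduces (R1) to a scalar statement with the same
  constants and without dimensional factors. Norms of vectors are recovered later by choosing e
  along the vector to be estimated.\<close>

lemma R1_bounded_gradient:
  fixes b :: "real ^ 'd::finite \<Rightarrow> real ^ 'd"
  assumes R1: "R1 b x0 Lb a" and e: "norm e = 1"
  obtains g1 g2 where "bounded_gradient (\<lambda>x. e \<bullet> b x) g1 Lb"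
    and "\<And>i. continuous_on UNIV (g2 i)"
    and "\<And>i x. ((\<lambda>t. g1 (x + t *\<^sub>R axis i 1) $ i) has_real_derivative g2 i x) (at 0)"
    and "\<And>x. \<bar>\<Sum>i\<in>UNIV. g2 i x\<bar> \<le> 2 * a * (1 + norm (x - x0))"
proof -
  obtain b' :: "real ^ 'd \<Rightarrow> (real ^ 'd) \<Rightarrow>\<^sub>L (real ^ 'd)"
    where b': "\<And>x. (b has_derivative blinfun_apply (b' x)) (at x)" and C1: "C1_map b'"
    using R1 by (auto simp: R1_def C2_map_def)
  obtain b'' :: "real ^ 'd \<Rightarrow> (real ^ 'd) \<Rightarrow>\<^sub>L (real ^ 'd) \<Rightarrow>\<^sub>L (real ^ 'd)"
    where b'': "\<And>x. (b' has_derivative blinfun_apply (b'' x)) (at x)" and c'': "continuous_on UNIV b''"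
    using C1 by (auto simp: C1_map_def)
  have c': "continuous_on UNIV b'"
    using has_derivative_continuous[OF b''] by (simp add: continuous_on_eq_continuous_at)
  have on: "norm (blinfun_apply (b' x) v) \<le> Lb * norm v" for x v
  proof -
    have "frechet_derivative b (at x) = blinfun_apply (b' x)"
      using frechet_derivative_at[OF b'] by simp
    then have J: "jacobian b (at x) *v v = blinfun_apply (b' x) v" for v
      by (simp add: jacobian_def matrix_works bounded_linear.linear blinfun.bounded_linear_right)
    have "onorm (\<lambda>v. jacobian b (at x) *v v) \<le> Lb" using R1 by (simp add: R1_def)
    then have "onorm (blinfun_apply (b' x)) \<le> Lb" by (simp add: J)
    then show ?thesis
      using onorm[OF blinfun.bounded_linear_right[of "b' x"], of v] mult_right_mono[OF _ norm_ge_zero[of v]]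
      by (meson order_trans)
  qed
  define g1 where "g1 x = (\<chi> i. e \<bullet> blinfun_apply (b' x) (axis i 1))" for x
  define g2 where "g2 i x = e \<bullet> blinfun_apply (blinfun_apply (b'' x) (axis i 1)) (axis i 1)" for i x
  have g1: "g1 x \<bullet> v = e \<bullet> blinfun_apply (b' x) v" for x v
    by (subst blinfun_apply_eq_sum_axis) (simp add: g1_def inner_vec_def[of _ v] inner_sum_right mult.commute)
  have "norm (g1 x) \<le> Lb" for x
  proof (cases "g1 x = 0")
    case True then show ?thesis using R1 by (simp add: R1_def)
  next
    case False
    have "norm (g1 x) * norm (g1 x) = e \<bullet> blinfun_apply (b' x) (g1 x)"
      using g1[of x "g1 x"] by (simp add: power2_norm_eq_inner[symmetric] power2_eq_square)
    also have "\<dots> \<le> norm (blinfun_apply (b' x) (g1 x))" using norm_cauchy_schwarz[of e] e by simp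
    also have "\<dots> \<le> Lb * norm (g1 x)" by (rule on)
    finally show ?thesis using False by simp
  qed
  moreover have "((\<lambda>x. e \<bullet> b x) has_derivative (\<lambda>v. g1 x \<bullet> v)) (at x)" for x
    unfolding g1 by (intro has_derivative_inner_right b')
  moreover have "continuous_on UNIV g1"
    unfolding g1_def[abs_def] by (intro continuous_on_vec_lambda continuous_intros c')
  ultimately have 1: "bounded_gradient (\<lambda>x. e \<bullet> b x) g1 Lb" by (simp add: bounded_gradient_def)
  have 2: "continuous_on UNIV (g2 i)" for i
    unfolding g2_def[abs_def] by (intro continuous_intros c'')
  have d2: "((\<lambda>t. blinfun_apply (b' (x + t *\<^sub>R axis i 1)) (axis i 1)) has_vector_derivative
      blinfun_apply (blinfun_apply (b'' x) (axis i 1)) (axis i 1)) (at 0)" for x i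
    using bounded_linear.has_vector_derivative[OF blinfun.bounded_linear_left has_derivative_along_axis[OF b'', of x "axis i 1"]]
    by simp
  have 3: "((\<lambda>t. g1 (x + t *\<^sub>R axis i 1) $ i) has_real_derivative g2 i x) (at 0)" for i x
    using bounded_linear.has_vector_derivative[OF bounded_linear_inner_right d2, of e x i]
    by (simp add: g1_def g2_def has_real_derivative_iff_has_vector_derivative)
  have p1: "partial_deriv j (\<lambda>y. b y $ k) y = blinfun_apply (b' y) (axis j 1) $ k" for j k y
  proof -
    have "((\<lambda>t. b (y + t *\<^sub>R axis j 1) $ k) has_real_derivative blinfun_apply (b' y) (axis j 1) $ k) (at 0)"
      using bounded_linear.has_vector_derivative[OF bounded_linear_vec_nth has_derivative_along_axis[OF b']]
      by (simp add: has_real_derivative_iff_has_vector_derivative)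
    then show ?thesis unfolding partial_deriv_def by (rule DERIV_imp_deriv)
  qed
  \<comment> \<open>This identifies the iterated partial derivatives in \<open>laplacian\<close>
    with diagonal values of the second Frechet derivative, so that the sum of the
    \<open>g2 i\<close> is e . \<open>laplacian b\<close>.\<close>
  have p2: "partial_deriv j (partial_deriv j (\<lambda>y. b y $ k)) x = blinfun_apply (blinfun_apply (b'' x) (axis j 1)) (axis j 1) $ k" for j k x
  proof -
    have "((\<lambda>t. partial_deriv j (\<lambda>y. b y $ k) (x + t *\<^sub>R axis j 1)) has_real_derivative
        blinfun_apply (blinfun_apply (b'' x) (axis j 1)) (axis j 1) $ k) (at 0)"
      unfolding p1 using bounded_linear.has_vector_derivative[OF bounded_linear_vec_nth d2]
      by (simp add: has_real_derivative_iff_has_vector_derivative)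
    then show ?thesis unfolding partial_deriv_def[of j "partial_deriv j (\<lambda>y. b y $ k)"] by (rule DERIV_imp_deriv)
  qed
  have lap: "laplacian b x = (\<Sum>i\<in>UNIV. blinfun_apply (blinfun_apply (b'' x) (axis i 1)) (axis i 1))" for x
    by (simp add: laplacian_def p2 vec_eq_iff)
  have 4: "\<bar>\<Sum>i\<in>UNIV. g2 i x\<bar> \<le> 2 * a * (1 + norm (x - x0))" for x
  proof -
    have "(\<Sum>i\<in>UNIV. g2 i x) = e \<bullet> laplacian b x" by (simp add: g2_def lap inner_sum_right)
    then have "\<bar>\<Sum>i\<in>UNIV. g2 i x\<bar> \<le> norm (laplacian b x)"
      using Cauchy_Schwarz_ineq2[of e "laplacian b x"] e by simp
    also have "\<dots> \<le> 2 * a * (1 + norm (x - x0))" using R1 by (simp add: R1_def)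
    finally show ?thesis .
  qed
  show thesis by (rule that[OF 1 2 3 4])
qed

lemma R1_bounded_gradient_ex:
  assumes "R1 b x0 Lb a" and "norm e = 1"
  shows "\<exists>g1. bounded_gradient (\<lambda>x. e \<bullet> b x) g1 Lb"
  by (rule R1_bounded_gradient[OF assms]) (rule exI)

text \<open>Projection onto the direction of b x - b y reduces the claim to a scalar function with
  gradient bounded by \<open>Lb\<close>.\<close>

lemma R1_lipschitz:
  fixes b :: "real ^ 'd::finite \<Rightarrow> real ^ 'd"
  assumes R1: "R1 b x0 Lb a"
  shows "Lb-lipschitz_on UNIV b"
proof (rule lipschitz_onI)
  show "0 \<le> Lb" using R1 by (simp add: R1_def)
  fix x y
  show "dist (b x) (b y) \<le> Lb * dist x y"
  proof (cases "b x = b y")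
    case True then show ?thesis using \<open>0 \<le> Lb\<close> by simp
  next
    case False
    define e where "e = (b x - b y) /\<^sub>R norm (b x - b y)"
    have "norm e = 1" using False by (simp add: e_def)
    then obtain g1 where "bounded_gradient (\<lambda>x. e \<bullet> b x) g1 Lb"
      using R1_bounded_gradient_ex[OF R1] by metis
    from lipschitz_on_normD[OF bounded_gradient_lipschitz[OF this], of x y]
    have "\<bar>e \<bullet> (b x - b y)\<bar> \<le> Lb * norm (x - y)" by (simp add: inner_diff_right)
    moreover have "e \<bullet> (b x - b y) = norm (b x - b y)"
      using False by (simp add: e_def dot_square_norm power2_eq_square)
    ultimately show ?thesis by (simp add: dist_norm)
  qed
qed

context prob_space
begin

text \<open>The drift shift h b y is split off first: under the same noise it costs at most h
  \<open>Lb\<close> |b y|. What remains is a centred Gaussian shift, treated by the Laplacian bound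
  for the projection onto the direction of the mean increment.\<close>

lemma R1_mean_increment:
  fixes V :: "'a \<Rightarrow> real ^ 'd::finite"
  assumes V: "gaussian_vector M h V" and R1: "R1 b x0 Lb a"
  shows "norm (expectation (\<lambda>\<omega>. b (y + h *\<^sub>R b y + V \<omega>)) - b y)
    \<le> h * Lb * norm (b y) + h * a * (1 + norm (y - x0) + 2 / 3 * sqrt (real CARD('d) * h))"
proof -
  have h: "0 < h" using V by (simp add: gaussian_vector_def)
  have a: "0 \<le> a" using R1 by (simp add: R1_def)
  note lip = R1_lipschitz[OF R1]
  note sqV = gaussian_vector_L2(1)[OF V]
  have sq: "sq_int M (\<lambda>\<omega>. b (z + V \<omega>))" for z
    by (intro sq_int_Lipschitz[OF _ lip] sq_int_add sq_int_const sqV)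
  have int: "integrable M (\<lambda>\<omega>. b (z + V \<omega>))" for z by (rule sq_int_imp_integrable[OF sq])
  have 1: "norm (expectation (\<lambda>\<omega>. b (y + h *\<^sub>R b y + V \<omega>)) - expectation (\<lambda>\<omega>. b (y + V \<omega>))) \<le> h * Lb * norm (b y)"
  proof -
    have "norm (expectation (\<lambda>\<omega>. b (y + h *\<^sub>R b y + V \<omega>)) - expectation (\<lambda>\<omega>. b (y + V \<omega>)))
      = norm (expectation (\<lambda>\<omega>. b (y + h *\<^sub>R b y + V \<omega>) - b (y + V \<omega>)))"
      using int by simp
    also have "\<dots> \<le> expectation (\<lambda>\<omega>. norm (b (y + h *\<^sub>R b y + V \<omega>) - b (y + V \<omega>)))"
      by (rule integral_norm_bound)
    also have "\<dots> \<le> expectation (\<lambda>\<omega>. h * Lb * norm (b y))"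
    proof (rule integral_mono)
      show "norm (b (y + h *\<^sub>R b y + V \<omega>) - b (y + V \<omega>)) \<le> h * Lb * norm (b y)" for \<omega>
        using lipschitz_on_normD[OF lip, of "y + h *\<^sub>R b y + V \<omega>" "y + V \<omega>"] h by (simp add: mult_ac)
    qed (use int in auto)
    finally show ?thesis by (simp add: prob_space)
  qed
  have 2: "norm (expectation (\<lambda>\<omega>. b (y + V \<omega>)) - b y) \<le> h * a * (1 + norm (y - x0) + 2 / 3 * sqrt (real CARD('d) * h))"
  proof (cases "expectation (\<lambda>\<omega>. b (y + V \<omega>)) - b y = 0")
    case True
    then show ?thesis using h a by simp
  next
    case False
    define G where "G = expectation (\<lambda>\<omega>. b (y + V \<omega>)) - b y"
    define e where "e = G /\<^sub>R norm G"
    have e: "norm e = 1" using False by (simp add: e_def G_def)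
    have "expectation (\<lambda>\<omega>. e \<bullet> b (y + V \<omega>)) - e \<bullet> b y \<le> h * a * (1 + norm (y - x0) + 2 / 3 * sqrt (real CARD('d) * h))"
      by (rule R1_bounded_gradient[OF R1 e])
        (rule gaussian_mean_increment_le[where g="\<lambda>x. e \<bullet> b x", OF V _ _ _ _ a]; assumption)
    moreover have "expectation (\<lambda>\<omega>. e \<bullet> b (y + V \<omega>)) - e \<bullet> b y = e \<bullet> G"
      using int by (simp add: G_def inner_diff_right)
    moreover have "e \<bullet> G = norm G"
      using False by (simp add: e_def G_def[symmetric] dot_square_norm power2_eq_square)
    ultimately show ?thesis by (simp add: G_def)
  qed
  show ?thesis
    using norm_triangle_ineq[of "expectation (\<lambda>\<omega>. b (y + h *\<^sub>R b y + V \<omega>)) - expectation (\<lambda>\<omega>. b (y + V \<omega>))"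
        "expectation (\<lambda>\<omega>. b (y + V \<omega>)) - b y"] 1 2
    by simp
qed

text \<open>The Poincare inequality is applied to each of the d components of b, every one having
  gradient at most \<open>Lb\<close>; this is where the factor d in the first term of the constant
  comes from.\<close>

lemma R1_fluctuation:
  fixes V :: "'a \<Rightarrow> real ^ 'd::finite"
  assumes V: "gaussian_vector M h V" and R1: "R1 b x0 Lb a"
  shows "expectation (\<lambda>\<omega>. (norm (b (y + V \<omega>) - expectation (\<lambda>\<omega>. b (y + V \<omega>))))\<^sup>2) \<le> real CARD('d) * h * Lb\<^sup>2"
proof -
  note lip = R1_lipschitz[OF R1]
  note sqV = gaussian_vector_L2(1)[OF V]
  define B where "B \<omega> = b (y + V \<omega>)" for \<omega>
  have sq: "sq_int M B" unfolding B_def[abs_def]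
    by (intro sq_int_Lipschitz[OF _ lip] sq_int_add sq_int_const sqV)
  have int: "integrable M B" by (rule sq_int_imp_integrable[OF sq])
  have sqj: "sq_int M (\<lambda>\<omega>. B \<omega> $ j)" for j
    by (rule sq_int_AE_bound(1)[OF sq])
      (use sq_int_measurable[OF sq] component_le_norm_cart in \<open>auto simp: real_norm_def\<close>)
  have intj: "expectation (\<lambda>\<omega>. B \<omega> $ j) = expectation B $ j" for j
    using integral_bounded_linear[OF bounded_linear_vec_nth int] by simp
  have i2: "integrable M (\<lambda>\<omega>. (B \<omega> $ j - expectation B $ j)\<^sup>2)" for j
    using sq_int_integrable[OF sq_int_diff[OF sqj sq_int_const]] by simp
  have "expectation (\<lambda>\<omega>. (B \<omega> $ j - expectation B $ j)\<^sup>2) \<le> h * Lb\<^sup>2" for j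
  proof -
    have "norm (axis j 1 :: real ^ 'd) = 1" by (simp add: norm_axis_1)
    then obtain g1 where g: "bounded_gradient (\<lambda>x. axis j 1 \<bullet> b x) g1 Lb"
      using R1_bounded_gradient_ex[OF R1] by metis
    have "expectation (\<lambda>\<omega>. (B \<omega> $ j - expectation B $ j)\<^sup>2) = expectation (\<lambda>\<omega>. (B \<omega> $ j)\<^sup>2) - (expectation (\<lambda>\<omega>. B \<omega> $ j))\<^sup>2"
      using variance_eq[OF sq_int_imp_integrable[OF sqj[of j]]] sq_int_integrable[OF sqj[of j]] intj[of j] by simp
    also have "\<dots> \<le> h * Lb\<^sup>2"
      using gaussian_poincare[OF V g, of y] by (simp add: B_def inner_axis')
    finally show ?thesis .
  qed
  then have "(\<Sum>j\<in>UNIV. expectation (\<lambda>\<omega>. (B \<omega> $ j - expectation B $ j)\<^sup>2)) \<le> (\<Sum>j\<in>(UNIV::'d set). h * Lb\<^sup>2)"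
    by (intro sum_mono)
  moreover have "expectation (\<lambda>\<omega>. (norm (B \<omega> - expectation B))\<^sup>2) = (\<Sum>j\<in>UNIV. expectation (\<lambda>\<omega>. (B \<omega> $ j - expectation B $ j)\<^sup>2))"
    unfolding norm_vec_sq using i2 by simp
  ultimately show ?thesis by (simp add: B_def[abs_def])
qed

end

section \<open>Euler chains driven by independent Gaussian increments\<close>

text \<open>A deterministic function of the noise sequence: the chain after k steps is thereby
  visibly a function of the first k increments, and coupling two chains means feeding them related
  sequences.\<close>

primrec euler_chain ::
  "('b::real_vector \<Rightarrow> 'b) \<Rightarrow> real \<Rightarrow> 'b \<Rightarrow> (nat \<Rightarrow> 'b) \<Rightarrow> nat \<Rightarrow> 'b" where
  "euler_chain b h x0 w 0 = x0"
| "euler_chain b h x0 w (Suc k) = euler_chain b h x0 w k + h *\<^sub>R b (euler_chain b h x0 w k) + w k"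

lemma euler_chain_cong:
  "(\<And>i. i < k \<Longrightarrow> w i = w' i) \<Longrightarrow> euler_chain b h x0 w k = euler_chain b h x0 w' k"
  by (induction k) auto

lemma euler_chain_eq_sum:
  "euler_chain b h x0 w k = x0 + h *\<^sub>R (\<Sum>j<k. b (euler_chain b h x0 w j)) + (\<Sum>j<k. w j)"
  by (induction k) (simp_all add: scaleR_right_distrib)

lemma euler_chain_measurable:
  fixes b :: "'b::euclidean_space \<Rightarrow> 'b"
  assumes b[measurable]: "b \<in> borel_measurable borel"
    and w[measurable]: "\<And>i. i < k \<Longrightarrow> (\<lambda>\<omega>. w \<omega> i) \<in> borel_measurable M"
  shows "(\<lambda>\<omega>. euler_chain b h x0 (w \<omega>) k) \<in> borel_measurable M"
  using w
proof (induction k)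
  case (Suc k)
  have [measurable]: "(\<lambda>\<omega>. euler_chain b h x0 (w \<omega>) k) \<in> borel_measurable M" using Suc by simp
  have [measurable]: "(\<lambda>\<omega>. w \<omega> k) \<in> borel_measurable M" using Suc by simp
  show ?case by simp
qed simp

section \<open>Discrete Gronwall comparison and sums of orthogonal increments\<close>

lemma geometric_sum_Suc: "x * (\<Sum>j<n. (1 + x) ^ j) = (1 + x) ^ n - (1::real)"
  by (induction n) (simp_all add: algebra_simps)

text \<open>Comparison with any supersolution r of the same recursion. Leaving r free preserves the
  exact time weights, which an explicit exponential bound would blur; it serves both the growth and
  the error estimate.\<close>

lemma discrete_gronwall_compare:
  fixes u r g :: "nat \<Rightarrow> real"
  assumes u: "\<And>k. k \<le> N \<Longrightarrow> u k \<le> g k + x * (\<Sum>j<k. u j)"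
    and r: "\<And>k. k \<le> N \<Longrightarrow> g k + x * (\<Sum>j<k. r j) \<le> r k"
    and x: "0 \<le> x" and k: "k \<le> N"
  shows "u k \<le> r k"
  using k
proof (induction k rule: less_induct)
  case (less k)
  have "u k \<le> g k + x * (\<Sum>j<k. u j)" using u less by simp
  also have "\<dots> \<le> g k + x * (\<Sum>j<k. r j)"
    using less x by (intro add_left_mono mult_left_mono sum_mono) auto
  also have "\<dots> \<le> r k" using r less by simp
  finally show ?case .
qed

locale gaussian_increments = prob_space M for M :: "'w measure" +
  fixes D :: "nat \<Rightarrow> 'w \<Rightarrow> real ^ 'd::finite" and N :: nat and h :: real
  assumes gauss: "\<And>i. i < N \<Longrightarrow> gaussian_vector M h (D i)"
    and indep: "indep_vars (\<lambda>_. borel) D {..<N}"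
begin

lemma D_measurable: "i < N \<Longrightarrow> D i \<in> borel_measurable M"
  using gauss by (simp add: gaussian_vector_def)

text \<open>The filtration is represented by measurable functions of the first k increments; being
  independent of increment k is all that adaptedness has to deliver.\<close>

lemma history_indep:
  assumes k: "k < N" and f: "f \<in> measurable (PiM {..<k} (\<lambda>_. borel)) S"
  shows "indep_pair M S (\<lambda>\<omega>. f (\<lambda>i\<in>{..<k}. D i \<omega>)) borel (D k)"
proof -
  have "indep_pair M (PiM {..<k} (\<lambda>_. borel)) (\<lambda>\<omega>. \<lambda>i\<in>{..<k}. D i \<omega>) (PiM {k} (\<lambda>_. borel)) (\<lambda>\<omega>. \<lambda>i\<in>{k}. D i \<omega>)"
    by (intro indep_var_imp_indep_pair indep_var_restrict[OF indep]) (use k in auto)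
  then have "indep_pair M S (\<lambda>\<omega>. f (\<lambda>i\<in>{..<k}. D i \<omega>)) borel (\<lambda>\<omega>. (\<lambda>x. x k) (\<lambda>i\<in>{k}. D i \<omega>))"
    by (rule indep_pair_compose) (auto intro: f measurable_component_singleton)
  then show ?thesis by simp
qed

text \<open>Integrating out \<open>D k\<close> first kills the inner product of the new term with
  the past sum, so the variances add. The bound linear in the noise ensures square integrability.
  \<open>\<psi>\<close> is kept general to cover both the plain noise sum and the weighted drift
  fluctuations.\<close>

lemma martingale_sum_L2:
  fixes b :: "real ^ 'd \<Rightarrow> real ^ 'd" and x0 :: "real ^ 'd" and \<psi> :: "nat \<Rightarrow> real ^ 'd \<Rightarrow> real ^ 'd \<Rightarrow> real ^ 'd"
  defines "Y \<equiv> \<lambda>k \<omega>. euler_chain b h x0 (\<lambda>i. D i \<omega>) k"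
  assumes b: "b \<in> borel_measurable borel"
    and m: "\<And>j. case_prod (\<psi> j) \<in> borel_measurable (borel \<Otimes>\<^sub>M borel)"
    and mean: "\<And>j y. j < N \<Longrightarrow> expectation (\<lambda>\<omega>. \<psi> j y (D j \<omega>)) = 0"
    and bound: "\<And>j y w. j < N \<Longrightarrow> norm (\<psi> j y w) \<le> A j + B j * norm w"
    and var: "\<And>j y. j < N \<Longrightarrow> expectation (\<lambda>\<omega>. (norm (\<psi> j y (D j \<omega>)))\<^sup>2) \<le> v j"
    and k: "k \<le> N"
  shows "sq_int M (\<lambda>\<omega>. \<Sum>j<k. \<psi> j (Y j \<omega>) (D j \<omega>)) \<and>
    expectation (\<lambda>\<omega>. (norm (\<Sum>j<k. \<psi> j (Y j \<omega>) (D j \<omega>)))\<^sup>2) \<le> (\<Sum>j<k. v j)"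
  using k
proof (induction k)
  case (Suc k)
  then have kN: "k < N" by simp
  note [measurable] = D_measurable[OF kN] m[of k]
  define S where "S \<omega> = (\<Sum>j<k. \<psi> j (Y j \<omega>) (D j \<omega>))" for \<omega>
  have sS: "sq_int M S" and vS: "expectation (\<lambda>\<omega>. (norm (S \<omega>))\<^sup>2) \<le> (\<Sum>j<k. v j)"
    using Suc by (simp_all add: S_def[abs_def])
  \<comment> \<open>Chain and partial sum are packed into one function of the history, since both
    together must be independent of \<open>D k\<close>.\<close>
  define F where "F u = (euler_chain b h x0 u k, \<Sum>j<k. \<psi> j (euler_chain b h x0 u j) (u j))" for u
  have F: "F \<in> measurable (PiM {..<k} (\<lambda>_. borel)) (borel \<Otimes>\<^sub>M borel)"
  proof -
    have c[measurable]: "(\<lambda>u. u i) \<in> borel_measurable (PiM {..<k} (\<lambda>_. borel))" if "i < k" for i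
      using that by (intro measurable_component_singleton) auto
    have e[measurable]: "(\<lambda>u. euler_chain b h x0 u j) \<in> borel_measurable (PiM {..<k} (\<lambda>_. borel))" if "j \<le> k" for j
      using that by (intro euler_chain_measurable[OF b]) auto
    have "(\<lambda>u. \<psi> j (euler_chain b h x0 u j) (u j)) \<in> borel_measurable (PiM {..<k} (\<lambda>_. borel))" if "j < k" for j
      using measurable_compose[OF measurable_Pair[OF e c] m, of j j j] that by simp
    then show ?thesis unfolding F_def[abs_def]
      by (intro measurable_Pair e borel_measurable_sum) auto
  qed
  have "F (\<lambda>i\<in>{..<k}. D i \<omega>) = (Y k \<omega>, S \<omega>)" for \<omega>
    unfolding F_def S_def Y_def
    by (auto intro!: sum.cong euler_chain_cong arg_cong2[where f="\<psi> _"])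
  with history_indep[OF kN F] have ind: "indep_pair M (borel \<Otimes>\<^sub>M borel) (\<lambda>\<omega>. (Y k \<omega>, S \<omega>)) borel (D k)"
    by simp
  then have YSm: "(\<lambda>\<omega>. (Y k \<omega>, S \<omega>)) \<in> measurable M (borel \<Otimes>\<^sub>M borel)" by (simp add: indep_pair_def)
  have [measurable]: "Y k \<in> borel_measurable M"
    using measurable_compose[OF YSm measurable_fst] by simp
  have [measurable]: "S \<in> borel_measurable M"
    using measurable_compose[OF YSm measurable_snd] by simp
  note sD = gaussian_vector_L2(1)[OF gauss[OF kN]]
  have sw: "sq_int M (\<lambda>\<omega>. A k + B k * norm (D k \<omega>))"
    by (intro sq_int_add sq_int_const sq_int_cmult sq_int_norm sD)
  have b': "norm (\<psi> k y w) \<le> norm (A k + B k * norm w)" for y w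
    using bound[OF kN, of y w] by simp
  have s\<psi>: "sq_int M (\<lambda>\<omega>. \<psi> k (Y k \<omega>) (D k \<omega>))"
    by (rule sq_int_AE_bound(1)[OF sw]) (use b' in auto)
  have s\<psi>y: "sq_int M (\<lambda>\<omega>. \<psi> k y (D k \<omega>))" for y
    by (rule sq_int_AE_bound(1)[OF sw]) (use b' in auto)
  have iS\<psi>: "integrable M (\<lambda>\<omega>. S \<omega> \<bullet> \<psi> k (Y k \<omega>) (D k \<omega>))"
    by (rule sq_int_inner_integrable[OF sS s\<psi>])
  have zero: "expectation (\<lambda>\<omega>. S \<omega> \<bullet> \<psi> k (Y k \<omega>) (D k \<omega>)) = 0"
  proof -
    have "(\<lambda>(ys, w). snd ys \<bullet> \<psi> k (fst ys) w) \<in> borel_measurable ((borel \<Otimes>\<^sub>M borel) \<Otimes>\<^sub>M borel)" by measurable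
    from indep_pair_iterated_integral(2)[OF ind this] iS\<psi>
    have "expectation (\<lambda>\<omega>. S \<omega> \<bullet> \<psi> k (Y k \<omega>) (D k \<omega>)) = (\<integral>\<omega>. (\<integral>\<omega>'. S \<omega> \<bullet> \<psi> k (Y k \<omega>) (D k \<omega>') \<partial>M) \<partial>M)"
      by simp
    also have "\<dots> = (\<integral>\<omega>. 0 \<partial>M)"
      using mean[OF kN] sq_int_imp_integrable[OF s\<psi>y] by (intro Bochner_Integration.integral_cong) auto
    finally show ?thesis by simp
  qed
  have v\<psi>: "expectation (\<lambda>\<omega>. (norm (\<psi> k (Y k \<omega>) (D k \<omega>)))\<^sup>2) \<le> v k"
  proof -
    have mm: "(\<lambda>(ys, w). (norm (\<psi> k (fst ys) w))\<^sup>2) \<in> borel_measurable ((borel \<Otimes>\<^sub>M (borel :: (real ^ 'd) measure)) \<Otimes>\<^sub>M borel)" by measurable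
    note it = indep_pair_iterated_integral[OF ind mm]
    have "expectation (\<lambda>\<omega>. (norm (\<psi> k (Y k \<omega>) (D k \<omega>)))\<^sup>2) = (\<integral>\<omega>. (\<integral>\<omega>'. (norm (\<psi> k (Y k \<omega>) (D k \<omega>')))\<^sup>2 \<partial>M) \<partial>M)"
      using it(2) sq_int_integrable[OF s\<psi>] by simp
    also have "\<dots> \<le> (\<integral>\<omega>. v k \<partial>M)"
      using it(1) sq_int_integrable[OF s\<psi>] var[OF kN] by (intro integral_mono) auto
    finally show ?thesis by (simp add: prob_space)
  qed
  have "sq_int M (\<lambda>\<omega>. S \<omega> + \<psi> k (Y k \<omega>) (D k \<omega>))" by (rule sq_int_add[OF sS s\<psi>])
  moreover have "expectation (\<lambda>\<omega>. (norm (S \<omega> + \<psi> k (Y k \<omega>) (D k \<omega>)))\<^sup>2) \<le> (\<Sum>j<k. v j) + v k"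
  proof -
    have "expectation (\<lambda>\<omega>. (norm (S \<omega> + \<psi> k (Y k \<omega>) (D k \<omega>)))\<^sup>2) =
      expectation (\<lambda>\<omega>. (norm (S \<omega>))\<^sup>2 + 2 * (S \<omega> \<bullet> \<psi> k (Y k \<omega>) (D k \<omega>)) + (norm (\<psi> k (Y k \<omega>) (D k \<omega>)))\<^sup>2)"
      by (intro Bochner_Integration.integral_cong refl)
        (simp add: power2_norm_eq_inner inner_add_left inner_add_right inner_commute)
    also have "\<dots> = expectation (\<lambda>\<omega>. (norm (S \<omega>))\<^sup>2) + expectation (\<lambda>\<omega>. (norm (\<psi> k (Y k \<omega>) (D k \<omega>)))\<^sup>2)"
      using iS\<psi> sq_int_integrable[OF sS] sq_int_integrable[OF s\<psi>] zero by simp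
    finally show ?thesis using vS v\<psi> by linarith
  qed
  ultimately show ?case by (simp add: S_def)
qed simp

end

text \<open>Supersolution for forcing A k + B sqrt k: the linear part solves its recursion exactly,
  while in the square-root part sqrt j is replaced by sqrt k under the sum.\<close>

lemma euler_growth_recursion:
  fixes A B x :: real
  assumes A: "0 \<le> A" and x: "0 < x" and B: "0 \<le> B"
  shows "A * real k + B * sqrt (real k) + x * (\<Sum>j<k. A * ((1 + x) ^ j - 1) / x + B * sqrt (real j) * (1 + x) ^ j)
     \<le> A * ((1 + x) ^ k - 1) / x + B * sqrt (real k) * (1 + x) ^ k"
proof -
  have 1: "x * (\<Sum>j<k. A * ((1 + x) ^ j - 1) / x) = A * ((1 + x) ^ k - 1) / x - A * real k"
  proof -
    have "x * (\<Sum>j<k. A * ((1 + x) ^ j - 1) / x) = (\<Sum>j<k. A * (1 + x) ^ j - A)"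
      using x by (auto simp: sum_distrib_left field_simps intro!: sum.cong)
    also have "\<dots> = A * (\<Sum>j<k. (1 + x) ^ j) - A * real k" by (simp add: sum_subtractf sum_distrib_left)
    also have "(\<Sum>j<k. (1 + x) ^ j) = ((1 + x) ^ k - 1) / x"
      using geometric_sum_Suc[of x k] x by (simp add: field_simps)
    finally show ?thesis by simp
  qed
  have "x * (\<Sum>j<k. B * sqrt (real j) * (1 + x) ^ j) \<le> x * (\<Sum>j<k. B * sqrt (real k) * (1 + x) ^ j)"
    using x B by (intro mult_left_mono sum_mono mult_right_mono) auto
  also have "\<dots> = B * sqrt (real k) * (x * (\<Sum>j<k. (1 + x) ^ j))" by (simp add: sum_distrib_left mult_ac)
  also have "\<dots> = B * sqrt (real k) * (1 + x) ^ k - B * sqrt (real k)"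
    unfolding geometric_sum_Suc by (simp add: algebra_simps)
  finally have 2: "x * (\<Sum>j<k. B * sqrt (real j) * (1 + x) ^ j) \<le> B * sqrt (real k) * (1 + x) ^ k - B * sqrt (real k)" .
  show ?thesis using 1 2 by (simp add: sum.distrib distrib_left)
qed

locale euler_setting = gaussian_increments M D N h
  for M :: "'w measure" and D :: "nat \<Rightarrow> 'w \<Rightarrow> real ^ 'd::finite" and N h +
  fixes b :: "real ^ 'd \<Rightarrow> real ^ 'd" and x0 :: "real ^ 'd" and Lb a :: real
  assumes R1: "R1 b x0 Lb a" and h: "0 < h"
begin

definition Y :: "nat \<Rightarrow> 'w \<Rightarrow> real ^ 'd" where
  "Y k \<omega> = euler_chain b h x0 (\<lambda>i. D i \<omega>) k"

text \<open>\<open>dev k\<close> bounds the \<open>L^2\<close>-norm of \<open>Y k - x0\<close>, and \<open>drift_bound k\<close> that of the conditional mean of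
  \<open>b (Y (k + 1)) - b (Y k)\<close> given the first \<open>k\<close> increments, which is \<open>drift_mean k (Y k) - b (Y k)\<close>.\<close>

definition dev :: "nat \<Rightarrow> real" where
  "dev k = norm (b x0) * ((1 + Lb * h) ^ k - 1) / Lb + sqrt (real CARD('d) * h) * sqrt (real k) * (1 + Lb * h) ^ k"

definition drift_mean :: "nat \<Rightarrow> real ^ 'd \<Rightarrow> real ^ 'd" where
  "drift_mean k y = expectation (\<lambda>\<omega>. b (y + h *\<^sub>R b y + D k \<omega>))"

definition drift_bound :: "nat \<Rightarrow> real" where
  "drift_bound k = h * (Lb * (norm (b x0) + Lb * dev k) + a * (1 + dev k + 2 / 3 * sqrt (real CARD('d) * h)))"

lemma Lb: "0 < Lb" and a: "0 \<le> a" using R1 by (auto simp: R1_def)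

lemma lip: "Lb-lipschitz_on UNIV b" by (rule R1_lipschitz[OF R1])

lemma b_measurable[measurable]: "b \<in> borel_measurable borel"
  using lip lipschitz_on_continuous_on borel_measurable_continuous_onI by blast

lemma sq_int_D: "k < N \<Longrightarrow> sq_int M (D k)" using gaussian_vector_L2(1)[OF gauss] .

lemma Y_Suc: "Y (Suc k) \<omega> = Y k \<omega> + h *\<^sub>R b (Y k \<omega>) + D k \<omega>" by (simp add: Y_def)

lemma sq_int_Y: "k \<le> N \<Longrightarrow> sq_int M (Y k)"
proof (induction k)
  case 0
  show ?case using sq_int_const[of x0] by (simp add: Y_def[abs_def])
next
  case (Suc k)
  have "sq_int M (\<lambda>\<omega>. Y k \<omega> + h *\<^sub>R b (Y k \<omega>) + D k \<omega>)"
    by (intro sq_int_add sq_int_scaleR sq_int_Lipschitz[OF _ lip] sq_int_D) (use Suc in auto)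
  then show ?case by (simp add: Y_Suc[abs_def])
qed

lemma L2_noise_sum: "k \<le> N \<Longrightarrow> L2 M (\<lambda>\<omega>. \<Sum>j<k. D j \<omega>) \<le> sqrt (real CARD('d) * h) * sqrt (real k)"
proof -
  assume k: "k \<le> N"
  have "expectation (\<lambda>\<omega>. (norm (\<Sum>j<k. D j \<omega>))\<^sup>2) \<le> (\<Sum>j<k. real CARD('d) * h)"
  proof (rule martingale_sum_L2[where \<psi>="\<lambda>j y w. w" and A="\<lambda>_. 0" and B="\<lambda>_. 1", OF b_measurable, THEN conjunct2])
    show "expectation (\<lambda>\<omega>. (norm (D j \<omega>))\<^sup>2) \<le> real CARD('d) * h" if "j < N" for j
      using gaussian_vector_L2(2)[OF gauss[OF that]] h by (simp add: L2_sq[symmetric])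
  qed (use k gaussian_vector_L2(3)[OF gauss] in auto)
  then show ?thesis
    by (simp add: L2_def real_sqrt_mult[symmetric] mult_ac)
qed

text \<open>Linear growth of b around x0 and the triangle inequality in mean square give a Gronwall
  inequality with rate \<open>Lb\<close> h; the noise contributes the square-root forcing by
  orthogonality.\<close>

lemma L2_dev: "k \<le> N \<Longrightarrow> L2 M (\<lambda>\<omega>. Y k \<omega> - x0) \<le> dev k"
proof (rule discrete_gronwall_compare[where N=N and x="Lb * h" and r=dev
    and g="\<lambda>k. (h * norm (b x0)) * real k + sqrt (real CARD('d) * h) * sqrt (real k)"])
  fix k assume k: "k \<le> N"
  have sqb: "sq_int M (\<lambda>\<omega>. norm (Y j \<omega> - x0))" if "j < k" for j
    using that k by (intro sq_int_norm sq_int_diff sq_int_Y sq_int_const) auto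
  have sqD: "sq_int M (\<lambda>\<omega>. \<Sum>j<k. D j \<omega>)"
    using k by (intro sq_int_sum sq_int_D) auto
  define U where "U \<omega> = (h * norm (b x0)) * real k + Lb * h * (\<Sum>j<k. norm (Y j \<omega> - x0))" for \<omega>
  have sqU: "sq_int M U" unfolding U_def[abs_def]
    by (intro sq_int_add sq_int_const sq_int_cmult sq_int_sum sqb) auto
  have b1: "norm (Y k \<omega> - x0) \<le> U \<omega> + norm (\<Sum>j<k. D j \<omega>)" for \<omega>
  proof -
    have "Y k \<omega> - x0 = h *\<^sub>R (\<Sum>j<k. b (Y j \<omega>)) + (\<Sum>j<k. D j \<omega>)"
      unfolding Y_def by (subst euler_chain_eq_sum) simp
    then have "norm (Y k \<omega> - x0) \<le> h * norm (\<Sum>j<k. b (Y j \<omega>)) + norm (\<Sum>j<k. D j \<omega>)"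
      using norm_triangle_ineq[of "h *\<^sub>R (\<Sum>j<k. b (Y j \<omega>))" "\<Sum>j<k. D j \<omega>"] h by simp
    also have "norm (\<Sum>j<k. b (Y j \<omega>)) \<le> (\<Sum>j<k. norm (b x0) + Lb * norm (Y j \<omega> - x0))"
    proof (intro order_trans[OF norm_sum] sum_mono)
      fix j show "norm (b (Y j \<omega>)) \<le> norm (b x0) + Lb * norm (Y j \<omega> - x0)"
        using lipschitz_on_normD[OF lip, of "Y j \<omega>" x0] norm_triangle_sub[of "b (Y j \<omega>)" "b x0"] by simp
    qed
    finally show ?thesis using h
      by (simp add: U_def sum.distrib sum_distrib_left algebra_simps mult_left_mono)
  qed
  have "L2 M (\<lambda>\<omega>. Y k \<omega> - x0) \<le> L2 M (\<lambda>\<omega>. U \<omega> + norm (\<Sum>j<k. D j \<omega>))"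
  proof (rule sq_int_AE_bound(2))
    show "sq_int M (\<lambda>\<omega>. U \<omega> + norm (\<Sum>j<k. D j \<omega>))" by (intro sq_int_add sqU sq_int_norm sqD)
    show "(\<lambda>\<omega>. Y k \<omega> - x0) \<in> borel_measurable M"
      using sq_int_measurable[OF sq_int_Y[OF k]] by simp
    show "AE \<omega> in M. norm (Y k \<omega> - x0) \<le> norm (U \<omega> + norm (\<Sum>j<k. D j \<omega>))"
      using order_trans[OF b1 abs_ge_self] by (intro AE_I2) simp
  qed
  also have "\<dots> \<le> L2 M U + L2 M (\<lambda>\<omega>. norm (\<Sum>j<k. D j \<omega>))"
    by (intro L2_add_le sqU sq_int_norm sqD)
  also have "L2 M (\<lambda>\<omega>. norm (\<Sum>j<k. D j \<omega>)) \<le> sqrt (real CARD('d) * h) * sqrt (real k)"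
    unfolding L2_norm by (rule L2_noise_sum[OF k])
  also have "L2 M U \<le> L2 M (\<lambda>\<omega>. (h * norm (b x0)) * real k) + L2 M (\<lambda>\<omega>. Lb * h * (\<Sum>j<k. norm (Y j \<omega> - x0)))"
    unfolding U_def[abs_def] by (intro L2_add_le sq_int_const sq_int_cmult sq_int_sum sqb) auto
  also have "L2 M (\<lambda>\<omega>. Lb * h * (\<Sum>j<k. norm (Y j \<omega> - x0))) \<le> Lb * h * (\<Sum>j<k. L2 M (\<lambda>\<omega>. Y j \<omega> - x0))"
  proof -
    have "L2 M (\<lambda>\<omega>. \<Sum>j<k. norm (Y j \<omega> - x0)) \<le> (\<Sum>j<k. L2 M (\<lambda>\<omega>. norm (Y j \<omega> - x0)))"
      by (rule L2_sum_le) (use sqb in auto)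
    then show ?thesis unfolding L2_cmult using Lb h by (simp add: L2_norm)
  qed
  finally show "L2 M (\<lambda>\<omega>. Y k \<omega> - x0) \<le> (h * norm (b x0)) * real k + sqrt (real CARD('d) * h) * sqrt (real k) + Lb * h * (\<Sum>j<k. L2 M (\<lambda>\<omega>. Y j \<omega> - x0))"
    using h by simp
next
  fix k
  have "h * norm (b x0) * z / (Lb * h) = norm (b x0) * z / Lb" for z using h by simp
  then show "(h * norm (b x0)) * real k + sqrt (real CARD('d) * h) * sqrt (real k) + Lb * h * (\<Sum>j<k. dev j) \<le> dev k"
    using euler_growth_recursion[of "h * norm (b x0)" "Lb * h" "sqrt (real CARD('d) * h)" k] Lb h
    by (simp add: dev_def)
qed (use Lb h in auto)

lemma dev_nonneg: "0 \<le> dev k"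
  unfolding dev_def using Lb h one_le_power[of "1 + Lb * h" k] by (intro add_nonneg_nonneg) auto

lemma dev_mono: "j \<le> k \<Longrightarrow> dev j \<le> dev k"
  unfolding dev_def using Lb h power_increasing[of j k "1 + Lb * h"]
  by (intro add_mono mult_mono divide_right_mono) auto

text \<open>Monotonicity is what permits replacing the decreasing weights inside a block by their
  mean.\<close>

lemma drift_bound_mono: "j \<le> k \<Longrightarrow> drift_bound j \<le> drift_bound k"
  unfolding drift_bound_def using dev_mono[of j k] Lb h a
  by (intro mult_left_mono add_mono) auto

lemma drift_bound_nonneg: "0 \<le> drift_bound k"
  unfolding drift_bound_def using dev_nonneg[of k] Lb h a by simp

lemma drift_mean_measurable: "k < N \<Longrightarrow> drift_mean k \<in> borel_measurable borel"
proof -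
  assume k: "k < N"
  note [measurable] = D_measurable[OF k]
  show ?thesis unfolding drift_mean_def[abs_def] by measurable
qed

lemma L2_drift:
  assumes k: "k < N"
  shows "sq_int M (\<lambda>\<omega>. drift_mean k (Y k \<omega>) - b (Y k \<omega>))"
    and "L2 M (\<lambda>\<omega>. drift_mean k (Y k \<omega>) - b (Y k \<omega>)) \<le> drift_bound k"
proof -
  have k': "k \<le> N" using k by simp
  note [measurable] = sq_int_measurable[OF sq_int_Y[OF k']] drift_mean_measurable[OF k]
  define c where "c = h * Lb * norm (b x0) + h * a * (1 + 2 / 3 * sqrt (real CARD('d) * h))"
  define c' where "c' = h * Lb * Lb + h * a"
  have c: "0 \<le> c" "0 \<le> c'" using h Lb a by (auto simp: c_def c'_def)
  define U where "U \<omega> = c + c' * norm (Y k \<omega> - x0)" for \<omega>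
  have sqd: "sq_int M (\<lambda>\<omega>. norm (Y k \<omega> - x0))"
    using k' by (intro sq_int_norm sq_int_diff sq_int_Y sq_int_const) auto
  have sqU: "sq_int M U" unfolding U_def[abs_def] by (intro sq_int_add sq_int_const sq_int_cmult sqd)
  have ae: "AE \<omega> in M. norm (drift_mean k (Y k \<omega>) - b (Y k \<omega>)) \<le> norm (U \<omega>)"
  proof (rule AE_I2)
    fix \<omega>
    have nb: "norm (b (Y k \<omega>)) \<le> norm (b x0) + Lb * norm (Y k \<omega> - x0)"
      using lipschitz_on_normD[OF lip, of "Y k \<omega>" x0] norm_triangle_sub[of "b (Y k \<omega>)" "b x0"] by simp
    have "norm (drift_mean k (Y k \<omega>) - b (Y k \<omega>)) \<le> h * Lb * norm (b (Y k \<omega>)) + h * a * (1 + norm (Y k \<omega> - x0) + 2 / 3 * sqrt (real CARD('d) * h))"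
      unfolding drift_mean_def by (rule R1_mean_increment[OF gauss[OF k] R1])
    also have "\<dots> \<le> h * Lb * (norm (b x0) + Lb * norm (Y k \<omega> - x0)) + h * a * (1 + norm (Y k \<omega> - x0) + 2 / 3 * sqrt (real CARD('d) * h))"
      using nb h Lb by (intro add_right_mono mult_left_mono) auto
    also have "\<dots> = U \<omega>" by (simp add: U_def c_def c'_def algebra_simps)
    finally show "norm (drift_mean k (Y k \<omega>) - b (Y k \<omega>)) \<le> norm (U \<omega>)" by simp
  qed
  show "sq_int M (\<lambda>\<omega>. drift_mean k (Y k \<omega>) - b (Y k \<omega>))"
    by (rule sq_int_AE_bound(1)[OF sqU _ ae]) measurable
  have "L2 M (\<lambda>\<omega>. drift_mean k (Y k \<omega>) - b (Y k \<omega>)) \<le> L2 M U"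
    by (rule sq_int_AE_bound(2)[OF sqU _ ae]) measurable
  also have "\<dots> \<le> L2 M (\<lambda>\<omega>. c) + L2 M (\<lambda>\<omega>. c' * norm (Y k \<omega> - x0))"
    unfolding U_def[abs_def] by (intro L2_add_le sq_int_const sq_int_cmult sqd)
  also have "\<dots> = c + c' * L2 M (\<lambda>\<omega>. Y k \<omega> - x0)" unfolding L2_cmult L2_norm using c by simp
  also have "\<dots> \<le> c + c' * dev k" using L2_dev[OF k'] c by (intro add_left_mono mult_left_mono) auto
  also have "\<dots> = drift_bound k" by (simp add: c_def c'_def drift_bound_def algebra_simps)
  finally show "L2 M (\<lambda>\<omega>. drift_mean k (Y k \<omega>) - b (Y k \<omega>)) \<le> drift_bound k" .
qed

text \<open>The deterministic weights \<open>c j\<close> are left free; summation by parts will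
  supply h (m - 1 - j mod m). The variance of each summand comes from
  \<open>R1_fluctuation\<close>.\<close>

lemma L2_fluctuation_sum:
  assumes k: "k \<le> N"
  shows "sq_int M (\<lambda>\<omega>. \<Sum>j<k. c j *\<^sub>R (b (Y (Suc j) \<omega>) - drift_mean j (Y j \<omega>)))"
    and "L2 M (\<lambda>\<omega>. \<Sum>j<k. c j *\<^sub>R (b (Y (Suc j) \<omega>) - drift_mean j (Y j \<omega>))) \<le> Lb * sqrt (real CARD('d) * h * (\<Sum>j<k. (c j)\<^sup>2))"
proof -
  \<comment> \<open>The default 0 beyond N is there because \<open>martingale_sum_L2\<close> wants
    measurability for every j, while \<open>drift_mean j\<close> is controlled for j < N.\<close>
  define \<psi> where "\<psi> j y w = (if j < N then c j *\<^sub>R (b (y + h *\<^sub>R b y + w) - drift_mean j y) else 0)" for j y w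
  have sqb: "sq_int M (\<lambda>\<omega>. b (z + D j \<omega>))" if "j < N" for z j
    by (intro sq_int_Lipschitz[OF _ lip] sq_int_add sq_int_const sq_int_D that)
  have "sq_int M (\<lambda>\<omega>. \<Sum>j<k. \<psi> j (Y j \<omega>) (D j \<omega>)) \<and>
    expectation (\<lambda>\<omega>. (norm (\<Sum>j<k. \<psi> j (Y j \<omega>) (D j \<omega>)))\<^sup>2) \<le> (\<Sum>j<k. (c j)\<^sup>2 * (real CARD('d) * h * Lb\<^sup>2))"
    unfolding Y_def
  proof (rule martingale_sum_L2[OF b_measurable, where A="\<lambda>j. \<bar>c j\<bar> * (Lb * expectation (\<lambda>\<omega>. norm (D j \<omega>)))" and B="\<lambda>j. \<bar>c j\<bar> * Lb"])
    show "case_prod (\<psi> j) \<in> borel_measurable (borel \<Otimes>\<^sub>M borel)" for j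
    proof (cases "j < N")
      case True
      note [measurable] = drift_mean_measurable[OF True]
      show ?thesis using True unfolding \<psi>_def by simp
    next
      case False
      then have "case_prod (\<psi> j) = (\<lambda>_. 0)" by (auto simp: \<psi>_def)
      then show ?thesis by simp
    qed
    fix j y assume j: "j < N"
    have ib: "integrable M (\<lambda>\<omega>. b (z + D j \<omega>))" for z by (rule sq_int_imp_integrable[OF sqb[OF j]])
    show "expectation (\<lambda>\<omega>. \<psi> j y (D j \<omega>)) = 0"
      using j ib by (simp add: \<psi>_def drift_mean_def prob_space)
    have "expectation (\<lambda>\<omega>. (norm (\<psi> j y (D j \<omega>)))\<^sup>2) = (c j)\<^sup>2 * expectation (\<lambda>\<omega>. (norm (b (y + h *\<^sub>R b y + D j \<omega>) - drift_mean j y))\<^sup>2)"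
      using j by (simp add: \<psi>_def power_mult_distrib)
    also have "\<dots> \<le> (c j)\<^sup>2 * (real CARD('d) * h * Lb\<^sup>2)"
      unfolding drift_mean_def by (intro mult_left_mono R1_fluctuation[OF gauss[OF j] R1]) auto
    finally show "expectation (\<lambda>\<omega>. (norm (\<psi> j y (D j \<omega>)))\<^sup>2) \<le> (c j)\<^sup>2 * (real CARD('d) * h * Lb\<^sup>2)" .
    fix w
    note iD = sq_int_imp_integrable_norm[OF sq_int_D[OF j]]
    let ?z = "y + h *\<^sub>R b y"
    have "norm (b (?z + w) - drift_mean j y) = norm (expectation (\<lambda>\<omega>. b (?z + w) - b (?z + D j \<omega>)))"
      using ib by (simp add: drift_mean_def prob_space)
    also have "\<dots> \<le> expectation (\<lambda>\<omega>. norm (b (?z + w) - b (?z + D j \<omega>)))" by (rule integral_norm_bound)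
    also have "\<dots> \<le> expectation (\<lambda>\<omega>. Lb * norm w + Lb * norm (D j \<omega>))"
    proof (rule integral_mono)
      fix \<omega>
      have "norm (b (?z + w) - b (?z + D j \<omega>)) \<le> Lb * norm (w - D j \<omega>)"
        using lipschitz_on_normD[OF lip, of "?z + w" "?z + D j \<omega>"] by simp
      also have "\<dots> \<le> Lb * (norm w + norm (D j \<omega>))"
        using Lb by (intro mult_left_mono norm_triangle_ineq4) auto
      finally show "norm (b (?z + w) - b (?z + D j \<omega>)) \<le> Lb * norm w + Lb * norm (D j \<omega>)" by (simp add: algebra_simps)
    qed (use ib iD in auto)
    also have "\<dots> = Lb * norm w + Lb * expectation (\<lambda>\<omega>. norm (D j \<omega>))" using iD by (simp add: prob_space)
    finally have "\<bar>c j\<bar> * norm (b (?z + w) - drift_mean j y) \<le> \<bar>c j\<bar> * (Lb * norm w + Lb * expectation (\<lambda>\<omega>. norm (D j \<omega>)))"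
      by (intro mult_left_mono) auto
    then show "norm (\<psi> j y w) \<le> \<bar>c j\<bar> * (Lb * expectation (\<lambda>\<omega>. norm (D j \<omega>))) + \<bar>c j\<bar> * Lb * norm w"
    proof -
      assume le: "\<bar>c j\<bar> * norm (b (?z + w) - drift_mean j y) \<le> \<bar>c j\<bar> * (Lb * norm w + Lb * expectation (\<lambda>\<omega>. norm (D j \<omega>)))"
      have "norm (\<psi> j y w) = \<bar>c j\<bar> * norm (b (?z + w) - drift_mean j y)" using j by (simp add: \<psi>_def)
      also note le
      finally show ?thesis by (simp add: algebra_simps)
    qed
  qed (rule k)
  moreover have "(\<Sum>j<k. \<psi> j (Y j \<omega>) (D j \<omega>)) = (\<Sum>j<k. c j *\<^sub>R (b (Y (Suc j) \<omega>) - drift_mean j (Y j \<omega>)))" for \<omega>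
    using k by (intro sum.cong) (auto simp: \<psi>_def Y_Suc)
  ultimately have *: "sq_int M (\<lambda>\<omega>. \<Sum>j<k. c j *\<^sub>R (b (Y (Suc j) \<omega>) - drift_mean j (Y j \<omega>)))"
    and **: "expectation (\<lambda>\<omega>. (norm (\<Sum>j<k. c j *\<^sub>R (b (Y (Suc j) \<omega>) - drift_mean j (Y j \<omega>))))\<^sup>2) \<le> (\<Sum>j<k. (c j)\<^sup>2 * (real CARD('d) * h * Lb\<^sup>2))"
    by simp_all
  show "sq_int M (\<lambda>\<omega>. \<Sum>j<k. c j *\<^sub>R (b (Y (Suc j) \<omega>) - drift_mean j (Y j \<omega>)))" by (rule *)
  have "(\<Sum>j<k. (c j)\<^sup>2 * (real CARD('d) * h * Lb\<^sup>2)) = Lb\<^sup>2 * (real CARD('d) * h * (\<Sum>j<k. (c j)\<^sup>2))"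
    by (simp add: sum_distrib_left sum_distrib_right mult_ac)
  then have "L2 M (\<lambda>\<omega>. \<Sum>j<k. c j *\<^sub>R (b (Y (Suc j) \<omega>) - drift_mean j (Y j \<omega>))) \<le> sqrt (Lb\<^sup>2 * (real CARD('d) * h * (\<Sum>j<k. (c j)\<^sup>2)))"
    unfolding L2_def using ** by (intro real_sqrt_le_mono) simp
  also have "\<dots> = Lb * sqrt (real CARD('d) * h * (\<Sum>j<k. (c j)\<^sup>2))"
    using Lb by (simp add: real_sqrt_mult)
  finally show "L2 M (\<lambda>\<omega>. \<Sum>j<k. c j *\<^sub>R (b (Y (Suc j) \<omega>) - drift_mean j (Y j \<omega>))) \<le> Lb * sqrt (real CARD('d) * h * (\<Sum>j<k. (c j)\<^sup>2))" .
qed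

end

section \<open>Comparison of a fine and a coarse Euler chain\<close>

lemma one_plus_power_le_exp: "0 \<le> x \<Longrightarrow> (1 + x) ^ k \<le> exp (x * real k)"
  using power_mono[OF exp_ge_add_one_self[of x], of k] by (simp add: exp_of_nat_mult[symmetric] mult.commute)

text \<open>A lower Riemann sum: on each cell sqrt is smallest at the left end and the exponential
  at the right end, where it dominates the power of 1 + \<open>Lb\<close> H.\<close>

lemma CA_const_ge:
  assumes Lb: "0 < Lb" and H: "0 < H" and T: "T = real n * H"
  shows "sqrt T + Lb * H * (\<Sum>j<n. (1 + Lb * H) ^ (n - 1 - j) * sqrt (real j * H)) \<le> CA_const Lb T"
proof -
  define f where "f t = exp (Lb * (T - t)) * sqrt t" for t
  have int: "f integrable_on {u..v}" for u v
    unfolding f_def[abs_def] by (intro integrable_continuous_real continuous_intros)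
  have "H * (\<Sum>j<k. (1 + Lb * H) ^ (n - 1 - j) * sqrt (real j * H)) \<le> integral {0..real k * H} f" if "k \<le> n" for k
    using that
  proof (induction k)
    case (Suc k)
    have le: "0 \<le> real k * H" "real k * H \<le> real (Suc k) * H" using H by auto
    have "H * ((1 + Lb * H) ^ (n - 1 - k) * sqrt (real k * H)) = integral {real k * H..real (Suc k) * H} (\<lambda>_. (1 + Lb * H) ^ (n - 1 - k) * sqrt (real k * H))"
      using le H by (simp add: algebra_simps)
    also have "\<dots> \<le> integral {real k * H..real (Suc k) * H} f"
    proof (rule integral_le[OF _ int])
      fix t assume t: "t \<in> {real k * H..real (Suc k) * H}"
      have "(1 + Lb * H) ^ (n - 1 - k) \<le> exp (Lb * H * real (n - 1 - k))"
        using Lb H by (intro one_plus_power_le_exp) auto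
      also have "Lb * H * real (n - 1 - k) = Lb * (T - real (Suc k) * H)"
        using Suc.prems by (simp add: T of_nat_diff algebra_simps)
      also have "exp \<dots> \<le> exp (Lb * (T - t))" using Lb t by simp
      finally show "(1 + Lb * H) ^ (n - 1 - k) * sqrt (real k * H) \<le> f t"
        unfolding f_def using t H by (intro mult_mono) auto
    qed auto
    finally have 1: "H * ((1 + Lb * H) ^ (n - 1 - k) * sqrt (real k * H)) \<le> integral {real k * H..real (Suc k) * H} f" .
    have "integral {0..real k * H} f + integral {real k * H..real (Suc k) * H} f = integral {0..real (Suc k) * H} f"
      by (rule Henstock_Kurzweil_Integration.integral_combine[OF le int])
    then show ?case using 1 Suc by (simp add: distrib_left)
  qed simp
  from this[of n] have "H * (\<Sum>j<n. (1 + Lb * H) ^ (n - 1 - j) * sqrt (real j * H)) \<le> integral {0..T} f" by (simp add: T)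
  from mult_left_mono[OF this, of Lb] Lb show ?thesis by (simp add: CA_const_def f_def[abs_def] mult.assoc)
qed

lemma sum_sqrt_le: "(\<Sum>i<n. sqrt (real i)) \<le> 2 / 3 * (real n * sqrt (real n))"
proof (induction n)
  case (Suc n)
  define u v where "u = sqrt (real n)" and "v = sqrt (real (Suc n))"
  have uv: "0 \<le> u" "u \<le> v" "v * v = u * u + 1" by (simp_all add: u_def v_def)
  have "0 < v" by (simp add: v_def)
  \<comment> \<open>With v^2 - u^2 = 1 this says that u is at most 2/3 (v^3 - u^3), so that the sum
    telescopes.\<close>
  have "0 \<le> (v - u) * (v - u) * (v + u / 2)" using uv by (intro mult_nonneg_nonneg) auto
  also have "\<dots> = (v * v * v - u * u * u) - 3 / 2 * u * (v * v - u * u)" by (simp add: field_simps)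
  finally have "u \<le> 2 / 3 * (v * v * v) - 2 / 3 * (u * u * u)" using uv(3) by simp
  moreover have "real n = u * u" "real (Suc n) = v * v" by (simp_all add: u_def v_def)
  ultimately show ?case using Suc uv(1) \<open>0 < v\<close> by (simp add: u_def[symmetric] v_def[symmetric] del: of_nat_Suc)
qed simp

text \<open>Lower Riemann sums of exp(- \<open>Lb\<close> t) and of 1 - exp(- \<open>Lb\<close> t)
  over [0, T]; the right-hand sides are the integrals, and they give the two exponential expressions
  in the constant.\<close>

lemma exp_sums:
  assumes Lb: "0 < Lb" and h: "0 < h" and T: "T = real N * h"
  shows "h * (\<Sum>i<N. exp (- (Lb * h * real (Suc i)))) \<le> (1 - exp (- (Lb * T))) / Lb"
    and "h * (\<Sum>i<N. 1 - exp (- (Lb * h * real i))) \<le> (Lb * T - 1 + exp (- (Lb * T))) / Lb"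
proof -
  define x where "x = Lb * h"
  have x: "0 < x" using Lb h by (simp add: x_def)
  have tel: "(\<Sum>i<N. exp (- (x * real i)) - exp (- (x * real (Suc i)))) = 1 - exp (- (Lb * T))"
    using sum_lessThan_telescope'[of "\<lambda>i. exp (- (x * real i))" N] by (simp add: x_def T mult_ac)
  have "x * (\<Sum>i<N. exp (- (x * real (Suc i)))) \<le> (\<Sum>i<N. exp (- (x * real i)) - exp (- (x * real (Suc i))))"
    unfolding sum_distrib_left
  proof (rule sum_mono)
    fix i
    have "exp (- (x * real (Suc i))) * (1 + x) \<le> exp (- (x * real (Suc i))) * exp x"
      by (intro mult_left_mono exp_ge_add_one_self) auto
    also have "\<dots> = exp (- (x * real i))" by (simp add: mult_exp_exp algebra_simps)
    finally show "x * exp (- (x * real (Suc i))) \<le> exp (- (x * real i)) - exp (- (x * real (Suc i)))"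
      by (simp add: algebra_simps)
  qed
  then show "h * (\<Sum>i<N. exp (- (Lb * h * real (Suc i)))) \<le> (1 - exp (- (Lb * T))) / Lb"
    using Lb unfolding tel by (simp add: x_def field_simps)
  have "1 - exp (- (Lb * T)) \<le> x * (\<Sum>i<N. exp (- (x * real i)))"
    unfolding tel[symmetric] sum_distrib_left
  proof (rule sum_mono)
    fix i
    have "exp (- (x * real i)) * (1 + - x) \<le> exp (- (x * real i)) * exp (- x)"
      by (intro mult_left_mono exp_ge_add_one_self) auto
    also have "\<dots> = exp (- (x * real (Suc i)))" by (simp add: mult_exp_exp algebra_simps)
    finally show "exp (- (x * real i)) - exp (- (x * real (Suc i))) \<le> x * exp (- (x * real i))"
      by (simp add: algebra_simps)
  qed
  then have "Lb * (h * (\<Sum>i<N. 1 - exp (- (Lb * h * real i)))) \<le> Lb * T - 1 + exp (- (Lb * T))"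
    by (simp add: x_def T sum_subtractf algebra_simps)
  then show "h * (\<Sum>i<N. 1 - exp (- (Lb * h * real i))) \<le> (Lb * T - 1 + exp (- (Lb * T))) / Lb"
    using Lb by (simp add: field_simps)
qed

lemma sum_affine_combination:
  fixes E F S :: "nat \<Rightarrow> real"
  shows "(\<Sum>i<N. h * (A + a * E i + c * F i + p * (s * S i) + B)) =
    A * (real N * h) + a * (h * (\<Sum>i<N. E i)) + c * (h * (\<Sum>i<N. F i)) + p * (h * s * (\<Sum>i<N. S i)) + real N * h * B"
  by (induction N) (simp_all add: algebra_simps)

section \<open>Blocks of fine steps: summation by parts, weights and the Gronwall kernel\<close>

lemma sum_lessThan_add: "(\<Sum>j<p + q. f j) = (\<Sum>j<p. f j) + (\<Sum>i<q. f (p + i :: nat) :: 'a::comm_monoid_add)"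
  by (induction q) (simp_all add: add.assoc)

lemma sum_blocks:
  fixes f :: "nat \<Rightarrow> 'a::comm_monoid_add" and k m :: nat
  shows "(\<Sum>j<k * m. f j) = (\<Sum>q<k. \<Sum>i<m. f (q * m + i))"
proof (induction k)
  case (Suc k)
  have "Suc k * m = k * m + m" by simp
  then show ?case using Suc by (simp only: sum_lessThan_add sum.lessThan_Suc)
qed simp

text \<open>The increment from i to i + 1 affects exactly the m - 1 - i later points of the block,
  hence its weight; the last increment has weight 0.\<close>

lemma abel_block_sum:
  fixes z :: "nat \<Rightarrow> 'b::real_vector"
  shows "(\<Sum>i<m. z i - z 0) = (\<Sum>i<m. (real m - 1 - real i) *\<^sub>R (z (Suc i) - z i))"
proof (induction m)
  case (Suc m)
  have "(\<Sum>i<m. (real (Suc m) - 1 - real i) *\<^sub>R (z (Suc i) - z i))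
     = (\<Sum>i<m. (real m - 1 - real i) *\<^sub>R (z (Suc i) - z i) + (z (Suc i) - z i))"
    by (intro sum.cong) (auto simp: algebra_simps)
  also have "\<dots> = (\<Sum>i<m. z i - z 0) + (z m - z 0)"
    by (simp add: sum.distrib Suc.IH sum_lessThan_telescope)
  finally show ?case by simp
qed simp

text \<open>Reversing the order turns this into the sum of squares below m. Divided by m^3 it is
  \<open>ratio_A\<close> times \<open>ratio_B\<close>.\<close>

lemma sum_weights_sq: "(\<Sum>i<m. (real m - 1 - real i)\<^sup>2) = (real m - 1) * real m * (2 * real m - 1) / 6"
proof -
  have "(\<Sum>i<m. (real m - 1 - real i)\<^sup>2) = (\<Sum>i<m. (real i)\<^sup>2)"
    by (rule sum.reindex_bij_witness[where i="\<lambda>i. m - 1 - i" and j="\<lambda>i. m - 1 - i"])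
      (auto simp: of_nat_diff)
  also have "\<dots> = (real m - 1) * real m * (2 * real m - 1) / 6"
    by (induction m) (simp_all add: field_simps power2_eq_square)
  finally show ?thesis .
qed

text \<open>An instance of Chebyshev's sum inequality: decreasing weights against an increasing
  sequence do no better than their mean (m - 1) / 2.\<close>

lemma weighted_sum_le_average:
  fixes \<beta> :: "nat \<Rightarrow> real"
  assumes mono: "\<And>i j. i \<le> j \<Longrightarrow> \<beta> i \<le> \<beta> j"
  shows "(\<Sum>i<m. (real m - 1 - real i) * \<beta> i) \<le> (real m - 1) / 2 * (\<Sum>i<m. \<beta> i)"
proof (induction m)
  case (Suc m)
  have "(\<Sum>i<m. (real (Suc m) - 1 - real i) * \<beta> i) = (\<Sum>i<m. (real m - 1 - real i) * \<beta> i) + (\<Sum>i<m. \<beta> i)"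
    by (simp add: sum.distrib[symmetric] algebra_simps)
  moreover have "(\<Sum>i<m. \<beta> i) \<le> (\<Sum>i<m. \<beta> m)" by (intro sum_mono mono) auto
  ultimately show ?case using Suc.IH by (simp add: field_simps)
qed simp

text \<open>The discrete variation-of-constants formula: the solution of u (k + 1) = (1 + x) u k + g
  k with u 0 = 0.\<close>

definition geo_sum :: "real \<Rightarrow> (nat \<Rightarrow> real) \<Rightarrow> nat \<Rightarrow> real" where
  "geo_sum x g k = (\<Sum>j<k. (1 + x) ^ (k - 1 - j) * g j)"

lemma geo_sum_0[simp]: "geo_sum x g 0 = 0" by (simp add: geo_sum_def)

lemma geo_sum_Suc: "geo_sum x g (Suc k) = (1 + x) * geo_sum x g k + g k"
proof -
  have "(\<Sum>j<k. (1 + x) ^ (k - j) * g j) = (1 + x) * geo_sum x g k"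
    unfolding geo_sum_def sum_distrib_left
  proof (rule sum.cong[OF refl])
    fix j assume "j \<in> {..<k}"
    then have "k - j = Suc (k - 1 - j)" by auto
    then show "(1 + x) ^ (k - j) * g j = (1 + x) * ((1 + x) ^ (k - 1 - j) * g j)" by simp
  qed
  then show ?thesis by (simp add: geo_sum_def)
qed

text \<open>It makes g k + x \<open>geo_sum x g k\<close> an exact solution of the Gronwall equation
  with forcing g k; used for the fluctuation term, whose forcing is not itself a partial
  sum.\<close>

lemma sum_geo_sum: "(\<Sum>j<k. g j + x * geo_sum x g j) = geo_sum x g k"
  by (induction k) (simp_all add: geo_sum_Suc algebra_simps)

text \<open>The companion for forcing given by partial sums of g; used for the drift term, which
  accumulates block by block.\<close>

lemma geo_sum_partial_sums: "(\<Sum>q<k. g q) + x * (\<Sum>j<k. geo_sum x g j) = geo_sum x g k"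
  by (induction k) (simp_all add: geo_sum_Suc algebra_simps)

section \<open>The strong error between coupled chains\<close>

context euler_setting
begin

text \<open>The Gronwall discount exp(- \<open>Lb\<close> h (i + 1)) offsets the growth (1 +
  \<open>Lb\<close> h)^i contained in \<open>dev i\<close>: their product is at most 1, and with the
  power lowered by 1 it is at most 1 - exp(- \<open>Lb\<close> h i). The exponential growth thus
  leaves only the common factor exp(\<open>Lb\<close> T) later on.\<close>

lemma weighted_drift_bound_le:
  "exp (- (Lb * h * real (Suc i))) * drift_bound i \<le>
    h * (Lb * norm (b x0) + a * exp (- (Lb * h * real (Suc i))) + a * norm (b x0) / Lb * (1 - exp (- (Lb * h * real i)))
      + (Lb\<^sup>2 + a) * (sqrt (real CARD('d) * h) * sqrt (real i)) + 2 / 3 * a * sqrt (real CARD('d) * h))"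
proof -
  define x where "x = Lb * h"
  define E where "E = exp (- (x * real (Suc i)))"
  define p where "p = (1 + x) ^ i"
  define s where "s = sqrt (real CARD('d) * h) * sqrt (real i)"
  define r where "r = sqrt (real CARD('d) * h)"
  have x: "0 < x" using Lb h by (simp add: x_def)
  have s: "0 \<le> s" "0 \<le> r" using h by (auto simp: s_def r_def)
  have E: "0 < E" "E \<le> 1" using x by (auto simp: E_def)
  have E': "E \<le> exp (- (x * real i))" using x by (simp add: E_def)
  have "1 \<le> p" using x by (simp add: p_def one_le_power)
  have p: "p \<le> exp (x * real i)" unfolding p_def using x by (intro one_plus_power_le_exp) auto
  have Ep: "E * p \<le> 1"
  proof -
    have "E * p \<le> exp (- (x * real i)) * exp (x * real i)" using E E' p \<open>1 \<le> p\<close> by (intro mult_mono) auto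
    then show ?thesis by (simp add: mult_exp_exp)
  qed
  have Ep1: "E * (p - 1) \<le> 1 - exp (- (x * real i))"
  proof -
    have "E * (p - 1) \<le> exp (- (x * real i)) * (exp (x * real i) - 1)" using E E' p \<open>1 \<le> p\<close> by (intro mult_mono) auto
    then show ?thesis by (simp add: right_diff_distrib mult_exp_exp)
  qed
  have "E * drift_bound i = h * (Lb * norm (b x0) * (E * p) + a * E + a * norm (b x0) / Lb * (E * (p - 1))
      + (Lb\<^sup>2 + a) * s * (E * p) + 2 / 3 * a * r * E)"
    using Lb by (simp add: drift_bound_def dev_def p_def x_def s_def r_def field_simps power2_eq_square)
  also have "\<dots> \<le> h * (Lb * norm (b x0) * 1 + a * E + a * norm (b x0) / Lb * (1 - exp (- (x * real i)))
      + (Lb\<^sup>2 + a) * s * 1 + 2 / 3 * a * r * 1)"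
    using h Lb a s E Ep Ep1 by (intro mult_left_mono add_mono) auto
  finally show ?thesis by (simp add: E_def x_def s_def r_def)
qed

text \<open>The factor 2 is cancelled later by the mean weight h (m - 1) / 2. The power T^(3/2)
  comes from summing the square-root growth of the noise.\<close>

lemma weighted_drift_sum_le:
  assumes T: "T = real N * h" and N: "1 \<le> N"
  shows "(\<Sum>i<N. exp (Lb * (T - real (Suc i) * h)) * drift_bound i) \<le>
    2 * (exp (Lb * T) * (norm (b x0) / 2 * (a * ((Lb * T - 1 + exp (- (Lb * T))) / Lb\<^sup>2) + Lb * T) +
      a * ((1 - exp (- (Lb * T))) / Lb) + 2 / 3 * sqrt (real CARD('d)) * (Lb\<^sup>2 + a) * T powr (3 / 2)))" 
proof -
  define d where "d = sqrt (real CARD('d))"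
  define n0 where "n0 = norm (b x0)"
  have T0: "0 < T" and hT: "h \<le> T" using h N by (simp_all add: T)
  have d0: "0 \<le> d" and n0: "0 \<le> n0" by (simp_all add: d_def n0_def)
  have split: "exp (Lb * (T - real k * h)) = exp (Lb * T) * exp (- (Lb * h * real k))" for k
    unfolding mult_exp_exp by (rule arg_cong[where f=exp]) (simp add: algebra_simps)
  have factor: "(\<Sum>i<N. exp (Lb * (T - real (Suc i) * h)) * drift_bound i)
    = exp (Lb * T) * (\<Sum>i<N. exp (- (Lb * h * real (Suc i))) * drift_bound i)"
    unfolding sum_distrib_left split by (simp only: mult.assoc)
  have "(\<Sum>i<N. exp (- (Lb * h * real (Suc i))) * drift_bound i) \<le> (\<Sum>i<N. h * (Lb * n0 + a * exp (- (Lb * h * real (Suc i))) + a * n0 / Lb * (1 - exp (- (Lb * h * real i)))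
      + (Lb\<^sup>2 + a) * (d * sqrt h * sqrt (real i)) + 2 / 3 * a * (d * sqrt h)))"
    by (rule sum_mono, rule order_trans[OF weighted_drift_bound_le]) (simp only: d_def n0_def real_sqrt_mult order_refl)
  also have "\<dots> = Lb * n0 * T + a * (h * (\<Sum>i<N. exp (- (Lb * h * real (Suc i))))) + a * n0 / Lb * (h * (\<Sum>i<N. 1 - exp (- (Lb * h * real i))))
      + (Lb\<^sup>2 + a) * d * (h * sqrt h * (\<Sum>i<N. sqrt (real i))) + 2 / 3 * a * d * (T * sqrt h)"
  proof -
    note eq = sum_affine_combination[of h "Lb * n0" a "\<lambda>i. exp (- (Lb * h * real (Suc i)))" "a * n0 / Lb"
      "\<lambda>i. 1 - exp (- (Lb * h * real i))" "Lb\<^sup>2 + a" "d * sqrt h" "\<lambda>i. sqrt (real i)" "2 / 3 * a * (d * sqrt h)" N,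
      folded T]
    show ?thesis unfolding eq by algebra
  qed
  also have "\<dots> \<le> Lb * n0 * T + a * ((1 - exp (- (Lb * T))) / Lb) + a * n0 / Lb * ((Lb * T - 1 + exp (- (Lb * T))) / Lb)
      + (Lb\<^sup>2 + a) * d * (2 / 3 * (T * sqrt T)) + 2 / 3 * a * d * (T * sqrt T)"
  proof -
    have "h * sqrt h * (\<Sum>i<N. sqrt (real i)) \<le> h * sqrt h * (2 / 3 * (real N * sqrt (real N)))"
      using h by (intro mult_left_mono sum_sqrt_le) auto
    also have "\<dots> = 2 / 3 * (T * sqrt T)" by (simp add: T real_sqrt_mult mult_ac)
    finally have 1: "h * sqrt h * (\<Sum>i<N. sqrt (real i)) \<le> 2 / 3 * (T * sqrt T)" .
    have 2: "T * sqrt h \<le> T * sqrt T" using T0 hT by (intro mult_left_mono) auto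
    show ?thesis
      using exp_sums[OF Lb h T] 1 2 a Lb n0 d0 hT T0
      by (intro add_mono mult_left_mono order_refl) auto
  qed
  also have "\<dots> \<le> Lb * n0 * T + 2 * (a * ((1 - exp (- (Lb * T))) / Lb)) + n0 * (a * ((Lb * T - 1 + exp (- (Lb * T))) / Lb\<^sup>2))
      + 4 / 3 * ((Lb\<^sup>2 + a) * d * (T * sqrt T))"
  proof -
    \<comment> \<open>Slack is given up here to reach the shape of the constant: the term with 1 -
      exp is doubled, and in the contribution of the step size a is enlarged to \<open>Lb\<close>^2
      + a, which turns 2/3 + 2/3 into 4/3.\<close>
    have "0 \<le> a * ((1 - exp (- (Lb * T))) / Lb)" using a Lb T0 by (intro mult_nonneg_nonneg divide_nonneg_pos) auto
    moreover have "a * d * (T * sqrt T) \<le> (Lb\<^sup>2 + a) * d * (T * sqrt T)"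
      using T0 d0 by (intro mult_right_mono) auto
    moreover have "a * n0 / Lb * ((Lb * T - 1 + exp (- (Lb * T))) / Lb) = n0 * (a * ((Lb * T - 1 + exp (- (Lb * T))) / Lb\<^sup>2))"
      by (simp add: power2_eq_square)
    ultimately show ?thesis by linarith
  qed
  finally have main: "(\<Sum>i<N. exp (Lb * (T - real (Suc i) * h)) * drift_bound i) \<le> exp (Lb * T) *
     (Lb * n0 * T + 2 * (a * ((1 - exp (- (Lb * T))) / Lb)) + n0 * (a * ((Lb * T - 1 + exp (- (Lb * T))) / Lb\<^sup>2))
      + 4 / 3 * ((Lb\<^sup>2 + a) * d * (T * sqrt T)))"
    unfolding factor by (rule mult_left_mono) simp
  have p: "T powr (3 / 2) = T * sqrt T"
    using T0 powr_add[of T 1 "1 / 2"] by (simp add: powr_half_sqrt)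
  show ?thesis
    unfolding p d_def[symmetric] n0_def[symmetric]
    by (rule order_trans[OF main]) (simp add: algebra_simps)
qed

definition coarse :: "nat \<Rightarrow> nat \<Rightarrow> 'w \<Rightarrow> real ^ 'd" where
  "coarse m k \<omega> = euler_chain b (real m * h) x0 (\<lambda>q. \<Sum>i<m. D (q * m + i) \<omega>) k"

text \<open>Both chains contain the same noise sum, which cancels. The remaining drift difference is
  the quadrature error inside blocks, rewritten by summation by parts and centred by
  \<open>drift_mean\<close>, plus the propagated error at the block starts.\<close>

lemma coarse_error_decomposition:
  "Y (k * m) \<omega> - coarse m k \<omega> =
    (\<Sum>j<k * m. (h * (real m - 1 - real (j mod m))) *\<^sub>R (b (Y (Suc j) \<omega>) - drift_mean j (Y j \<omega>)))
    + (\<Sum>j<k * m. (h * (real m - 1 - real (j mod m))) *\<^sub>R (drift_mean j (Y j \<omega>) - b (Y j \<omega>)))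
    + (real m * h) *\<^sub>R (\<Sum>q<k. b (Y (q * m) \<omega>) - b (coarse m q \<omega>))"
proof -
  have "Y (k * m) \<omega> = x0 + h *\<^sub>R (\<Sum>j<k * m. b (Y j \<omega>)) + (\<Sum>j<k * m. D j \<omega>)"
    unfolding Y_def by (rule euler_chain_eq_sum)
  moreover have "coarse m k \<omega> = x0 + (real m * h) *\<^sub>R (\<Sum>q<k. b (coarse m q \<omega>)) + (\<Sum>j<k * m. D j \<omega>)"
    unfolding coarse_def by (subst euler_chain_eq_sum) (simp add: sum_blocks)
  ultimately have "Y (k * m) \<omega> - coarse m k \<omega> = h *\<^sub>R (\<Sum>j<k * m. b (Y j \<omega>)) - (real m * h) *\<^sub>R (\<Sum>q<k. b (coarse m q \<omega>))"
    by simp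
  also have "(\<Sum>j<k * m. b (Y j \<omega>)) = (\<Sum>q<k. (\<Sum>i<m. b (Y (q * m + i) \<omega>) - b (Y (q * m) \<omega>)) + real m *\<^sub>R b (Y (q * m) \<omega>))"
    unfolding sum_blocks by (intro sum.cong) (simp_all add: sum_subtractf sum_constant_scaleR del: sum_constant)
  also have "\<dots> = (\<Sum>q<k. \<Sum>i<m. (real m - 1 - real i) *\<^sub>R (b (Y (Suc (q * m + i)) \<omega>) - b (Y (q * m + i) \<omega>)))
      + real m *\<^sub>R (\<Sum>q<k. b (Y (q * m) \<omega>))"
    using abel_block_sum[where z="\<lambda>i. b (Y (q * m + i) \<omega>)" and m=m for q]
    by (simp add: sum.distrib scaleR_sum_right)
  also have "(\<Sum>q<k. \<Sum>i<m. (real m - 1 - real i) *\<^sub>R (b (Y (Suc (q * m + i)) \<omega>) - b (Y (q * m + i) \<omega>)))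
    = (\<Sum>j<k * m. (real m - 1 - real (j mod m)) *\<^sub>R (b (Y (Suc j) \<omega>) - b (Y j \<omega>)))"
    unfolding sum_blocks by (intro sum.cong) auto
  also have "h *\<^sub>R (\<dots> + real m *\<^sub>R (\<Sum>q<k. b (Y (q * m) \<omega>))) - (real m * h) *\<^sub>R (\<Sum>q<k. b (coarse m q \<omega>))
    = (\<Sum>j<k * m. (h * (real m - 1 - real (j mod m))) *\<^sub>R (b (Y (Suc j) \<omega>) - b (Y j \<omega>)))
      + (real m * h) *\<^sub>R (\<Sum>q<k. b (Y (q * m) \<omega>) - b (coarse m q \<omega>))"
    by (simp add: scaleR_sum_right sum_subtractf scaleR_right_distrib scaleR_right_diff_distrib mult.commute)
  also have "(\<Sum>j<k * m. (h * (real m - 1 - real (j mod m))) *\<^sub>R (b (Y (Suc j) \<omega>) - b (Y j \<omega>))) =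
    (\<Sum>j<k * m. (h * (real m - 1 - real (j mod m))) *\<^sub>R (b (Y (Suc j) \<omega>) - drift_mean j (Y j \<omega>)))
    + (\<Sum>j<k * m. (h * (real m - 1 - real (j mod m))) *\<^sub>R (drift_mean j (Y j \<omega>) - b (Y j \<omega>)))"
    by (simp add: sum.distrib[symmetric] scaleR_right_distrib[symmetric])
  finally show ?thesis .
qed

lemma sq_int_coarse:
  assumes "k * m \<le> N"
  shows "sq_int M (coarse m k)"
  using assms
proof (induction k)
  case 0
  show ?case using sq_int_const[of x0] by (simp add: coarse_def[abs_def])
next
  case (Suc k)
  have "sq_int M (\<lambda>\<omega>. coarse m k \<omega> + (real m * h) *\<^sub>R b (coarse m k \<omega>) + (\<Sum>i<m. D (k * m + i) \<omega>))"
    by (intro sq_int_add sq_int_scaleR sq_int_Lipschitz[OF _ lip] sq_int_sum sq_int_D Suc.IH)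
      (use Suc.prems in auto)
  then show ?case by (simp add: coarse_def[abs_def])
qed

text \<open>The three parts are treated differently: orthogonality for the fluctuations, the
  triangle inequality for the conditional means, Lipschitz continuity for the propagated
  error.\<close>

lemma coarse_error_recursion:
  assumes k: "k * m \<le> N" and m: "1 \<le> m"
  shows "L2 M (\<lambda>\<omega>. Y (k * m) \<omega> - coarse m k \<omega>) \<le>
    Lb * sqrt (real CARD('d) * h * (h\<^sup>2 * (real k * ((real m - 1) * real m * (2 * real m - 1) / 6))))
    + h * (real m - 1) / 2 * (\<Sum>q<k. \<Sum>i<m. drift_bound (q * m + i))
    + Lb * (real m * h) * (\<Sum>q<k. L2 M (\<lambda>\<omega>. Y (q * m) \<omega> - coarse m q \<omega>))"
proof -
  define c where "c j = h * (real m - 1 - real (j mod m))" for j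
  have c0: "0 \<le> c j" for j
  proof -
    have "j mod m < m" using m by simp
    then have "real (j mod m) + 1 \<le> real m" by linarith
    then show ?thesis using h by (simp add: c_def)
  qed
  define A where "A \<omega> = (\<Sum>j<k * m. c j *\<^sub>R (b (Y (Suc j) \<omega>) - drift_mean j (Y j \<omega>)))" for \<omega>
  define B where "B \<omega> = (\<Sum>j<k * m. c j *\<^sub>R (drift_mean j (Y j \<omega>) - b (Y j \<omega>)))" for \<omega>
  define e where "e q \<omega> = Y (q * m) \<omega> - coarse m q \<omega>" for q \<omega>
  have qm: "q * m \<le> N" if "q \<le> k" for q
    using that k by (meson le_trans mult_le_mono1)
  have sqe: "sq_int M (e q)" if "q \<le> k" for q
    unfolding e_def[abs_def] using qm[OF that] by (intro sq_int_diff sq_int_Y sq_int_coarse)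
  have sqA: "sq_int M A" unfolding A_def[abs_def] by (rule L2_fluctuation_sum(1)[OF k])
  have sqj: "sq_int M (\<lambda>\<omega>. c j *\<^sub>R (drift_mean j (Y j \<omega>) - b (Y j \<omega>)))" if "j < k * m" for j
    by (intro sq_int_scaleR L2_drift(1)) (use that k in auto)
  have sqB: "sq_int M B" unfolding B_def[abs_def] by (intro sq_int_sum sqj) auto
  have sqE: "sq_int M (\<lambda>\<omega>. \<Sum>q<k. norm (e q \<omega>))" by (intro sq_int_sum sq_int_norm sqe) auto
  note sqs = sq_int_norm[OF sqA] sq_int_norm[OF sqB] sq_int_cmult[OF sqE, of "Lb * (real m * h)"]
  have "L2 M (e k) \<le> L2 M (\<lambda>\<omega>. norm (A \<omega>) + norm (B \<omega>) + Lb * (real m * h) * (\<Sum>q<k. norm (e q \<omega>)))"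
  proof (rule sq_int_AE_bound(2))
    show "sq_int M (\<lambda>\<omega>. norm (A \<omega>) + norm (B \<omega>) + Lb * (real m * h) * (\<Sum>q<k. norm (e q \<omega>)))"
      by (intro sq_int_add sqs)
    show "e k \<in> borel_measurable M" using sq_int_measurable[OF sqe[of k]] by simp
    show "AE \<omega> in M. norm (e k \<omega>) \<le> norm (norm (A \<omega>) + norm (B \<omega>) + Lb * (real m * h) * (\<Sum>q<k. norm (e q \<omega>)))"
    proof (rule AE_I2)
      fix \<omega>
      have "norm ((real m * h) *\<^sub>R (\<Sum>q<k. b (Y (q * m) \<omega>) - b (coarse m q \<omega>))) \<le> (real m * h) * (\<Sum>q<k. Lb * norm (e q \<omega>))"
      proof -
        have "norm (\<Sum>q<k. b (Y (q * m) \<omega>) - b (coarse m q \<omega>)) \<le> (\<Sum>q<k. Lb * norm (e q \<omega>))"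
          unfolding e_def by (intro order_trans[OF norm_sum] sum_mono lipschitz_on_normD[OF lip]) auto
        then show ?thesis using h by (simp add: mult_left_mono)
      qed
      then have "norm (e k \<omega>) \<le> norm (A \<omega>) + norm (B \<omega>) + (real m * h) * (\<Sum>q<k. Lb * norm (e q \<omega>))"
        unfolding e_def[of k] coarse_error_decomposition[of k m \<omega>] A_def B_def c_def
        by (intro norm_triangle_le add_mono order_refl) 
      also have "\<dots> = norm (A \<omega>) + norm (B \<omega>) + Lb * (real m * h) * (\<Sum>q<k. norm (e q \<omega>))"
        by (simp add: sum_distrib_left mult_ac)
      finally show "norm (e k \<omega>) \<le> norm (norm (A \<omega>) + norm (B \<omega>) + Lb * (real m * h) * (\<Sum>q<k. norm (e q \<omega>)))" by simp
    qed
  qed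
  also have "\<dots> \<le> L2 M A + L2 M B + Lb * (real m * h) * L2 M (\<lambda>\<omega>. \<Sum>q<k. norm (e q \<omega>))"
  proof -
    have "L2 M (\<lambda>\<omega>. norm (A \<omega>) + norm (B \<omega>) + Lb * (real m * h) * (\<Sum>q<k. norm (e q \<omega>)))
      \<le> L2 M (\<lambda>\<omega>. norm (A \<omega>) + norm (B \<omega>)) + L2 M (\<lambda>\<omega>. Lb * (real m * h) * (\<Sum>q<k. norm (e q \<omega>)))"
      by (intro L2_add_le sq_int_add sqs)
    moreover have "L2 M (\<lambda>\<omega>. norm (A \<omega>) + norm (B \<omega>)) \<le> L2 M (\<lambda>\<omega>. norm (A \<omega>)) + L2 M (\<lambda>\<omega>. norm (B \<omega>))"
      by (intro L2_add_le sqs)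
    moreover have "\<bar>Lb * (real m * h)\<bar> = Lb * (real m * h)" using Lb h by simp
    ultimately show ?thesis unfolding L2_cmult L2_norm by simp
  qed
  finally have 1: "L2 M (e k) \<le> L2 M A + L2 M B + Lb * (real m * h) * L2 M (\<lambda>\<omega>. \<Sum>q<k. norm (e q \<omega>))" .
  have 2: "L2 M A \<le> Lb * sqrt (real CARD('d) * h * (\<Sum>j<k * m. (c j)\<^sup>2))"
    unfolding A_def[abs_def] by (rule L2_fluctuation_sum(2)[OF k])
  have 3: "(\<Sum>j<k * m. (c j)\<^sup>2) = h\<^sup>2 * (real k * ((real m - 1) * real m * (2 * real m - 1) / 6))"
    unfolding sum_blocks
    by (simp add: c_def power_mult_distrib sum_distrib_left[symmetric] sum_weights_sq)
  have 4: "L2 M B \<le> h * (real m - 1) / 2 * (\<Sum>q<k. \<Sum>i<m. drift_bound (q * m + i))"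
  proof -
    have "L2 M B \<le> (\<Sum>j<k * m. L2 M (\<lambda>\<omega>. c j *\<^sub>R (drift_mean j (Y j \<omega>) - b (Y j \<omega>))))"
      unfolding B_def[abs_def] by (intro L2_sum_le sqj) auto
    also have "\<dots> \<le> (\<Sum>j<k * m. c j * drift_bound j)"
      unfolding L2_scaleR using c0 k by (intro sum_mono mult_mono L2_drift(2)) auto
    also have "\<dots> = (\<Sum>q<k. h * (\<Sum>i<m. (real m - 1 - real i) * drift_bound (q * m + i)))"
      unfolding sum_blocks by (simp add: c_def sum_distrib_left mult.assoc)
    also have "\<dots> \<le> (\<Sum>q<k. h * ((real m - 1) / 2 * (\<Sum>i<m. drift_bound (q * m + i))))"
      using h by (intro sum_mono mult_left_mono weighted_sum_le_average drift_bound_mono) auto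
    also have "\<dots> = h * (real m - 1) / 2 * (\<Sum>q<k. \<Sum>i<m. drift_bound (q * m + i))"
      by (simp add: sum_distrib_left mult_ac)
    finally show ?thesis .
  qed
  have "L2 M (\<lambda>\<omega>. \<Sum>q<k. norm (e q \<omega>)) \<le> (\<Sum>q<k. L2 M (e q))"
    using L2_sum_le[of "{..<k}" M "\<lambda>q \<omega>. norm (e q \<omega>)"] sq_int_norm[OF sqe] by (simp add: L2_norm)
  then have 5: "Lb * (real m * h) * L2 M (\<lambda>\<omega>. \<Sum>q<k. norm (e q \<omega>)) \<le> Lb * (real m * h) * (\<Sum>q<k. L2 M (e q))"
    using Lb h by (intro mult_left_mono) auto
  show ?thesis
    using 1 2[unfolded 3] 4 5 unfolding e_def[abs_def] by linarith
qed

lemma coarse_error_le: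
  assumes N: "N = n * m" and n: "1 \<le> n" and m: "1 \<le> m" and T: "T = real N * h"
  shows "L2 M (\<lambda>\<omega>. Y N \<omega> - coarse m n \<omega>) \<le> sqrt_K1 b x0 Lb a T (enat m) * sqrt (ratio_B (enat m)) * (T / real n)"
proof -
  define H where "H = real m * h"
  have H: "0 < H" using h m by (simp add: H_def)
  have TH: "T = real n * H" by (simp add: T N H_def)
  define x where "x = Lb * H"
  have x: "0 < x" using Lb H by (simp add: x_def)
  define c1 where "c1 = H * Lb * (sqrt (real CARD('d) * ratio_A (enat m)) * sqrt (ratio_B (enat m)))"
  define c2 where "c2 = h * (real m - 1) / 2"
  define \<Gamma> where "\<Gamma> q = (\<Sum>i<m. drift_bound (q * m + i))" for q
  define s where "s q = sqrt (real q * H)" for q :: nat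
  \<comment> \<open>The supersolution for the Gronwall comparison, composed from the two
    \<open>geo_sum\<close> identities.\<close>
  define r where "r k = c1 * (s k + x * geo_sum x s k) + c2 * geo_sum x \<Gamma> k" for k
  have rA: "0 \<le> ratio_A (enat m)" and rB: "0 \<le> ratio_B (enat m)" using m by (auto simp: ratio_A_def ratio_B_def)
  have c1: "0 \<le> c1" using H Lb rA rB by (simp add: c1_def)
  have c2: "0 \<le> c2" using h m by (simp add: c2_def)
  have \<Gamma>0: "0 \<le> \<Gamma> q" for q unfolding \<Gamma>_def by (intro sum_nonneg drift_bound_nonneg)
  have fluct: "Lb * sqrt (real CARD('d) * h * (h\<^sup>2 * (real k * ((real m - 1) * real m * (2 * real m - 1) / 6)))) = c1 * s k" for k
  proof -
    have eq: "real CARD('d) * h * (h\<^sup>2 * (real k * ((real m - 1) * real m * (2 * real m - 1) / 6)))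
      = H\<^sup>2 * ((real CARD('d) * ratio_A (enat m)) * ratio_B (enat m)) * (real k * H)"
      using m by (simp add: H_def ratio_A_def ratio_B_def field_simps power2_eq_square)
    show ?thesis unfolding eq using H by (simp add: c1_def s_def real_sqrt_mult)
  qed
  have "L2 M (\<lambda>\<omega>. Y (n * m) \<omega> - coarse m n \<omega>) \<le> r n"
  proof (rule discrete_gronwall_compare[where N=n and x=x and r=r and g="\<lambda>k. c1 * s k + c2 * (\<Sum>q<k. \<Gamma> q)"])
    fix k assume "k \<le> n"
    then have "k * m \<le> N" by (simp add: N)
    from coarse_error_recursion[OF this m]
    show "L2 M (\<lambda>\<omega>. Y (k * m) \<omega> - coarse m k \<omega>) \<le> c1 * s k + c2 * (\<Sum>q<k. \<Gamma> q) + x * (\<Sum>q<k. L2 M (\<lambda>\<omega>. Y (q * m) \<omega> - coarse m q \<omega>))"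
      unfolding fluct by (simp add: c2_def \<Gamma>_def x_def H_def)
    have "x * (\<Sum>j<k. r j) = c1 * (x * (\<Sum>j<k. s j + x * geo_sum x s j)) + c2 * (x * (\<Sum>j<k. geo_sum x \<Gamma> j))"
      by (simp add: r_def sum.distrib sum_distrib_left algebra_simps)
    then have "c1 * s k + c2 * (\<Sum>q<k. \<Gamma> q) + x * (\<Sum>j<k. r j) = c1 * (s k + x * geo_sum x s k) + c2 * ((\<Sum>q<k. \<Gamma> q) + x * (\<Sum>j<k. geo_sum x \<Gamma> j))"
      unfolding sum_geo_sum by (simp add: algebra_simps)
    then show "c1 * s k + c2 * (\<Sum>q<k. \<Gamma> q) + x * (\<Sum>j<k. r j) \<le> r k"
      unfolding geo_sum_partial_sums by (simp add: r_def)
  qed (use x in auto)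
  also have "\<dots> \<le> c1 * CA_const Lb T + c2 * (\<Sum>i<N. exp (Lb * (T - real (Suc i) * h)) * drift_bound i)"
    unfolding r_def
  proof (intro add_mono mult_left_mono c1 c2)
    show "s n + x * geo_sum x s n \<le> CA_const Lb T"
      using CA_const_ge[OF Lb H TH] by (simp add: s_def geo_sum_def x_def TH)
    show "geo_sum x \<Gamma> n \<le> (\<Sum>i<N. exp (Lb * (T - real (Suc i) * h)) * drift_bound i)"
      unfolding geo_sum_def N sum_blocks \<Gamma>_def sum_distrib_left
    proof (intro sum_mono mult_right_mono drift_bound_nonneg)
      fix q i assume q: "q \<in> {..<n}" and i: "i \<in> {..<m}"
      have "(1 + x) ^ (n - 1 - q) \<le> exp (x * real (n - 1 - q))" using x by (intro one_plus_power_le_exp) auto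
      also have "x * real (n - 1 - q) = Lb * (T - real (Suc q * m) * h)"
        using q by (simp add: x_def TH H_def of_nat_diff algebra_simps)
      \<comment> \<open>The kernel belongs to the right end of block q. Each fine step of the block
        ends no later, so the exponential at its own end is at least as large.\<close>
      also have "real (Suc (q * m + i)) \<le> real (Suc q * m)" using i by (simp only: of_nat_le_iff) simp
      then have "exp (Lb * (T - real (Suc q * m) * h)) \<le> exp (Lb * (T - real (Suc (q * m + i)) * h))"
        using Lb h by (simp add: mult_left_mono mult_right_mono)
      finally show "(1 + x) ^ (n - 1 - q) \<le> exp (Lb * (T - real (Suc (q * m + i)) * h))" .
    qed
  qed
  also have "\<dots> \<le> c1 * CA_const Lb T + c2 *
    (2 * (exp (Lb * T) * (norm (b x0) / 2 * (a * ((Lb * T - 1 + exp (- (Lb * T))) / Lb\<^sup>2) + Lb * T) +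
      a * ((1 - exp (- (Lb * T))) / Lb) + 2 / 3 * sqrt (real CARD('d)) * (Lb\<^sup>2 + a) * T powr (3 / 2))))"
    using n m by (intro add_left_mono mult_left_mono c2 weighted_drift_sum_le T) (simp add: N)
  also have "\<dots> = sqrt_K1 b x0 Lb a T (enat m) * sqrt (ratio_B (enat m)) * H"
  proof -
    \<comment> \<open>The drift part carries \<open>ratio_B\<close> in full and the fluctuation part
      only its root; one root is factored out of both, the other stays inside
      \<open>sqrt_K1\<close>.\<close>
    have "c2 * 2 = H * (sqrt (ratio_B (enat m)) * sqrt (ratio_B (enat m)))"
      using rB m by (simp add: c2_def H_def ratio_B_def)
    then have "c1 * u + c2 * (2 * (v * z)) = (u * Lb * sqrt (real CARD('d) * ratio_A (enat m)) + v * sqrt (ratio_B (enat m)) * z) * sqrt (ratio_B (enat m)) * H" for u v z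
      unfolding c1_def by algebra
    then show ?thesis unfolding sqrt_K1_def .
  qed
  also have "H = T / real n" using n by (simp add: TH)
  finally show ?thesis by (simp add: N)
qed

end

section \<open>The Euler schemes and the solution\<close>

abbreviation grid_increment :: "(real \<Rightarrow> 'b::real_vector) \<Rightarrow> real \<Rightarrow> nat \<Rightarrow> 'b" where
  "grid_increment w h i \<equiv> w (real (Suc i) * h) - w (real i * h)"

section \<open>Pathwise identification of the schemes and their convergence\<close>

lemma euler_grid_eq:
  assumes T: "0 < T" and N: "1 \<le> N" and s: "real k * (T / real N) \<le> s" "s < real (Suc k) * (T / real N)"
  shows "euler_grid T N s = real k * (T / real N)"
proof -
  have "\<lfloor>real N * s / T\<rfloor> = int k"
  proof (rule floor_unique)
    show "of_int (int k) \<le> real N * s / T" using s(1) T N by (simp add: field_simps)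
    show "real N * s / T < of_int (int k) + 1" using s(2) T N by (simp add: field_simps)
  qed
  then show ?thesis by (simp add: euler_grid_def)
qed

lemma grid_point_mem:
  assumes "0 < T" "1 \<le> N" "k \<le> N"
  shows "real k * (T / real N) \<in> {0..T}"
proof -
  have "real k * T \<le> real N * T" using assms by (intro mult_right_mono) auto
  then show ?thesis using assms by (simp add: field_simps)
qed

lemma integral_equation_step:
  fixes y w \<beta> :: "real \<Rightarrow> real ^ 'd::finite"
  assumes y: "\<And>t. t \<in> {0..T} \<Longrightarrow> \<beta> integrable_on {0..t} \<and> y t = x0 + integral {0..t} \<beta> + w t"
    and st: "0 \<le> s" "s \<le> t" "t \<le> T"
  shows "y t = y s + integral {s..t} \<beta> + (w t - w s)"
proof -
  have "integral {0..s} \<beta> + integral {s..t} \<beta> = integral {0..t} \<beta>"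
    using y[of t] st by (intro Henstock_Kurzweil_Integration.integral_combine) auto
  then show ?thesis using y[of t] y[of s] st by (simp add: algebra_simps)
qed

lemma euler_path_eq_chain:
  fixes y w :: "real \<Rightarrow> real ^ 'd::finite"
  assumes T: "0 < T" and N: "1 \<le> N"
    and y: "\<And>t. t \<in> {0..T} \<Longrightarrow> (\<lambda>s. b (y (euler_grid T N s))) integrable_on {0..t} \<and>
        y t = x0 + integral {0..t} (\<lambda>s. b (y (euler_grid T N s))) + w t"
    and w: "w 0 = 0" and k: "k \<le> N"
  shows "y (real k * (T / real N)) = euler_chain b (T / real N) x0 (grid_increment w (T / real N)) k"
  using k
proof (induction k)
  case 0
  then show ?case using y[of 0] w T by simp
next
  case (Suc k)
  let ?h = "T / real N"
  have h: "0 < ?h" using T N by simp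
  have mem: "real (Suc k) * ?h \<le> T" using grid_point_mem[OF T N Suc.prems] by simp
  have le: "0 \<le> real k * ?h" "real k * ?h \<le> real (Suc k) * ?h"
    using h by (intro mult_nonneg_nonneg mult_right_mono; simp)+
  have "integral {real k * ?h..real (Suc k) * ?h} (\<lambda>s. b (y (euler_grid T N s)))
      = integral {real k * ?h..real (Suc k) * ?h} (\<lambda>s. b (y (real k * ?h)))"
  proof (rule integral_spike[of "{real (Suc k) * ?h}"])
    \<comment> \<open>At the right endpoint the floor has already moved to the next grid point, so
      this point is removed as a null set.\<close>
    fix s assume "s \<in> {real k * ?h..real (Suc k) * ?h} - {real (Suc k) * ?h}"
    then show "b (y (real k * ?h)) = b (y (euler_grid T N s))"
      using euler_grid_eq[OF T N, of k s] by simp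
  qed simp
  also have "\<dots> = (real (Suc k) * ?h - real k * ?h) *\<^sub>R b (y (real k * ?h))"
    using le(2) by (simp del: of_nat_Suc)
  also have "real (Suc k) * ?h - real k * ?h = ?h" by (simp only: of_nat_Suc ring_distribs)
  finally show ?case
    using integral_equation_step[OF y le mem] Suc by simp
qed

text \<open>A statement about a single path. The increments of w cancel between path and chain,
  leaving a Riemann-sum error of the drift governed by the modulus of continuity of x.\<close>

lemma euler_chain_tendsto:
  fixes x w :: "real \<Rightarrow> real ^ 'd::finite"
  assumes T: "0 < T" and lip: "K-lipschitz_on UNIV b"
    and cont: "continuous_on {0..T} x"
    and x: "\<And>t. t \<in> {0..T} \<Longrightarrow> (\<lambda>s. b (x s)) integrable_on {0..t} \<and>
        x t = x0 + integral {0..t} (\<lambda>s. b (x s)) + w t"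
    and w: "w 0 = 0"
  shows "(\<lambda>N. euler_chain b (T / real N) x0 (grid_increment w (T / real N)) N) \<longlonglongrightarrow> x T"
proof (rule LIMSEQ_I)
  fix e :: real assume e: "0 < e"
  have K: "0 \<le> K" using lip by (rule lipschitz_on_nonneg)
  \<comment> \<open>The exponential is the Gronwall factor of the whole horizon; the 2 makes the
    final inequality strict.\<close>
  define \<epsilon> where "\<epsilon> = e / (2 * exp (K * T))"
  have \<epsilon>: "0 < \<epsilon>" using e by (simp add: \<epsilon>_def)
  have "uniformly_continuous_on {0..T} x" by (rule compact_uniformly_continuous[OF cont]) simp
  then obtain \<delta> where \<delta>: "0 < \<delta>" "\<And>s t. s \<in> {0..T} \<Longrightarrow> t \<in> {0..T} \<Longrightarrow> dist s t < \<delta> \<Longrightarrow> dist (x s) (x t) < \<epsilon>"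
    unfolding uniformly_continuous_on_def using \<epsilon> by metis
  obtain N0 where N0: "T / \<delta> < real N0" using reals_Archimedean2 by blast
  show "\<exists>no. \<forall>n\<ge>no. norm (euler_chain b (T / real n) x0 (grid_increment w (T / real n)) n - x T) < e"
  proof (intro exI allI impI)
    fix N assume "max 1 N0 \<le> N"
    then have N: "1 \<le> N" "N0 \<le> N" by auto
    define h where "h = T / real N"
    have h: "0 < h" using T N by (simp add: h_def)
    have "T / \<delta> < real N" using N0 N(2) by linarith
    then have h\<delta>: "h < \<delta>" using \<delta> N by (simp add: h_def field_simps)
    let ?Y = "euler_chain b h x0 (grid_increment w h)"
    \<comment> \<open>A step multiplies the error by at most 1 + K h and adds at most K h
      \<open>\<epsilon>\<close>; the right-hand side solves this recursion exactly with initial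
      value 0.\<close>
    have "norm (x (real k * h) - ?Y k) \<le> \<epsilon> * ((1 + K * h) ^ k - 1)" if "k \<le> N" for k
      using that
    proof (induction k)
      case 0
      then show ?case using x[of 0] w T by simp
    next
      case (Suc k)
      let ?s = "real k * h" and ?t = "real (Suc k) * h"
      have mem: "?t \<le> T" using grid_point_mem[OF T N(1) Suc.prems] by (simp add: h_def)
      have le: "0 \<le> ?s" "?s \<le> ?t" using h by (auto simp: algebra_simps)
      have int: "(\<lambda>s. b (x s)) integrable_on {?s..?t}"
        by (rule integrable_on_subinterval[where S="{0..?t}"]) (use x[of ?t] mem le in auto)
      have "norm (integral {?s..?t} (\<lambda>s. b (x s) - b (x ?s))) \<le> (K * \<epsilon>) * (?t - ?s)"
      proof (rule integral_bound[OF le(2)])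
        show "continuous_on {?s..?t} (\<lambda>s. b (x s) - b (x ?s))"
          using mem le
          by (intro continuous_intros continuous_on_compose2[OF lipschitz_on_continuous_on[OF lip] continuous_on_subset[OF cont]]) auto
        fix u assume u: "u \<in> {?s..?t}"
        have "0 \<le> u" using u le(1) by auto
        moreover have "?t = ?s + h" by (simp add: algebra_simps)
        ultimately have "dist (x u) (x ?s) < \<epsilon>"
          using u le mem h\<delta> by (intro \<delta>(2)) (auto simp: dist_real_def)
        then have "K * dist (x u) (x ?s) \<le> K * \<epsilon>" using K by (intro mult_left_mono) auto
        then show "norm (b (x u) - b (x ?s)) \<le> K * \<epsilon>"
          using lipschitz_on_normD[OF lip, of "x u" "x ?s"] by (simp add: dist_norm)
      qed
      moreover have "integral {?s..?t} (\<lambda>s. b (x s) - b (x ?s)) = integral {?s..?t} (\<lambda>s. b (x s)) - h *\<^sub>R b (x ?s)"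
        using int le h by (subst Henstock_Kurzweil_Integration.integral_diff) (auto simp: algebra_simps)
      moreover have "(K * \<epsilon>) * (?t - ?s) = K * h * \<epsilon>" by (simp add: algebra_simps)
      ultimately have 1: "norm (integral {?s..?t} (\<lambda>s. b (x s)) - h *\<^sub>R b (x ?s)) \<le> K * h * \<epsilon>"
        by (simp only:)
      have 2: "norm (h *\<^sub>R (b (x ?s) - b (?Y k))) \<le> K * h * norm (x ?s - ?Y k)"
        using mult_left_mono[OF lipschitz_on_normD[OF lip, of "x ?s" "?Y k"], of h] h by (simp add: mult_ac)
      have 3: "x ?t - ?Y (Suc k) = (x ?s - ?Y k) + (integral {?s..?t} (\<lambda>s. b (x s)) - h *\<^sub>R b (x ?s)) + h *\<^sub>R (b (x ?s) - b (?Y k))"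
        using integral_equation_step[OF x le mem] by (simp add: algebra_simps)
      have "norm (x ?t - ?Y (Suc k)) \<le> norm (x ?s - ?Y k) + K * h * \<epsilon> + K * h * norm (x ?s - ?Y k)"
        unfolding 3 by (intro norm_triangle_le add_mono order_refl 1 2)
      also have "\<dots> = (1 + K * h) * norm (x ?s - ?Y k) + K * h * \<epsilon>" by (simp add: algebra_simps)
      also have "\<dots> \<le> (1 + K * h) * (\<epsilon> * ((1 + K * h) ^ k - 1)) + K * h * \<epsilon>"
        using Suc K h by (intro add_right_mono mult_left_mono) auto
      finally show ?case by (simp add: algebra_simps)
    qed
    from this[of N] have "norm (x T - ?Y N) \<le> \<epsilon> * ((1 + K * h) ^ N - 1)" using N by (simp add: h_def)
    also have "\<dots> \<le> \<epsilon> * exp (K * T)"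
    proof (rule mult_left_mono)
      have "(1 + K * h) ^ N \<le> exp (K * h * real N)" using K h by (intro one_plus_power_le_exp) auto
      then show "(1 + K * h) ^ N - 1 \<le> exp (K * T)" using N by (simp add: h_def)
    qed (use \<epsilon> in simp)
    also have "\<dots> < e" using e by (simp add: \<epsilon>_def)
    finally show "norm (euler_chain b (T / real N) x0 (grid_increment w (T / real N)) N - x T) < e"
      by (simp add: norm_minus_commute h_def)
  qed
qed

section \<open>Strong errors of the schemes driven by Brownian motion\<close>

lemma brownian_euler_setting:
  fixes W :: "real \<Rightarrow> 'w \<Rightarrow> real ^ 'd::finite"
  assumes W: "brownian_motion M W" and h: "0 < h" and R1: "R1 b x0 Lb a"
  shows "euler_setting M (\<lambda>i \<omega>. grid_increment (\<lambda>t. W t \<omega>) h i) N h b x0 Lb a"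
proof -
  interpret prob_space M using W by (simp add: brownian_motion_def)
  show ?thesis
  proof
    show "indep_vars (\<lambda>_. borel) (\<lambda>i \<omega>. grid_increment (\<lambda>t. W t \<omega>) h i) {..<N}"
    proof -
      have "\<forall>(n::nat) t. 0 \<le> t 0 \<and> (\<forall>i<n. t i \<le> t (Suc i)) \<longrightarrow>
        indep_vars (\<lambda>_. borel) (\<lambda>i \<omega>. W (t (Suc i)) \<omega> - W (t i) \<omega>) {..<n}"
        using W by (simp add: brownian_motion_def)
      from this[rule_format, of "\<lambda>i. real i * h" N] show ?thesis using h by (simp add: algebra_simps)
    qed
    fix i
    have le: "0 \<le> real i * h" "real i * h < real (Suc i) * h" using h by (auto simp: algebra_simps)
    have d: "real (Suc i) * h - real i * h = h" by (simp add: algebra_simps)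
    have "W (real (Suc i) * h) \<in> borel_measurable M" "W (real i * h) \<in> borel_measurable M"
      using W le h unfolding brownian_motion_def by (auto simp del: of_nat_Suc)
    then have m: "(\<lambda>\<omega>. grid_increment (\<lambda>t. W t \<omega>) h i) \<in> borel_measurable M" by measurable
    have "\<forall>s t. 0 \<le> s \<and> s < t \<longrightarrow>
        indep_vars (\<lambda>_. borel) (\<lambda>j \<omega>. (W t \<omega> - W s \<omega>) $ j) UNIV \<and>
        (\<forall>j. distributed M lborel (\<lambda>\<omega>. (W t \<omega> - W s \<omega>) $ j)
               (\<lambda>x. ennreal (normal_density 0 (sqrt (t - s)) x)))"
      using W by (simp add: brownian_motion_def)
    from this[rule_format, of "real i * h" "real (Suc i) * h"] le m h
    show "gaussian_vector M h (\<lambda>\<omega>. grid_increment (\<lambda>t. W t \<omega>) h i)"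
      unfolding gaussian_vector_def d by auto
  qed (use R1 h in auto)
qed

locale additive_sde = prob_space M for M :: "'w measure" +
  fixes W X :: "real \<Rightarrow> 'w \<Rightarrow> real ^ 'd::finite" and Xe :: "nat \<Rightarrow> real \<Rightarrow> 'w \<Rightarrow> real ^ 'd"
    and b :: "real ^ 'd \<Rightarrow> real ^ 'd" and x0 :: "real ^ 'd" and T Lb a :: real
  assumes T: "0 < T" and W: "brownian_motion M W" and X: "sde_solution M W b x0 T X"
    and Xe: "\<And>n. n \<ge> 1 \<Longrightarrow> euler_scheme M W b x0 T n (Xe n)"
    and R1: "R1 b x0 Lb a"
begin

abbreviation dW :: "nat \<Rightarrow> nat \<Rightarrow> 'w \<Rightarrow> real ^ 'd" where
  "dW n i \<omega> \<equiv> grid_increment (\<lambda>t. W t \<omega>) (T / real n) i"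

lemma Xe_measurable: "1 \<le> n \<Longrightarrow> Xe n T \<in> borel_measurable M"
  using Xe[of n] T by (simp add: euler_scheme_def additive_noise_process_def)

lemma X_measurable: "X T \<in> borel_measurable M"
  using X T by (simp add: sde_solution_def additive_noise_process_def)

lemma W0: "AE \<omega> in M. W 0 \<omega> = 0"
  using W by (simp add: brownian_motion_def)

lemma Xe_eq_chain:
  assumes n: "1 \<le> n"
  shows "AE \<omega> in M. Xe n T \<omega> = euler_chain b (T / real n) x0 (\<lambda>i. dW n i \<omega>) n"
proof -
  have "AE \<omega> in M. \<forall>t\<in>{0..T}. (\<lambda>s. b (Xe n (euler_grid T n s) \<omega>)) integrable_on {0..t} \<and>
      Xe n t \<omega> = x0 + integral {0..t} (\<lambda>s. b (Xe n (euler_grid T n s) \<omega>)) + W t \<omega>"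
    using Xe[OF n] by (simp add: euler_scheme_def additive_noise_process_def)
  with W0 show ?thesis
  proof eventually_elim
    case (elim \<omega>)
    have "Xe n (real n * (T / real n)) \<omega> = euler_chain b (T / real n) x0 (\<lambda>i. dW n i \<omega>) n"
      by (rule euler_path_eq_chain[where y="\<lambda>t. Xe n t \<omega>" and w="\<lambda>t. W t \<omega>", OF T n _ elim(1) order_refl]) (use elim(2) in auto)
    then show ?case using n by simp
  qed
qed

lemma Xe_tendsto: "AE \<omega> in M. (\<lambda>n. Xe n T \<omega>) \<longlonglongrightarrow> X T \<omega>"
proof -
  have "AE \<omega> in M. \<forall>n. 1 \<le> n \<longrightarrow> Xe n T \<omega> = euler_chain b (T / real n) x0 (\<lambda>i. dW n i \<omega>) n"
    using Xe_eq_chain by (auto simp: AE_all_countable)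
  moreover have "AE \<omega> in M. continuous_on {0..T} (\<lambda>t. X t \<omega>)"
    "AE \<omega> in M. \<forall>t\<in>{0..T}. (\<lambda>s. b (X s \<omega>)) integrable_on {0..t} \<and>
      X t \<omega> = x0 + integral {0..t} (\<lambda>s. b (X s \<omega>)) + W t \<omega>"
    using X by (simp_all add: sde_solution_def additive_noise_process_def)
  ultimately show ?thesis using W0
  proof eventually_elim
    case (elim \<omega>)
    have "(\<lambda>n. euler_chain b (T / real n) x0 (\<lambda>i. dW n i \<omega>) n) \<longlonglongrightarrow> X T \<omega>"
      by (rule euler_chain_tendsto[where x="\<lambda>t. X t \<omega>" and w="\<lambda>t. W t \<omega>", OF T R1_lipschitz[OF R1] elim(2) _ elim(4)]) (use elim(3) in auto)
    then show ?case
      by (rule Lim_transform_eventually)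
        (use elim(1) in \<open>auto simp: eventually_sequentially intro!: exI[of _ 1]\<close>)
  qed
qed

lemma sq_int_Xe:
  assumes n: "1 \<le> n"
  shows "sq_int M (Xe n T)"
proof -
  have h: "0 < T / real n" using T n by simp
  interpret E: euler_setting M "dW n" n "T / real n" b x0 Lb a
    by (rule brownian_euler_setting[OF W h R1])
  have "AE \<omega> in M. Xe n T \<omega> = E.Y n \<omega>" unfolding E.Y_def by (rule Xe_eq_chain[OF n])
  then have "AE \<omega> in M. norm (Xe n T \<omega>) \<le> norm (E.Y n \<omega>)" by eventually_elim simp
  then show ?thesis
    by (rule sq_int_AE_bound(1)[OF E.sq_int_Y[OF order_refl] Xe_measurable[OF n]])
qed

lemma Xe_diff_L2:
  assumes n: "1 \<le> n" and m: "1 \<le> m"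
  shows "L2 M (\<lambda>\<omega>. Xe (n * m) T \<omega> - Xe n T \<omega>) \<le> sqrt_K1 b x0 Lb a T (enat m) * sqrt (ratio_B (enat m)) * (T / real n)"
proof -
  define h where "h = T / real (n * m)"
  have nm: "1 \<le> n * m" using n m by simp
  have h: "0 < h" using T nm by (simp add: h_def)
  interpret E: euler_setting M "dW (n * m)" "n * m" h b x0 Lb a
    unfolding h_def[symmetric] by (rule brownian_euler_setting[OF W h R1])
  have mh: "real m * h = T / real n" using m by (simp add: h_def)
  \<comment> \<open>Coarse Brownian increments telescope into block sums of fine ones, which is
    precisely the coupling built into \<open>coarse\<close>.\<close>
  have inc: "dW n q \<omega> = (\<Sum>i<m. dW (n * m) (q * m + i) \<omega>)" for q \<omega>
  proof -
    have "(\<Sum>i<m. dW (n * m) (q * m + i) \<omega>) = W (real (q * m + m) * h) \<omega> - W (real (q * m) * h) \<omega>"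
      using sum_lessThan_telescope[of "\<lambda>i. W (real (q * m + i) * h) \<omega>" m] by (simp add: h_def)
    also have "real (q * m + m) * h = real (Suc q) * (T / real n)" by (simp add: mh[symmetric] algebra_simps)
    also have "real (q * m) * h = real q * (T / real n)" by (simp add: mh[symmetric])
    finally show ?thesis by simp
  qed
  have "E.Y (n * m) \<omega> = euler_chain b (T / real (n * m)) x0 (\<lambda>i. dW (n * m) i \<omega>) (n * m)" for \<omega>
    unfolding E.Y_def unfolding h_def ..
  moreover have "E.coarse m n \<omega> = euler_chain b (T / real n) x0 (\<lambda>i. dW n i \<omega>) n" for \<omega>
    unfolding E.coarse_def mh inc ..
  ultimately have "AE \<omega> in M. norm (Xe (n * m) T \<omega> - Xe n T \<omega>) \<le> norm (E.Y (n * m) \<omega> - E.coarse m n \<omega>)"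
    using Xe_eq_chain[OF n] Xe_eq_chain[OF nm] by (auto elim: eventually_elim2)
  then have "L2 M (\<lambda>\<omega>. Xe (n * m) T \<omega> - Xe n T \<omega>) \<le> L2 M (\<lambda>\<omega>. E.Y (n * m) \<omega> - E.coarse m n \<omega>)"
    using Xe_measurable[OF n] Xe_measurable[OF nm]
    by (intro sq_int_AE_bound(2) sq_int_diff E.sq_int_Y E.sq_int_coarse) auto
  also have "\<dots> \<le> sqrt_K1 b x0 Lb a T (enat m) * sqrt (ratio_B (enat m)) * (T / real n)"
    using nm by (intro E.coarse_error_le[OF refl n m]) (simp add: h_def)
  finally show ?thesis .
qed

lemma Xe_diff_sq:
  assumes n: "1 \<le> n" and m: "1 \<le> m"
  shows "expectation (\<lambda>\<omega>. (norm (Xe (n * m) T \<omega> - Xe n T \<omega>))\<^sup>2) \<le> K1 b x0 Lb a T (enat m) * ratio_B (enat m) * (T / real n)\<^sup>2"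
proof -
  have "(L2 M (\<lambda>\<omega>. Xe (n * m) T \<omega> - Xe n T \<omega>))\<^sup>2 \<le> (sqrt_K1 b x0 Lb a T (enat m) * sqrt (ratio_B (enat m)) * (T / real n))\<^sup>2"
    using Xe_diff_L2[OF n m] by (rule power_mono) simp
  moreover have "0 \<le> ratio_B (enat m)" using m by (simp add: ratio_B_def)
  ultimately show ?thesis by (simp add: L2_sq K1_def power_mult_distrib power_divide)
qed

text \<open>The scheme with n steps is compared with its refinements instead of with X directly;
  their bounds converge to the constant at infinity because \<open>ratio_B\<close> tends to 1.
  Fatou's lemma yields the square integrability together with the estimate.\<close>

lemma X_Xe_diff:
  assumes n: "1 \<le> n"
  shows "sq_int M (\<lambda>\<omega>. X T \<omega> - Xe n T \<omega>)"
    and "expectation (\<lambda>\<omega>. (norm (X T \<omega> - Xe n T \<omega>))\<^sup>2) \<le> K1 b x0 Lb a T \<infinity> * (T / real n)\<^sup>2"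
proof -
  define B where "B m = K1 b x0 Lb a T (enat m) * ratio_B (enat m) * (T / real n)\<^sup>2" for m
  define Binf where "Binf = K1 b x0 Lb a T \<infinity> * (T / real n)\<^sup>2"
  \<comment> \<open>\<open>Suc m\<close> keeps the refinement factor positive, and n *
    \<open>Suc m\<close> indexes a subsequence of the almost surely convergent schemes.\<close>
  define u where "u m \<omega> = ennreal ((norm (Xe (n * Suc m) T \<omega> - Xe n T \<omega>))\<^sup>2)" for m \<omega>
  have nm: "1 \<le> n * Suc m" for m using n by simp
  note [measurable] = Xe_measurable[OF n] Xe_measurable[OF nm] X_measurable
  have [measurable]: "u m \<in> borel_measurable M" for m unfolding u_def[abs_def] by measurable
  have "B \<longlonglongrightarrow> K1 b x0 Lb a T \<infinity> * ratio_B \<infinity> * (T / real n)\<^sup>2"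
    unfolding B_def[abs_def] by (intro tendsto_intros K1_tendsto ratio_B_tendsto)
  then have B: "(\<lambda>m. B (Suc m)) \<longlonglongrightarrow> Binf"
    by (intro LIMSEQ_Suc) (simp add: Binf_def ratio_B_def)
  have lim: "AE \<omega> in M. ennreal ((norm (X T \<omega> - Xe n T \<omega>))\<^sup>2) = liminf (\<lambda>m. u m \<omega>)"
    using Xe_tendsto
  proof eventually_elim
    case (elim \<omega>)
    have "filterlim (\<lambda>m. n * Suc m) at_top sequentially"
      by (rule filterlim_subseq) (use n in \<open>auto simp: strict_mono_def\<close>)
    from filterlim_compose[OF elim this]
    have "(\<lambda>m. u m \<omega>) \<longlonglongrightarrow> ennreal ((norm (X T \<omega> - Xe n T \<omega>))\<^sup>2)"
      unfolding u_def by (intro tendsto_intros tendsto_ennrealI) 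
    from lim_imp_Liminf[OF _ this] show ?case by simp
  qed
  have "(\<integral>\<^sup>+\<omega>. ennreal ((norm (X T \<omega> - Xe n T \<omega>))\<^sup>2) \<partial>M) = (\<integral>\<^sup>+\<omega>. liminf (\<lambda>m. u m \<omega>) \<partial>M)"
    by (rule nn_integral_cong_AE[OF lim])
  also have "\<dots> \<le> liminf (\<lambda>m. \<integral>\<^sup>+\<omega>. u m \<omega> \<partial>M)"
    by (rule nn_integral_liminf) simp
  also have "\<dots> \<le> liminf (\<lambda>m. ennreal (B (Suc m)))"
  proof (intro Liminf_mono always_eventually allI)
    fix m
    have "(\<integral>\<^sup>+\<omega>. u m \<omega> \<partial>M) = ennreal (expectation (\<lambda>\<omega>. (norm (Xe (n * Suc m) T \<omega> - Xe n T \<omega>))\<^sup>2))"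
      unfolding u_def
      by (intro nn_integral_eq_integral sq_int_integrable sq_int_diff sq_int_Xe n nm) auto
    also have "\<dots> \<le> ennreal (B (Suc m))"
      unfolding B_def by (intro ennreal_leI Xe_diff_sq n) simp
    finally show "(\<integral>\<^sup>+\<omega>. u m \<omega> \<partial>M) \<le> ennreal (B (Suc m))" .
  qed
  also have "\<dots> = ennreal Binf"
    using lim_imp_Liminf[OF _ tendsto_ennrealI[OF B]] by simp
  finally have le: "(\<integral>\<^sup>+\<omega>. ennreal ((norm (X T \<omega> - Xe n T \<omega>))\<^sup>2) \<partial>M) \<le> ennreal Binf" .
  have int: "integrable M (\<lambda>\<omega>. (norm (X T \<omega> - Xe n T \<omega>))\<^sup>2)"
    by (rule integrableI_bounded) (use le in \<open>auto intro: le_less_trans\<close>)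
  then show "sq_int M (\<lambda>\<omega>. X T \<omega> - Xe n T \<omega>)" unfolding sq_int_def by simp
  have "0 \<le> Binf" by (simp add: Binf_def K1_def)
  moreover have "ennreal (expectation (\<lambda>\<omega>. (norm (X T \<omega> - Xe n T \<omega>))\<^sup>2)) \<le> ennreal Binf"
    using le by (subst (asm) nn_integral_eq_integral[OF int]) auto
  ultimately show "expectation (\<lambda>\<omega>. (norm (X T \<omega> - Xe n T \<omega>))\<^sup>2) \<le> K1 b x0 Lb a T \<infinity> * (T / real n)\<^sup>2"
    by (simp add: Binf_def)
qed

text \<open>With one step the drift is the constant b x0, so the terminal value is a fixed point
  plus a Gaussian vector of coordinate variance T.\<close>

lemma Xe_1_variance:
  assumes f: "bounded_gradient f f1 K"
  shows "expectation (\<lambda>\<omega>. (f (Xe 1 T \<omega>))\<^sup>2) - (expectation (\<lambda>\<omega>. f (Xe 1 T \<omega>)))\<^sup>2 \<le> T * K\<^sup>2"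
proof -
  interpret E: euler_setting M "dW 1" 1 T b x0 Lb a
    using brownian_euler_setting[OF W T R1, of 1] by simp
  note [measurable] = Xe_measurable[OF order_refl] E.D_measurable[of 0, simplified] bounded_gradient_measurable[OF f]
  have V: "gaussian_vector M T (dW 1 0)" using E.gauss[of 0] by simp
  then have [measurable]: "dW 1 0 \<in> borel_measurable M" by (simp add: gaussian_vector_def)
  have "AE \<omega> in M. Xe 1 T \<omega> = (x0 + T *\<^sub>R b x0) + dW 1 0 \<omega>" using Xe_eq_chain[of 1] by simp
  then have "AE \<omega> in M. f (Xe 1 T \<omega>) = f ((x0 + T *\<^sub>R b x0) + dW 1 0 \<omega>)"
    and "AE \<omega> in M. (f (Xe 1 T \<omega>))\<^sup>2 = (f ((x0 + T *\<^sub>R b x0) + dW 1 0 \<omega>))\<^sup>2" by auto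
  then have "expectation (\<lambda>\<omega>. f (Xe 1 T \<omega>)) = expectation (\<lambda>\<omega>. f ((x0 + T *\<^sub>R b x0) + dW 1 0 \<omega>))"
    and "expectation (\<lambda>\<omega>. (f (Xe 1 T \<omega>))\<^sup>2) = expectation (\<lambda>\<omega>. (f ((x0 + T *\<^sub>R b x0) + dW 1 0 \<omega>))\<^sup>2)"
    by (intro integral_cong_AE; measurable)+
  then show ?thesis using gaussian_poincare[OF V f, of "x0 + T *\<^sub>R b x0"] by simp
qed

end

section \<open>The multilevel estimator\<close>

lemma (in prob_space) variance_indep_sum:
  fixes U :: "'i \<Rightarrow> 'a \<Rightarrow> real"
  assumes I: "finite I" and ind: "indep_vars (\<lambda>_. borel) U I" and sq: "\<And>i. i \<in> I \<Longrightarrow> sq_int M (U i)"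
  shows "expectation (\<lambda>\<omega>. (\<Sum>i\<in>I. U i \<omega>)\<^sup>2) - (expectation (\<lambda>\<omega>. \<Sum>i\<in>I. U i \<omega>))\<^sup>2
    = (\<Sum>i\<in>I. expectation (\<lambda>\<omega>. (U i \<omega>)\<^sup>2) - (expectation (U i))\<^sup>2)"
  using I ind sq
proof (induction I rule: finite_induct)
  case (insert i I)
  define S where "S \<omega> = (\<Sum>i\<in>I. U i \<omega>)" for \<omega>
  have sqS: "sq_int M S" unfolding S_def[abs_def] using insert.prems by (intro sq_int_sum) auto
  have sqi: "sq_int M (U i)" using insert.prems by simp
  have "indep_var borel (U i) borel S"
    unfolding S_def[abs_def] by (rule indep_vars_sum[OF insert.hyps insert.prems(1)])
  from indep_var_lebesgue_integral[OF this]
  have prod: "expectation (\<lambda>\<omega>. U i \<omega> * S \<omega>) = expectation (U i) * expectation S"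
    using sq_int_imp_integrable[OF sqS] sq_int_imp_integrable[OF sqi] by simp
  have ints: "integrable M (\<lambda>\<omega>. (U i \<omega>)\<^sup>2)" "integrable M (\<lambda>\<omega>. (S \<omega>)\<^sup>2)" "integrable M (\<lambda>\<omega>. U i \<omega> * S \<omega>)"
    "integrable M (U i)" "integrable M S"
    using sq_int_integrable[OF sqi] sq_int_integrable[OF sqS] sq_int_inner_integrable[OF sqi sqS]
      sq_int_imp_integrable[OF sqS] sq_int_imp_integrable[OF sqi] by simp_all
  have "expectation (\<lambda>\<omega>. (U i \<omega> + S \<omega>)\<^sup>2) = expectation (\<lambda>\<omega>. (U i \<omega>)\<^sup>2 + (S \<omega>)\<^sup>2 + 2 * (U i \<omega> * S \<omega>))"
    by (simp add: power2_sum mult.assoc)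
  also have "\<dots> = expectation (\<lambda>\<omega>. (U i \<omega>)\<^sup>2) + expectation (\<lambda>\<omega>. (S \<omega>)\<^sup>2) + 2 * (expectation (U i) * expectation S)"
    using ints by (simp add: prod)
  finally have 1: "expectation (\<lambda>\<omega>. (U i \<omega> + S \<omega>)\<^sup>2) = \<dots>" .
  have 2: "expectation (\<lambda>\<omega>. U i \<omega> + S \<omega>) = expectation (U i) + expectation S" using ints by simp
  have 3: "expectation (\<lambda>\<omega>. (S \<omega>)\<^sup>2) - (expectation S)\<^sup>2 = (\<Sum>i\<in>I. expectation (\<lambda>\<omega>. (U i \<omega>)\<^sup>2) - (expectation (U i))\<^sup>2)"
    unfolding S_def[abs_def] using insert.prems by (intro insert.IH indep_vars_subset[OF insert.prems(1)]) auto
  have "expectation (\<lambda>\<omega>. (U i \<omega> + S \<omega>)\<^sup>2) - (expectation (\<lambda>\<omega>. U i \<omega> + S \<omega>))\<^sup>2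
      = (expectation (\<lambda>\<omega>. (U i \<omega>)\<^sup>2) - (expectation (U i))\<^sup>2) + (expectation (\<lambda>\<omega>. (S \<omega>)\<^sup>2) - (expectation S)\<^sup>2)"
    unfolding 1 2 by (simp add: power2_sum)
  then show ?case using insert.hyps unfolding 3 by (simp add: S_def)
qed simp

lemma (in prob_space) mean_square_error:
  fixes Q :: "'a \<Rightarrow> real"
  assumes Q: "sq_int M Q"
  shows "expectation (\<lambda>\<omega>. (Q \<omega> - c)\<^sup>2) = expectation (\<lambda>\<omega>. (Q \<omega>)\<^sup>2) - (expectation Q)\<^sup>2 + (expectation Q - c)\<^sup>2"
proof -
  have "expectation (\<lambda>\<omega>. (Q \<omega> - c)\<^sup>2) = expectation (\<lambda>\<omega>. (Q \<omega>)\<^sup>2 - 2 * c * Q \<omega> + c\<^sup>2)"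
    by (simp add: power2_diff algebra_simps)
  also have "\<dots> = expectation (\<lambda>\<omega>. (Q \<omega>)\<^sup>2) - 2 * c * expectation Q + c\<^sup>2"
    using sq_int_integrable[OF Q] sq_int_imp_integrable[OF Q] by (simp add: prob_space)
  finally show ?thesis by (simp add: power2_diff)
qed

text \<open>The integrability assumption concerns the difference U - V, which is the form in which
  Fatou's lemma delivers it for the solution and a scheme.\<close>

lemma (in prob_space) Lipschitz_diff_sq:
  fixes f :: "'b::euclidean_space \<Rightarrow> real"
  assumes f: "K-lipschitz_on UNIV f" and UV: "sq_int M (\<lambda>\<omega>. U \<omega> - V \<omega>)"
    and m: "U \<in> borel_measurable M" "V \<in> borel_measurable M"
  shows "sq_int M (\<lambda>\<omega>. f (U \<omega>) - f (V \<omega>))"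
    and "expectation (\<lambda>\<omega>. (f (U \<omega>) - f (V \<omega>))\<^sup>2) \<le> K\<^sup>2 * expectation (\<lambda>\<omega>. (norm (U \<omega> - V \<omega>))\<^sup>2)"
proof -
  note [measurable] = m
  have [measurable]: "f \<in> borel_measurable borel"
    using f lipschitz_on_continuous_on borel_measurable_continuous_onI by blast
  have K: "0 \<le> K" using f by (rule lipschitz_on_nonneg)
  have le: "\<bar>f x - f y\<bar> \<le> K * norm (x - y)" for x y
    using lipschitz_on_normD[OF f, of x y] by simp
  show sq: "sq_int M (\<lambda>\<omega>. f (U \<omega>) - f (V \<omega>))"
    by (rule sq_int_AE_bound(1)[OF sq_int_cmult[OF sq_int_norm[OF UV], of K]])
      (use le K in \<open>auto simp: abs_mult\<close>)
  have "expectation (\<lambda>\<omega>. (f (U \<omega>) - f (V \<omega>))\<^sup>2) \<le> expectation (\<lambda>\<omega>. K\<^sup>2 * (norm (U \<omega> - V \<omega>))\<^sup>2)"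
  proof (rule integral_mono)
    show "(f (U \<omega>) - f (V \<omega>))\<^sup>2 \<le> K\<^sup>2 * (norm (U \<omega> - V \<omega>))\<^sup>2" for \<omega>
      using power_mono[OF le[of "U \<omega>" "V \<omega>"], of 2] by (simp add: power_mult_distrib)
  qed (use sq_int_integrable[OF sq] sq_int_integrable[OF UV] in auto)
  then show "expectation (\<lambda>\<omega>. (f (U \<omega>) - f (V \<omega>))\<^sup>2) \<le> K\<^sup>2 * expectation (\<lambda>\<omega>. (norm (U \<omega> - V \<omega>))\<^sup>2)"
    by simp
qed

context additive_sde
begin

lemma level_second_moment:
  assumes f: "K-lipschitz_on UNIV f" and m: "1 \<le> m" and l: "1 \<le> l"
  shows "expectation (\<lambda>\<omega>. (f (Xe (m ^ l) T \<omega>) - f (Xe (m ^ (l - 1)) T \<omega>))\<^sup>2)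
    \<le> K\<^sup>2 * (K1 b x0 Lb a T (enat m) * (real m - 1) * T\<^sup>2 / real m ^ (2 * l - 1))"
proof -
  define n where "n = m ^ (l - 1)"
  have n: "1 \<le> n" and nm: "1 \<le> n * m" using m by (simp_all add: n_def)
  have ml: "m ^ l = n * m" using l by (cases l) (simp_all add: n_def)
  have "expectation (\<lambda>\<omega>. (f (Xe (n * m) T \<omega>) - f (Xe n T \<omega>))\<^sup>2) \<le> K\<^sup>2 * expectation (\<lambda>\<omega>. (norm (Xe (n * m) T \<omega> - Xe n T \<omega>))\<^sup>2)"
    by (intro Lipschitz_diff_sq[OF f] sq_int_diff sq_int_Xe Xe_measurable n nm)
  also have "\<dots> \<le> K\<^sup>2 * (K1 b x0 Lb a T (enat m) * ratio_B (enat m) * (T / real n)\<^sup>2)"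
    by (intro mult_left_mono Xe_diff_sq n m) simp
  also have "K1 b x0 Lb a T (enat m) * ratio_B (enat m) * (T / real n)\<^sup>2 = K1 b x0 Lb a T (enat m) * (real m - 1) * T\<^sup>2 / real m ^ (2 * l - 1)"
  proof -
    \<comment> \<open>With n = m^(l-1) one has m^(2l-1) = m n^2, where the extra m is the
      denominator of \<open>ratio_B\<close>.\<close>
    obtain l' where l': "l = Suc l'" using l by (cases l) auto
    then have "real m ^ (2 * l - 1) = real m * (real n)\<^sup>2"
      by (simp add: n_def power_mult[symmetric] mult.commute)
    then show ?thesis by (simp add: ratio_B_def power_divide)
  qed
  finally show ?thesis by (simp add: ml n_def)
qed

lemma weak_error:
  assumes f: "K-lipschitz_on UNIV f" and n: "1 \<le> n"
  shows "integrable M (\<lambda>\<omega>. f (X T \<omega>))"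
    and "(expectation (\<lambda>\<omega>. f (Xe n T \<omega>)) - expectation (\<lambda>\<omega>. f (X T \<omega>)))\<^sup>2 \<le> K\<^sup>2 * (K1 b x0 Lb a T \<infinity> * T\<^sup>2 / (real n)\<^sup>2)"
proof -
  note d = Lipschitz_diff_sq[OF f X_Xe_diff(1)[OF n] X_measurable Xe_measurable[OF n]]
  have iXe: "integrable M (\<lambda>\<omega>. f (Xe n T \<omega>))"
    by (intro sq_int_imp_integrable sq_int_Lipschitz[OF _ f] sq_int_Xe n)
  from Bochner_Integration.integrable_add[OF sq_int_imp_integrable[OF d(1)] iXe]
  show iX: "integrable M (\<lambda>\<omega>. f (X T \<omega>))" by simp
  have "(expectation (\<lambda>\<omega>. f (Xe n T \<omega>)) - expectation (\<lambda>\<omega>. f (X T \<omega>)))\<^sup>2 = (expectation (\<lambda>\<omega>. f (X T \<omega>) - f (Xe n T \<omega>)))\<^sup>2"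
    using iXe iX by (simp add: power2_commute)
  also have "\<dots> \<le> expectation (\<lambda>\<omega>. (f (X T \<omega>) - f (Xe n T \<omega>))\<^sup>2)" by (rule expectation_sq_le[OF d(1)])
  also have "\<dots> \<le> K\<^sup>2 * expectation (\<lambda>\<omega>. (norm (X T \<omega> - Xe n T \<omega>))\<^sup>2)" by (rule d(2))
  also have "\<dots> \<le> K\<^sup>2 * (K1 b x0 Lb a T \<infinity> * (T / real n)\<^sup>2)" by (intro mult_left_mono X_Xe_diff(2) n) simp
  finally show "(expectation (\<lambda>\<omega>. f (Xe n T \<omega>)) - expectation (\<lambda>\<omega>. f (X T \<omega>)))\<^sup>2 \<le> K\<^sup>2 * (K1 b x0 Lb a T \<infinity> * T\<^sup>2 / (real n)\<^sup>2)"
    by (simp add: power_divide)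
qed

text \<open>The samples live on P and the schemes on M, so all moments are transported through
  equality of laws, level by level; independence on P then makes the variances add.\<close>

lemma mlmc_moments:
  fixes F C :: "nat \<Rightarrow> nat \<Rightarrow> 'v \<Rightarrow> real ^ 'd" and N :: "nat \<Rightarrow> nat"
  assumes f: "bounded_gradient f f1 K" and m: "1 \<le> m" and N: "\<forall>l\<le>L. 1 \<le> N l"
    and S: "mlmc_samples P M Xe T m L N F C"
  shows "sq_int P (mlmc_estimator f L N F C)"
    and "integral\<^sup>L P (mlmc_estimator f L N F C) = expectation (\<lambda>\<omega>. f (Xe (m ^ L) T \<omega>))"
    and "(\<integral>\<omega>. (mlmc_estimator f L N F C \<omega>)\<^sup>2 \<partial>P) - (integral\<^sup>L P (mlmc_estimator f L N F C))\<^sup>2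
      \<le> K\<^sup>2 * (T / real (N 0) + (\<Sum>l=1..L. K1 b x0 Lb a T (enat m) * (real m - 1) * T\<^sup>2 / (real (N l) * real m ^ (2 * l - 1))))"
proof -
  interpret P: prob_space P using S by (simp add: mlmc_samples_def)
  define I where "I = (SIGMA l:{0..L}. {1..N l})"
  \<comment> \<open>The constant 0 at level 0 mirrors the independence clause of
    \<open>mlmc_samples\<close>; \<open>g 0\<close> does not look at it.\<close>
  define Z where "Z i \<omega> = (F (fst i) (snd i) \<omega>, if fst i = 0 then 0 else C (fst i) (snd i) \<omega>)" for i \<omega>
  define g where "g l z = (if l = 0 then f (fst z) else f (fst z) - f (snd z))" for l :: nat and z
  define V where "V l \<omega> = (if l = 0 then f (Xe 1 T \<omega>) else f (Xe (m ^ l) T \<omega>) - f (Xe (m ^ (l - 1)) T \<omega>))" for l \<omega>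
  define v where "v l = (if l = 0 then T else K1 b x0 Lb a T (enat m) * (real m - 1) * T\<^sup>2 / real m ^ (2 * l - 1))" for l
  have lip: "K-lipschitz_on UNIV f" by (rule bounded_gradient_lipschitz[OF f])
  note [measurable] = bounded_gradient_measurable[OF f]
  have gm[measurable]: "g l \<in> borel_measurable borel" for l
    unfolding g_def[abs_def] borel_prod[symmetric] by measurable
  have mp: "1 \<le> m ^ l" for l using m by simp
  have Xm[measurable]: "Xe (m ^ l) T \<in> borel_measurable M" "Xe 1 T \<in> borel_measurable M" for l
    by (intro Xe_measurable mp order_refl)+
  have indZ: "P.indep_vars (\<lambda>_. borel) Z I"
    using S by (simp add: mlmc_samples_def Z_def[abs_def] I_def case_prod_beta')
  then have Zm[measurable]: "Z i \<in> borel_measurable P" if "i \<in> I" for i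
    using that by (simp add: P.indep_vars_def)
  have finI: "finite I" by (simp add: I_def)
  have Vm[measurable]: "V l \<in> borel_measurable M" for l
    unfolding V_def[abs_def] by measurable
  have law: "distr P borel (\<lambda>\<omega>. g l (Z (l, k) \<omega>)) = distr M borel (V l)" if lk: "(l, k) \<in> I" for l k
  proof (cases "l = 0")
    case True
    have Fm[measurable]: "F 0 k \<in> borel_measurable P"
      using measurable_compose[OF Zm[OF lk, unfolded borel_prod[symmetric]] measurable_fst] True by (simp add: Z_def)
    have "distr P borel (F 0 k) = distr M borel (Xe 1 T)"
      using S lk True by (simp add: mlmc_samples_def I_def)
    from arg_cong[OF this, of "\<lambda>D. distr D borel f"]
    have "distr P borel (\<lambda>\<omega>. f (F 0 k \<omega>)) = distr M borel (\<lambda>\<omega>. f (Xe 1 T \<omega>))"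
      by (simp add: distr_distr comp_def del: One_nat_def)
    then show ?thesis using True by (simp add: g_def Z_def V_def[abs_def])
  next
    case False
    have FCm: "(\<lambda>\<omega>. (F l k \<omega>, C l k \<omega>)) \<in> borel_measurable P"
      using Zm[OF lk] False by (simp add: Z_def[abs_def])
    have XXm: "(\<lambda>\<omega>. (Xe (m ^ l) T \<omega>, Xe (m ^ (l - 1)) T \<omega>)) \<in> borel_measurable M"
      unfolding borel_prod[symmetric] by measurable
    have "distr P borel (\<lambda>\<omega>. (F l k \<omega>, C l k \<omega>)) = distr M borel (\<lambda>\<omega>. (Xe (m ^ l) T \<omega>, Xe (m ^ (l - 1)) T \<omega>))"
      using S lk False by (simp add: mlmc_samples_def I_def)
    from arg_cong[OF this, of "\<lambda>D. distr D borel (g l)"]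
    have "distr P borel (\<lambda>\<omega>. g l (F l k \<omega>, C l k \<omega>)) = distr M borel (\<lambda>\<omega>. g l (Xe (m ^ l) T \<omega>, Xe (m ^ (l - 1)) T \<omega>))"
      using FCm XXm by (simp add: distr_distr comp_def)
    then show ?thesis using False by (simp add: g_def Z_def V_def[abs_def])
  qed
  have sqV: "sq_int M (V l)" for l
    unfolding V_def[abs_def]
    by (cases "l = 0") (auto intro!: sq_int_diff sq_int_Lipschitz[OF _ lip] sq_int_Xe mp)
  have EV: "expectation (V l) = (if l = 0 then expectation (\<lambda>\<omega>. f (Xe 1 T \<omega>)) else expectation (\<lambda>\<omega>. f (Xe (m ^ l) T \<omega>)) - expectation (\<lambda>\<omega>. f (Xe (m ^ (l - 1)) T \<omega>)))" for l
  proof -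
    have "integrable M (\<lambda>\<omega>. f (Xe (m ^ l) T \<omega>))" for l
      by (intro sq_int_imp_integrable sq_int_Lipschitz[OF _ lip] sq_int_Xe mp)
    then show ?thesis by (simp add: V_def[abs_def])
  qed
  have varV: "expectation (\<lambda>\<omega>. (V l \<omega>)\<^sup>2) - (expectation (V l))\<^sup>2 \<le> K\<^sup>2 * v l" for l
  proof (cases "l = 0")
    case True
    then show ?thesis using Xe_1_variance[OF f] by (simp add: V_def[abs_def] v_def mult.commute)
  next
    case False
    \<comment> \<open>At levels l >= 1 the second moment is already of the size of the squared
      strong error, so it can stand in for the variance.\<close>
    have "expectation (\<lambda>\<omega>. (V l \<omega>)\<^sup>2) - (expectation (V l))\<^sup>2 \<le> expectation (\<lambda>\<omega>. (V l \<omega>)\<^sup>2)" by simp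
    also have "\<dots> \<le> K\<^sup>2 * v l"
      using level_second_moment[OF lip m, of l] False by (simp add: V_def v_def)
    finally show ?thesis .
  qed
  define U where "U i \<omega> = 1 / real (N (fst i)) * g (fst i) (Z i \<omega>)" for i \<omega>
  have gZ: "(\<lambda>\<omega>. g l (Z (l, k) \<omega>)) \<in> borel_measurable P" if "(l, k) \<in> I" for l k
    by (rule measurable_compose[OF Zm[OF that] gm])
  have EgZ: "(\<integral>\<omega>. \<phi> (g l (Z (l, k) \<omega>)) \<partial>P) = (\<integral>\<omega>. \<phi> (V l \<omega>) \<partial>M)"
    if "(l, k) \<in> I" "\<phi> \<in> borel_measurable borel" for l k and \<phi> :: "real \<Rightarrow> real"
    using integral_distr[OF gZ[OF that(1)] that(2)] integral_distr[OF Vm that(2), of l] law[OF that(1)] by simp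
  have sqgZ: "sq_int P (\<lambda>\<omega>. g l (Z (l, k) \<omega>))" if lk: "(l, k) \<in> I" for l k
  proof -
    have m2: "(\<lambda>x::real. (norm x)\<^sup>2) \<in> borel_measurable borel" by measurable
    have "integrable P (\<lambda>\<omega>. (norm (g l (Z (l, k) \<omega>)))\<^sup>2) = integrable M (\<lambda>\<omega>. (norm (V l \<omega>))\<^sup>2)"
      using integrable_distr_eq[OF gZ[OF lk] m2] integrable_distr_eq[OF Vm m2, of l] law[OF lk] by simp
    then show ?thesis using sq_int_integrable[OF sqV[of l]] gZ[OF lk] by (simp add: sq_int_def)
  qed
  have sqU: "sq_int P (U i)" if "i \<in> I" for i
    unfolding U_def[abs_def] using sqgZ[of "fst i" "snd i"] that by (intro sq_int_cmult) simp
  have indU: "P.indep_vars (\<lambda>_. borel) U I"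
    unfolding U_def[abs_def]
    by (rule P.indep_vars_compose2[OF indZ, of "\<lambda>i z. 1 / real (N (fst i)) * g (fst i) z"]) measurable
  have levels: "{0..L} = insert 0 {1..L}" by auto
  have est: "mlmc_estimator f L N F C = (\<lambda>\<omega>. \<Sum>i\<in>I. U i \<omega>)"
  proof (rule ext)
    fix \<omega>
    have "(\<Sum>i\<in>I. U i \<omega>) = (\<Sum>l\<in>{0..L}. \<Sum>k\<in>{1..N l}. 1 / real (N l) * g l (Z (l, k) \<omega>))"
      unfolding I_def by (subst sum.Sigma) (auto simp: U_def case_prod_beta' intro!: sum.cong)
    also have "\<dots> = mlmc_estimator f L N F C \<omega>"
      unfolding levels by (subst sum.insert)
        (auto simp: mlmc_estimator_def g_def Z_def sum_distrib_left intro!: sum.cong)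
    finally show "mlmc_estimator f L N F C \<omega> = (\<Sum>i\<in>I. U i \<omega>)" by simp
  qed
  show "sq_int P (mlmc_estimator f L N F C)" unfolding est by (intro sq_int_sum sqU)
  \<comment> \<open>Applied with c l = E V l for the mean, and with c l = K^2 v l / N l for the
    variance, where one of the two factors 1 / N l survives the summation over samples.\<close>
  have avg: "(\<Sum>i\<in>I. c (fst i) / real (N (fst i))) = (\<Sum>l\<in>{0..L}. c l)" for c :: "nat \<Rightarrow> real"
  proof -
    have "(\<Sum>i\<in>I. c (fst i) / real (N (fst i))) = (\<Sum>l\<in>{0..L}. \<Sum>k\<in>{1..N l}. c l / real (N l))"
      unfolding I_def by (subst sum.Sigma) (auto simp: case_prod_beta' intro!: sum.cong)
    also have "\<dots> = (\<Sum>l\<in>{0..L}. c l)"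
    proof (rule sum.cong[OF refl])
      fix l assume "l \<in> {0..L}"
      then have "1 \<le> N l" using N by simp
      then show "(\<Sum>k\<in>{1..N l}. c l / real (N l)) = c l" by simp
    qed
    finally show ?thesis .
  qed
  have EU: "integral\<^sup>L P (U i) = expectation (V (fst i)) / real (N (fst i))" if "i \<in> I" for i
    using EgZ[of "fst i" "snd i" "\<lambda>x. x"] that by (simp add: U_def[abs_def])
  have "integral\<^sup>L P (mlmc_estimator f L N F C) = (\<Sum>i\<in>I. expectation (V (fst i)) / real (N (fst i)))"
    unfolding est using EU by (subst Bochner_Integration.integral_sum) (auto intro: P.sq_int_imp_integrable sqU)
  also have "\<dots> = (\<Sum>l\<in>{0..L}. expectation (V l))" by (rule avg)
  \<comment> \<open>The level means telescope; the coarse scheme of level 1 has m^0 = 1 step and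
    meets the level-0 term.\<close>
  also have "\<dots> = expectation (\<lambda>\<omega>. f (Xe (m ^ L) T \<omega>))"
    by (induction L) (simp_all add: EV)
  finally show "integral\<^sup>L P (mlmc_estimator f L N F C) = expectation (\<lambda>\<omega>. f (Xe (m ^ L) T \<omega>))" .
  have "(\<integral>\<omega>. (mlmc_estimator f L N F C \<omega>)\<^sup>2 \<partial>P) - (integral\<^sup>L P (mlmc_estimator f L N F C))\<^sup>2
    = (\<Sum>i\<in>I. (\<integral>\<omega>. (U i \<omega>)\<^sup>2 \<partial>P) - (integral\<^sup>L P (U i))\<^sup>2)"
    unfolding est by (rule P.variance_indep_sum[OF finI indU sqU])
  also have "\<dots> \<le> (\<Sum>i\<in>I. (K\<^sup>2 * v (fst i) / real (N (fst i))) / real (N (fst i)))"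
  proof (rule sum_mono)
    fix i assume i: "i \<in> I"
    have "(\<integral>\<omega>. (U i \<omega>)\<^sup>2 \<partial>P) = expectation (\<lambda>\<omega>. (V (fst i) \<omega>)\<^sup>2) / (real (N (fst i)))\<^sup>2"
      using EgZ[of "fst i" "snd i" "\<lambda>x. x\<^sup>2"] i by (simp add: U_def power_divide)
    then have "(\<integral>\<omega>. (U i \<omega>)\<^sup>2 \<partial>P) - (integral\<^sup>L P (U i))\<^sup>2 = (expectation (\<lambda>\<omega>. (V (fst i) \<omega>)\<^sup>2) - (expectation (V (fst i)))\<^sup>2) / (real (N (fst i)))\<^sup>2"
      by (simp add: EU[OF i] power_divide diff_divide_distrib)
    also have "\<dots> \<le> K\<^sup>2 * v (fst i) / (real (N (fst i)))\<^sup>2" by (intro divide_right_mono varV) simp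
    finally show "(\<integral>\<omega>. (U i \<omega>)\<^sup>2 \<partial>P) - (integral\<^sup>L P (U i))\<^sup>2 \<le> (K\<^sup>2 * v (fst i) / real (N (fst i))) / real (N (fst i))"
      by (simp add: power2_eq_square)
  qed
  also have "\<dots> = (\<Sum>l\<in>{0..L}. K\<^sup>2 * v l / real (N l))" by (rule avg)
  also have "\<dots> = K\<^sup>2 * (T / real (N 0) + (\<Sum>l=1..L. K1 b x0 Lb a T (enat m) * (real m - 1) * T\<^sup>2 / (real (N l) * real m ^ (2 * l - 1))))"
    unfolding levels by (subst sum.insert) (auto simp: v_def distrib_left sum_distrib_left mult.commute intro!: sum.cong)
  finally show "(\<integral>\<omega>. (mlmc_estimator f L N F C \<omega>)\<^sup>2 \<partial>P) - (integral\<^sup>L P (mlmc_estimator f L N F C))\<^sup>2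
      \<le> K\<^sup>2 * (T / real (N 0) + (\<Sum>l=1..L. K1 b x0 Lb a T (enat m) * (real m - 1) * T\<^sup>2 / (real (N l) * real m ^ (2 * l - 1))))" .
qed

end

theorem proposition2p2:
  fixes M :: "'w measure" and P :: "'v measure"
    and W X :: "real \<Rightarrow> 'w \<Rightarrow> real ^ 'd::finite"
    and Xe :: "nat \<Rightarrow> real \<Rightarrow> 'w \<Rightarrow> real ^ 'd"
    and F C :: "nat \<Rightarrow> nat \<Rightarrow> 'v \<Rightarrow> real ^ 'd"
    and b :: "real ^ 'd \<Rightarrow> real ^ 'd" and f :: "real ^ 'd \<Rightarrow> real"
    and x0 :: "real ^ 'd" and T Lb a Lf :: real
    and m L :: nat and N :: "nat \<Rightarrow> nat"
  assumes "0 < T"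
    and "brownian_motion M W"
    and "sde_solution M W b x0 T X"
    and "\<And>n. n \<ge> 1 \<Longrightarrow> euler_scheme M W b x0 T n (Xe n)"
    and "R1 b x0 Lb a"
    and "C1_map f" and "Lf-lipschitz_on UNIV f"
    and "m \<ge> 1" and "L \<ge> 1" and "\<And>l. l \<le> L \<Longrightarrow> N l \<ge> 1"
    and "mlmc_samples P M Xe T m L N F C"
  shows "integrable M (\<lambda>\<omega>. f (X T \<omega>))
    \<and> integrable P (\<lambda>\<omega>. (mlmc_estimator f L N F C \<omega> - (LINT \<omega>'|M. f (X T \<omega>')))\<^sup>2)
    \<and> (LINT \<omega>|P. (mlmc_estimator f L N F C \<omega> - (LINT \<omega>'|M. f (X T \<omega>')))\<^sup>2)
      \<le> Lf\<^sup>2 * (K1 b x0 Lb a T \<infinity> * T\<^sup>2 / real m ^ (2 * L) + T / real (N 0)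
          + (\<Sum>l=1..L. K1 b x0 Lb a T (enat m) * (real m - 1) * T\<^sup>2
                        / (real (N l) * real m ^ (2 * l - 1))))"
proof -
  interpret additive_sde M W X Xe b x0 T Lb a
  proof -
    have "prob_space M" using assms(2) by (simp add: brownian_motion_def)
    then show "additive_sde M W X Xe b x0 T Lb a"
      using assms(1-5) by (simp add: additive_sde_def additive_sde_axioms_def)
  qed
  interpret P: prob_space P using assms(11) by (simp add: mlmc_samples_def)
  obtain f1 where f: "bounded_gradient f f1 Lf"
    by (rule C1_lipschitz_bounded_gradient[OF assms(6,7)])
  have mL: "1 \<le> m ^ L" using assms(8) by simp
  have "\<forall>l\<le>L. 1 \<le> N l" using assms(10) by blast
  note mom = mlmc_moments[OF f assms(8) this assms(11)]
  note weak = weak_error[OF assms(7) mL]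
  let ?c = "LINT \<omega>'|M. f (X T \<omega>')"
  have "sq_int P (\<lambda>\<omega>. mlmc_estimator f L N F C \<omega> - ?c)" by (intro sq_int_diff mom(1) P.sq_int_const)
  then have int: "integrable P (\<lambda>\<omega>. (mlmc_estimator f L N F C \<omega> - ?c)\<^sup>2)"
    using sq_int_integrable by fastforce
  \<comment> \<open>Variance plus squared bias. By telescoping the bias is that of the finest scheme
    alone, with m^L steps against the solution, hence the constant at infinity.\<close>
  have "(LINT \<omega>|P. (mlmc_estimator f L N F C \<omega> - ?c)\<^sup>2)
    \<le> Lf\<^sup>2 * (T / real (N 0) + (\<Sum>l=1..L. K1 b x0 Lb a T (enat m) * (real m - 1) * T\<^sup>2 / (real (N l) * real m ^ (2 * l - 1))))
      + Lf\<^sup>2 * (K1 b x0 Lb a T \<infinity> * T\<^sup>2 / (real (m ^ L))\<^sup>2)"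
    unfolding P.mean_square_error[OF mom(1)] using mom(2,3) weak(2) by (intro add_mono) auto
  also have "(real (m ^ L))\<^sup>2 = real m ^ (2 * L)" by (simp add: power_mult[symmetric] mult.commute)
  finally show ?thesis using weak(1) int by (simp add: algebra_simps)
qed


end
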